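(* Let $K$ be a number field, let $S$ be a finite set of places of $K$, and let $\varphi:\mathbb{P}^1\to\mathbb{P}^1$ be a rational map of degree at least two defined over $K$. Let $Z\subset\mathbb{P}^1(K)$ be a finite set of points, and let $P\in\mathbb{P}^1(K)$. Then \[ \mathcal{O}_\varphi(P)\cap Z(K) \;=\; \mathrm{C}_S\bigl(\mathcal{O}_\varphi(P)\bigr)\cap Z(\mathsf{A}'_{K,S}). \]
   Context: For a place $v$ of $K$, $K_v$ denotes the completion of $K$ at $v$. The $\varphi$-orbit of $P$ is $\mathcal{O}_\varphi(P)=\{P,\varphi(P),\varphi^2(P),\dots\}\subset\mathbb{P}^1(K)$. Let $\mathsf{A}'_{K,S}=\prod'_{v\notin S}K_v$ be the restricted product (adèles with the places in $S$ removed). The set of $\mathsf{A}'_{K,S}$-points of $\mathbb{P}^1$ is identified with $\prod_{v\notin S}\mathbb{P}^1(K_v)$ equipped with the product topology (each $\mathbb{P}^1(K_v)$ with its $v$-adic topology), and $\mathbb{P}^1(K)$ embeds diagonally into it. $\mathrm{C}_S(\mathcal{O}_\varphi(P))$ denotes the closure of the diagonally embedded orbit $\mathcal{O}_\varphi(P)$ in $\prod_{v\notin S}\mathbb{P}^1(K_v)$. For the finite set $Z$, $Z(\mathsf{A}'_{K,S})=\prod_{v\notin S}Z\subset\prod_{v\notin S}\mathbb{P}^1(K_v)$, i.e. the adelic points $(z_v)_{v\notin S}$ with every $z_v\in Z$; and $\mathcal{O}_\varphi(P)\cap Z(K)$ is identified with its diagonal image. *)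

theory Defs
  imports "HOL-Analysis.Analysis" "HOL-Computational_Algebra.Polynomial"
begin

definition is_number_field :: "'k::field_char_0 itself \<Rightarrow> bool" where
  "is_number_field _ \<longleftrightarrow>
     (\<exists>B :: 'k list. \<forall>x :: 'k. \<exists>q :: rat list.
        length q = length B \<and> x = (\<Sum>i<length B. of_rat (q ! i) * B ! i))"

definition is_abs_val :: "('k::field \<Rightarrow> real) \<Rightarrow> bool" where
  "is_abs_val a \<longleftrightarrow>
     (\<forall>x. a x \<ge> 0) \<and> (\<forall>x. a x = 0 \<longleftrightarrow> x = 0) \<and>
     (\<forall>x y. a (x * y) = a x * a y) \<and> (\<forall>x y. a (x + y) \<le> a x + a y)"

definition nontrivial_abs_val :: "('k::field \<Rightarrow> real) \<Rightarrow> bool" where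
  "nontrivial_abs_val a \<longleftrightarrow> is_abs_val a \<and> (\<exists>x. x \<noteq> 0 \<and> a x \<noteq> 1)"

definition equiv_abs_val :: "('k::field \<Rightarrow> real) \<Rightarrow> ('k \<Rightarrow> real) \<Rightarrow> bool" where
  "equiv_abs_val a b \<longleftrightarrow> (\<exists>c>0. \<forall>x. b x = a x powr c)"

definition places :: "('k::field \<Rightarrow> real) set set" where
  "places = {v. \<exists>a. nontrivial_abs_val a \<and>
                     v = {b. nontrivial_abs_val b \<and> equiv_abs_val a b}}"

text \<open>P^1(K) is represented as 'k option; None is the point at infinity.\<close>

fun chordal :: "('k::field \<Rightarrow> real) \<Rightarrow> 'k option \<Rightarrow> 'k option \<Rightarrow> real" where
  "chordal a None None = 0"
| "chordal a None (Some y) = 1 / max 1 (a y)"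
| "chordal a (Some x) None = 1 / max 1 (a x)"
| "chordal a (Some x) (Some y) = a (x - y) / (max 1 (a x) * max 1 (a y))"

definition P1_topology_abs :: "('k::field \<Rightarrow> real) \<Rightarrow> 'k option topology" where
  "P1_topology_abs a =
     topology (\<lambda>U. \<forall>x\<in>U. \<exists>e>0. \<forall>y. chordal a x y < e \<longrightarrow> y \<in> U)"

text \<open>The v-adic topology on P^1(K) for a place v (independent of the representative).\<close>
definition P1_topology :: "('k::field \<Rightarrow> real) set \<Rightarrow> 'k option topology" where
  "P1_topology v = P1_topology_abs (SOME a. a \<in> v)"

fun rat_map :: "'k::field poly \<Rightarrow> 'k poly \<Rightarrow> 'k option \<Rightarrow> 'k option" where
  "rat_map f g None =
     (if degree g < degree f then None else Some (coeff f (degree g) / lead_coeff g))"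
| "rat_map f g (Some x) =
     (if poly g x = 0 then None else Some (poly f x / poly g x))"

definition orbit :: "('a \<Rightarrow> 'a) \<Rightarrow> 'a \<Rightarrow> 'a set" where
  "orbit \<phi> P = {(\<phi> ^^ n) P | n. True}"

definition diag :: "'b set \<Rightarrow> 'a \<Rightarrow> ('b \<Rightarrow> 'a)" where
  "diag I x = restrict (\<lambda>_. x) I"

end

(*
  Suppose (z_v) lies in the closure of the orbit x_n = phi^n(P) but is not the diagonal image of an
  orbit point. Then P is wandering, and for each place v outside S, each precision and each N some
  x_n with n >= N is v-adically close to z_v. If v is a prime of good reduction and x_r = x_s modulo
  v^e with r > s, the orbit is periodic modulo v^e from s on, with period r - s, and z_v lies on the
  cycle; hence phi^(r-s)(z_v) = z_v modulo v^e, and x_s is congruent to a point of the orbit of z_v.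
  Writing D(x, y) for the determinant of almost coprime coordinates, it follows that, away from a
  finite set of places, D(x_r, x_s) divides the product of all D(phi^(r-s)(z), z) over the wandering
  z in Z and of all D(x_s, w) over w in the finite orbits of points of Z. The norm of this product
  grows like exp(O(deg^(r-s))), where the implied constant does not depend on s. On the other hand
  the norm of D(x_r, x_s) is at least a constant times H(x_r), i.e. exp(c deg^r), unless x_r is close
  to x_s at one of the excluded places; each of these places can spoil only boundedly many s, because
  x_r cannot be close to two different points. So a large s from a fixed finite list gives a
  contradiction as r tends to infinity. No Diophantine approximation theorem is needed.
*)
theory Submission
  imports Defs "Jordan_Normal_Form.Char_Poly"
begin

unbundle no vec_syntax
hide_const (open) Finite_Cartesian_Product.vec

section \<open>Simultaneous triangularization\<close>

text \<open>Every coordinate of a point of \<open>Z\<close> is \<open>K\<close>-rational, so the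
  closure may be taken inside the product of the spaces P^1(K) with their v-adic topologies. The
  obstacle is arithmetic: the argument wants factorization, heights and a product formula at once.
  All three are drawn from one order \<open>A\<close> of \<open>K\<close>. Inverting a suitable
  natural number \<open>m\<close> turns \<open>A\<close> into a ring \<open>R\<close> with Bezout
  identities and prime decompositions, over which the map has good reduction; \<open>m\<close> is
  also chosen in the maximal ideal of every finite place of \<open>S\<close>, so each prime of
  \<open>R\<close> gives a place outside \<open>S\<close>. Norms of elements of \<open>A\<close> are
  ordinary integers, and comparing the archimedean size of such an integer with its factor prime to
  \<open>m\<close> acts as the product formula. There a linear dependence among any
  \<open>n + 1\<close> elements of \<open>K\<close> bounds the number of bad points. Hence the list
  of \<open>n + card (prime_factors m) * n + 1\<close> orbit points: one bad point for each of the
  \<open>n\<close> embeddings, at most \<open>n\<close> for each prime of \<open>m\<close>, and one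
  to spare.\<close>

lemma sum_coeff_linear_factor:
  fixes q :: "complex poly"
  assumes "degree q < N"
  shows "(\<Sum>k\<le>N. coeff ([:- m, 1:] * q) k * a k) =
         (\<Sum>k\<le>N. coeff q k * a (Suc k)) - m * (\<Sum>k\<le>N. coeff q k * a k)"
proof -
  have "(\<Sum>k\<le>N. coeff (pCons 0 q) k * a k) = (\<Sum>k<N. coeff q k * a (Suc k))"
    by (subst sum.atMost_shift) simp
  also have "\<dots> = (\<Sum>k\<le>N. coeff q k * a (Suc k))"
    using assms by (simp add: lessThan_Suc_atMost[symmetric] coeff_eq_0)
  finally have *: "(\<Sum>k\<le>N. coeff (pCons 0 q) k * a k) = (\<Sum>k\<le>N. coeff q k * a (Suc k))" .
  have "[:- m, 1:] * q = pCons 0 q - Polynomial.smult m q"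
    by simp
  then show ?thesis
    using * by (simp add: algebra_simps sum_subtractf sum_distrib_left)
qed

text \<open>Arbitrary matrix representations are allowed, and not only the regular one, because the
  triangularization recurses on the quotient by a common eigenvector, which is again a
  representation.\<close>

definition mat_rep :: "nat \<Rightarrow> ('k::field_char_0 \<Rightarrow> complex mat) \<Rightarrow> bool" where
  "mat_rep n M \<longleftrightarrow> (\<forall>x. M x \<in> carrier_mat n n) \<and> (\<forall>x y. M (x + y) = M x + M y) \<and>
     (\<forall>x y. M (x * y) = M x * M y) \<and> M 1 = 1\<^sub>m n"

lemma mat_repD:
  assumes "mat_rep n M"
  shows "M x \<in> carrier_mat n n" "M (x + y) = M x + M y" "M (x * y) = M x * M y" "M 1 = 1\<^sub>m n"
  using assms by (auto simp: mat_rep_def)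

text \<open>Take an annihilating polynomial of \<open>v\<close> of minimal degree; dropping one linear factor gives an eigenvector.\<close>
lemma eigenvector_in_cyclic_span:
  fixes M :: "'k::field_char_0 \<Rightarrow> complex mat" and p :: "complex poly"
  assumes M: "mat_rep n M"
    and v: "v \<in> carrier_vec n" "v \<noteq> 0\<^sub>v n"
    and p: "p \<noteq> 0" "\<And>i. i < n \<Longrightarrow> (\<Sum>k\<le>degree p. coeff p k * (M (x ^ k) *\<^sub>v v) $ i) = 0"
  obtains w \<mu> c N where "w \<in> carrier_vec n" "w \<noteq> 0\<^sub>v n" "M x *\<^sub>v w = \<mu> \<cdot>\<^sub>v w"
    "w = vec n (\<lambda>i. \<Sum>k\<le>N. c k * (M (x ^ k) *\<^sub>v v) $ i)"
proof -
  define N where "N = degree p"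
  define a where "a i k = (M (x ^ k) *\<^sub>v v) $ i" for i k
  define W where "W q = vec n (\<lambda>i. \<Sum>k\<le>N. coeff q k * a i k)" for q :: "complex poly"
  define good where "good q \<longleftrightarrow> q \<noteq> 0 \<and> degree q \<le> N \<and> W q = 0\<^sub>v n" for q :: "complex poly"
  have "good p" using p by (auto simp: good_def N_def W_def a_def)
  then obtain q where q: "good q" and min: "\<And>r. good r \<Longrightarrow> degree q \<le> degree r"
    using ex_has_least_nat[of good p degree] by blast
  \<comment> \<open>A nonzero constant would annihilate the term for \<open>k = 0\<close>, which is
    \<open>v\<close> itself.\<close>
  have "degree q \<noteq> 0"
  proof
    assume "degree q = 0"
    then obtain c where c: "q = [:c:]" by (meson degree_eq_zeroE)
    have "c \<noteq> 0" using q c by (auto simp: good_def)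
    moreover have "c * v $ i = 0" if "i < n" for i
    proof -
      have "(\<Sum>k\<le>N. coeff [:c:] k * a i k) = c * a i 0"
        by (subst sum.atMost_shift) (simp add: coeff_pCons)
      moreover have "(W q) $ i = 0" using q that by (simp add: good_def)
      ultimately show ?thesis
        using that c mat_repD(4)[OF M] v by (simp add: W_def a_def)
    qed
    ultimately have "v = 0\<^sub>v n" using v(1) by (intro eq_vecI) auto
    with v show False by simp
  qed
  then obtain \<mu> where "poly q \<mu> = 0"
    by (metis fundamental_theorem_of_algebra constant_degree)
  then obtain r where r: "q = [:- \<mu>, 1:] * r"
    by (meson dvdE poly_eq_0_iff_dvd)
  have r0: "r \<noteq> 0" using q r by (auto simp: good_def)
  then have dr: "degree q = Suc (degree r)"
    unfolding r by (subst degree_mult_eq) auto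
  have drN: "degree r < N" using dr q by (simp add: good_def)
  have "\<not> good r" using min dr by fastforce
  then have w0: "W r \<noteq> 0\<^sub>v n" using r0 drN by (simp add: good_def)
  have Wc: "W r \<in> carrier_vec n" by (simp add: W_def)
  have "M x *\<^sub>v W r = \<mu> \<cdot>\<^sub>v W r"
  proof (intro eq_vecI)
    fix i assume "i < dim_vec (\<mu> \<cdot>\<^sub>v W r)"
    then have i: "i < n" by (simp add: W_def)
    note c = mat_repD(1)[OF M]
    have step: "(\<Sum>j = 0..<n. M x $$ (i, j) * a j k) = a i (Suc k)" for k
    proof -
      have "M x *\<^sub>v (M (x ^ k) *\<^sub>v v) = M (x ^ Suc k) *\<^sub>v v"
        using mat_repD(3)[OF M, of x "x ^ k"] assoc_mult_mat_vec[OF c c v(1)] by simp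
      moreover have "(M x *\<^sub>v (M (x ^ k) *\<^sub>v v)) $ i = (\<Sum>j = 0..<n. M x $$ (i, j) * a j k)"
        using i c[of x] c[of "x ^ k"] by (auto simp: scalar_prod_def a_def intro!: sum.cong)
      ultimately show ?thesis by (simp add: a_def)
    qed
    have "(M x *\<^sub>v W r) $ i = (\<Sum>j = 0..<n. M x $$ (i, j) * (\<Sum>k\<le>N. coeff r k * a j k))"
      using i c[of x] by (auto simp: scalar_prod_def W_def intro!: sum.cong)
    also have "\<dots> = (\<Sum>k\<le>N. coeff r k * (\<Sum>j = 0..<n. M x $$ (i, j) * a j k))"
      by (subst sum_distrib_left, subst sum.swap) (simp add: sum_distrib_left mult_ac)
    also have "\<dots> = (\<Sum>k\<le>N. coeff q k * a i k) + \<mu> * (\<Sum>k\<le>N. coeff r k * a i k)"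
      unfolding step r sum_coeff_linear_factor[OF drN] by simp
    also have "(\<Sum>k\<le>N. coeff q k * a i k) = W q $ i" using i by (simp add: W_def)
    also have "W q $ i = 0" using q i by (simp add: good_def)
    finally show "(M x *\<^sub>v W r) $ i = (\<mu> \<cdot>\<^sub>v W r) $ i" using i by (simp add: W_def)
  qed (use mat_repD(1)[OF M, of x] in \<open>auto simp: W_def\<close>)
  then show thesis
    using that[OF Wc w0] unfolding W_def a_def by blast
qed

lemma mat_rep_0:
  assumes "mat_rep n M"
  shows "M 0 = 0\<^sub>m n n"
proof (intro eq_matI)
  fix i j assume ij: "i < dim_row (0\<^sub>m n n :: complex mat)" "j < dim_col (0\<^sub>m n n :: complex mat)"
  have "M 0 = M 0 + M 0" using mat_repD(2)[OF assms, of 0 0] by simp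
  then have "M 0 $$ (i,j) = (M 0 + M 0) $$ (i, j)" by simp
  with ij show "M 0 $$ (i,j) = 0\<^sub>m n n $$ (i,j)" 
    using mat_repD(1)[OF assms, of 0] by simp
qed (use mat_repD(1)[OF assms, of 0] in auto)

lemma mat_rep_sum_index:
  assumes M: "mat_rep n M" and "finite F" "i < n" "j < n"
  shows "M (sum f F) $$ (i, j) = (\<Sum>k\<in>F. M (f k) $$ (i, j))"
  using assms(2)
proof (induction F rule: finite_induct)
  case empty
  then show ?case using assms by (simp add: mat_rep_0[OF M])
next
  case (insert a F)
  then show ?case using assms mat_repD(1)[OF M, of "sum f F"]
    by (simp add: mat_repD(2)[OF M])
qed

lemma mat_rep_of_nat:
  assumes M: "mat_rep n M"
  shows "M (of_nat k) = of_nat k \<cdot>\<^sub>m 1\<^sub>m n"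
proof (induction k)
  case 0
  then show ?case by (auto simp: mat_rep_0[OF M])
next
  case (Suc k)
  then show ?case
    by (auto simp: mat_repD(2,4)[OF M] algebra_simps intro!: eq_matI)
qed

lemma mat_rep_of_int:
  assumes M: "mat_rep n M"
  shows "M (of_int k) = of_int k \<cdot>\<^sub>m 1\<^sub>m n"
proof (cases k)
  case (nonneg m)
  then show ?thesis using mat_rep_of_nat[OF M] by simp
next
  case (neg m)
  have "M (of_nat (Suc m)) + M (of_int k) = M 0"
    unfolding mat_repD(2)[OF M, symmetric] neg by simp
  then have "M (of_nat (Suc m)) $$ (i,j) + M (of_int k) $$ (i,j) = 0" if "i < n" "j < n" for i j
    using that mat_rep_0[OF M] mat_repD(1)[OF M, of "of_int k"] 
    by (metis index_add_mat(1) index_zero_mat(1) carrier_matD)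
  then have "M (of_int k) $$ (i,j) = - M (of_nat (Suc m)) $$ (i,j)" if "i < n" "j < n" for i j
    using that by (metis add.inverse_unique)
  then show ?thesis
    unfolding mat_rep_of_nat[OF M] using mat_repD(1)[OF M, of "of_int k"] neg
    by (intro eq_matI) simp_all
qed

lemma mat_rep_of_rat:
  assumes M: "mat_rep n M"
  shows "M (of_rat q) = of_rat q \<cdot>\<^sub>m 1\<^sub>m n"
proof (cases q)
  case (Fract a b)
  have "M (of_int b) * M (of_rat q) = M (of_int a)"
    unfolding mat_repD(3)[OF M, symmetric] using Fract by (simp add: of_rat_rat)
  then have *: "(of_int b \<cdot>\<^sub>m 1\<^sub>m n) * M (of_rat q) = of_int a \<cdot>\<^sub>m 1\<^sub>m n"
    by (simp add: mat_rep_of_int[OF M])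
  have "(of_int b \<cdot>\<^sub>m 1\<^sub>m n) * M (of_rat q) = of_int b \<cdot>\<^sub>m M (of_rat q)"
    using mult_smult_assoc_mat[OF one_carrier_mat mat_repD(1)[OF M], of "of_int b" "of_rat q"]
      left_mult_one_mat[OF mat_repD(1)[OF M]] by simp
  with * have "(of_int b \<cdot>\<^sub>m M (of_rat q)) $$ (i,j) = (of_int a \<cdot>\<^sub>m 1\<^sub>m n) $$ (i,j)" for i j
    by simp
  then have *: "of_int b * M (of_rat q) $$ (i,j) = (if i = j then of_int a else 0)" if "i < n" "j < n" for i j
    using that mat_repD(1)[OF M, of "of_rat q"]
    by (metis carrier_matD index_one_mat(1) index_smult_mat(1) mult.right_neutral mult_zero_right
        one_carrier_mat)
  have b: "b > 0" using Fract by simp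
  have "M (of_rat q) $$ (i,j) = (if i = j then of_rat q else 0)" if "i < n" "j < n" for i j
    using *[OF that] b Fract(1) by (simp add: of_rat_rat field_simps split: if_splits)
  then show ?thesis
    using mat_repD(1)[OF M, of "of_rat q"] by (intro eq_matI) auto
qed

lemma mat_rep_apply_sum:
  assumes M: "mat_rep n M" and "finite F" "i < n" and v: "v \<in> carrier_vec n"
  shows "(M (sum f F) *\<^sub>v v) $ i = (\<Sum>k\<in>F. (M (f k) *\<^sub>v v) $ i)"
proof -
  have ix: "(M x *\<^sub>v v) $ i = (\<Sum>j = 0..<n. M x $$ (i, j) * v $ j)" for x
    using assms(3) v mat_repD(1)[OF M, of x] by (auto simp: scalar_prod_def intro!: sum.cong)
  show ?thesis unfolding ix
    by (subst sum.swap) (auto simp: mat_rep_sum_index[OF M assms(2,3)] sum_distrib_right intro!: sum.cong)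
qed

lemma mat_rep_apply_scale:
  assumes M: "mat_rep n M" and "i < n" and v: "v \<in> carrier_vec n"
  shows "(M (of_rat q * x) *\<^sub>v v) $ i = of_rat q * (M x *\<^sub>v v) $ i"
proof -
  note c = mat_repD(1)[OF M]
  have "M (of_rat q * x) = of_rat q \<cdot>\<^sub>m M x"
    unfolding mat_repD(3)[OF M] mat_rep_of_rat[OF M]
    using mult_smult_assoc_mat[OF one_carrier_mat c, of "of_rat q" x] left_mult_one_mat[OF c] by simp
  then show ?thesis
    using assms c[of x] by (auto simp: scalar_prod_def sum_distrib_left mult_ac intro!: sum.cong)
qed

text \<open>The matrices commute because multiplication in \<open>K\<close> does. Running through a
  finite spanning set, the eigenvector \<open>w\<close> for the next element \<open>x\<close> is
  found in the span of the images of \<open>v\<close> under \<open>M (x ^ k)\<close>; any earlier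
  \<open>b\<close> acts on all of these by the same scalar as on \<open>v\<close>, so
  \<open>w\<close> keeps the old eigenvalues. Algebraicity of \<open>x\<close> supplies the
  annihilating polynomial.\<close>

lemma common_eigenvector:
  fixes M :: "'k::field_char_0 \<Rightarrow> complex mat"
  assumes M: "mat_rep n M" and n: "n > 0"
    and B: "finite B" "\<And>x. \<exists>q :: 'k \<Rightarrow> rat. x = (\<Sum>b\<in>B. of_rat (q b) * b)"
    and alg: "\<And>x :: 'k. \<exists>p :: rat poly. p \<noteq> 0 \<and> poly (map_poly of_rat p) x = 0"
  obtains v s where "v \<in> carrier_vec n" "v \<noteq> 0\<^sub>v n" "\<And>x. M x *\<^sub>v v = s x \<cdot>\<^sub>v v"
proof -
  note c = mat_repD(1)[OF M]
  have "\<exists>v \<in> carrier_vec n. v \<noteq> 0\<^sub>v n \<and> (\<forall>b\<in>F. \<exists>m. M b *\<^sub>v v = m \<cdot>\<^sub>v v)" if "finite F" for F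
    using that
  proof (induction F rule: finite_induct)
    case empty
    have "unit_vec n 0 \<noteq> (0\<^sub>v n :: complex vec)"
      using n by (metis index_unit_vec(2) index_zero_vec(1) zero_neq_one)
    then show ?case by (intro bexI[of _ "unit_vec n 0"]) auto
  next
    case (insert x F)
    then obtain v where v: "v \<in> carrier_vec n" "v \<noteq> 0\<^sub>v n" "\<forall>b\<in>F. \<exists>m. M b *\<^sub>v v = m \<cdot>\<^sub>v v" by blast
    obtain p :: "rat poly" where p: "p \<noteq> 0" "poly (map_poly of_rat p) x = 0" using alg by blast
    define P where "P = map_poly (of_rat :: rat \<Rightarrow> complex) p"
    have dP: "degree P = degree p" and cP: "coeff P k = of_rat (coeff p k)" for k
      by (simp_all add: P_def degree_map_poly coeff_map_poly)
    have "(\<Sum>k\<le>degree P. coeff P k * (M (x ^ k) *\<^sub>v v) $ i) = 0" if i: "i < n" for i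
    proof -
      have "(\<Sum>k\<le>degree P. coeff P k * (M (x ^ k) *\<^sub>v v) $ i) =
            (M (\<Sum>k\<le>degree p. of_rat (coeff p k) * x ^ k) *\<^sub>v v) $ i"
        unfolding dP cP mat_rep_apply_sum[OF M finite_atMost i v(1)] mat_rep_apply_scale[OF M i v(1)] ..
      also have "(\<Sum>k\<le>degree p. of_rat (coeff p k) * x ^ k) = 0"
        using p by (simp add: poly_altdef degree_map_poly coeff_map_poly)
      finally show ?thesis using i v by (simp add: mat_rep_0[OF M])
    qed
    note ann = this
    have "coeff P (degree p) \<noteq> 0" using p(1) cP[of "degree p"] by simp
    then have "P \<noteq> 0" by auto
    then obtain w \<mu> cf N where w: "w \<in> carrier_vec n" "w \<noteq> 0\<^sub>v n" "M x *\<^sub>v w = \<mu> \<cdot>\<^sub>v w"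
      "w = vec n (\<lambda>i. \<Sum>k\<le>N. cf k * (M (x ^ k) *\<^sub>v v) $ i)"
      by (rule eigenvector_in_cyclic_span[OF M v(1,2) _ ann])
    have "\<exists>m. M b *\<^sub>v w = m \<cdot>\<^sub>v w" if b: "b \<in> F" for b
    proof -
      obtain m where m: "M b *\<^sub>v v = m \<cdot>\<^sub>v v" using v(3) b by blast
      have "M b *\<^sub>v w = m \<cdot>\<^sub>v w"
      proof (intro eq_vecI)
        fix i assume "i < dim_vec (m \<cdot>\<^sub>v w)"
        then have i: "i < n" using w(1) by auto
        have step: "(\<Sum>j = 0..<n. M b $$ (i, j) * (M (x ^ k) *\<^sub>v v) $ j) = m * (M (x ^ k) *\<^sub>v v) $ i" for k
        proof -
          have "(\<Sum>j = 0..<n. M b $$ (i, j) * (M (x ^ k) *\<^sub>v v) $ j) = (M b *\<^sub>v (M (x ^ k) *\<^sub>v v)) $ i"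
            using i c[of b] c[of "x ^ k"] by (auto simp: scalar_prod_def intro!: sum.cong)
          also have "M b *\<^sub>v (M (x ^ k) *\<^sub>v v) = M (x ^ k) *\<^sub>v (M b *\<^sub>v v)"
            using assoc_mult_mat_vec[OF c c v(1)] mat_repD(3)[OF M] by (metis mult.commute)
          also have "\<dots> = m \<cdot>\<^sub>v (M (x ^ k) *\<^sub>v v)"
            unfolding m by (rule mult_mat_vec[OF c v(1)])
          finally show ?thesis using i c[of "x ^ k"] by simp
        qed
        have "(M b *\<^sub>v w) $ i = (\<Sum>j = 0..<n. M b $$ (i, j) * (\<Sum>k\<le>N. cf k * (M (x ^ k) *\<^sub>v v) $ j))"
          using i c[of b] w(1) by (subst w(4)) (auto simp: scalar_prod_def intro!: sum.cong)
        also have "\<dots> = (\<Sum>k\<le>N. cf k * (\<Sum>j = 0..<n. M b $$ (i, j) * (M (x ^ k) *\<^sub>v v) $ j))"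
          by (subst sum_distrib_left, subst sum.swap) (simp add: sum_distrib_left mult_ac)
        also have "\<dots> = m * (\<Sum>k\<le>N. cf k * (M (x ^ k) *\<^sub>v v) $ i)"
          unfolding step by (simp add: sum_distrib_left mult_ac)
        finally show "(M b *\<^sub>v w) $ i = (m \<cdot>\<^sub>v w) $ i"
          using i by (simp add: w(4))
      qed (use c[of b] w(1) in auto)
      then show ?thesis by blast
    qed
    then show ?case using w by blast
  qed
  from this[OF B(1)] obtain v m where v: "v \<in> carrier_vec n" "v \<noteq> 0\<^sub>v n"
    and m: "\<And>b. b \<in> B \<Longrightarrow> M b *\<^sub>v v = m b \<cdot>\<^sub>v v" by metis
  have "\<exists>m. M x *\<^sub>v v = m \<cdot>\<^sub>v v" for x
  proof -
    obtain q :: "'k \<Rightarrow> rat" where q: "x = (\<Sum>b\<in>B. of_rat (q b) * b)" using B(2) by blast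
    have "M x *\<^sub>v v = (\<Sum>b\<in>B. of_rat (q b) * m b) \<cdot>\<^sub>v v"
    proof (intro eq_vecI)
      fix i assume "i < dim_vec ((\<Sum>b\<in>B. of_rat (q b) * m b) \<cdot>\<^sub>v v)"
      then have i: "i < n" using v(1) by auto
      have "(M x *\<^sub>v v) $ i = (\<Sum>b\<in>B. of_rat (q b) * (M b *\<^sub>v v) $ i)"
        unfolding q mat_rep_apply_sum[OF M B(1) i v(1)] mat_rep_apply_scale[OF M i v(1)] ..
      also have "\<dots> = (\<Sum>b\<in>B. of_rat (q b) * m b) * v $ i"
        using i v(1) by (simp add: m sum_distrib_left sum_distrib_right mult_ac)
      finally show "(M x *\<^sub>v v) $ i = ((\<Sum>b\<in>B. of_rat (q b) * m b) \<cdot>\<^sub>v v) $ i" using i v(1) by simp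
    qed (use c[of x] v(1) in auto)
    then show ?thesis by blast
  qed
  then show thesis using that v by metis
qed

lemma invertible_with_first_column:
  fixes v :: "complex vec"
  assumes v: "v \<in> carrier_vec n" "v \<noteq> 0\<^sub>v n"
  obtains P Q where "P \<in> carrier_mat n n" "Q \<in> carrier_mat n n" "P * Q = 1\<^sub>m n" "Q * P = 1\<^sub>m n"
    "P *\<^sub>v unit_vec n 0 = v"
proof -
  obtain k where k: "k < n" "v $ k \<noteq> 0"
    using v by (metis carrier_vecD eq_vecI index_zero_vec)
  \<comment> \<open>As \<open>v $ k\<close> is nonzero, \<open>v\<close> can replace the
    \<open>k\<close>-th unit vector in the standard basis and move to the front. Row
    \<open>k\<close> of \<open>P\<close> then has \<open>v $ k\<close> as its only nonzero entry,
    which starts the proof that the kernel is trivial.\<close>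
  define P where "P = mat n n (\<lambda>(i, j). if j = 0 then v $ i else if i = (if j = k then 0 else j) then 1 else (0::complex))"
  have P: "P \<in> carrier_mat n n" by (simp add: P_def)
  have ix: "(P *\<^sub>v w) $ i = v $ i * w $ 0 + (\<Sum>j = 1..<n. if i = (if j = k then 0 else j) then w $ j else 0)"
    if i: "i < n" and w: "w \<in> carrier_vec n" for i w
  proof -
    have "(P *\<^sub>v w) $ i = (\<Sum>j = 0..<n. P $$ (i, j) * w $ j)"
      using i P w by (auto simp: scalar_prod_def intro!: sum.cong)
    also have "\<dots> = P $$ (i, 0) * w $ 0 + (\<Sum>j = 1..<n. P $$ (i, j) * w $ j)"
      using k by (subst sum.atLeast_Suc_lessThan) auto
    finally show ?thesis using i by (auto simp: P_def intro!: sum.cong)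
  qed
  have "det P \<noteq> 0"
  proof
    assume "det P = 0"
    then obtain w where w: "w \<in> carrier_vec n" "w \<noteq> 0\<^sub>v n" "P *\<^sub>v w = 0\<^sub>v n"
      using det_0_iff_vec_prod_zero_field[OF P] by blast
    have z: "v $ i * w $ 0 + (\<Sum>j = 1..<n. if i = (if j = k then 0 else j) then w $ j else 0) = 0" if "i < n" for i
      using ix[OF that w(1)] w(3) that by simp
    have "(\<Sum>j = 1..<n. if k = (if j = k then 0 else j) then w $ j else 0) = 0"
      by (intro sum.neutral) auto
    then have w0: "w $ 0 = 0" using z[OF k(1)] k(2) by simp
    have "w $ j = 0" if j: "j < n" for j
    proof (cases "j = 0")
      case False
      define i where "i = (if j = k then 0 else j)"
      have "(\<Sum>j' = 1..<n. if i = (if j' = k then 0 else j') then w $ j' else 0) =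
            (\<Sum>j' = 1..<n. if j' = j then w $ j' else 0)"
        using False by (intro sum.cong) (auto simp: i_def)
      also have "\<dots> = w $ j" using j False by (simp add: sum.delta)
      finally show ?thesis using z[of i] j w0 by (simp add: i_def split: if_splits)
    qed (use w0 in simp)
    then have "w = 0\<^sub>v n" using w(1) by (intro eq_vecI) auto
    with w show False by simp
  qed
  then have "P \<in> Units (ring_mat TYPE(complex) n ())" by (rule det_non_zero_imp_unit[OF P])
  then obtain Q where Q: "Q \<in> carrier_mat n n" "P * Q = 1\<^sub>m n" "Q * P = 1\<^sub>m n"
    unfolding Units_def by (auto simp: ring_mat_simps)
  have "P *\<^sub>v unit_vec n 0 = v"
  proof (intro eq_vecI)
    fix i assume "i < dim_vec v"
    then have i: "i < n" using v by auto
    have "(\<Sum>j = 1..<n. if i = (if j = k then 0 else j) then unit_vec n 0 $ j else 0) = (0::complex)"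
      using k by (intro sum.neutral) auto
    then show "(P *\<^sub>v unit_vec n 0) $ i = v $ i" using i k ix[OF i, of "unit_vec n 0"] by simp
  qed (use P v in auto)
  with that P Q show thesis by blast
qed

text \<open>A common eigenvector as first basis vector makes every matrix block triangular; the
  corner entry \<open>s0 x\<close> and the lower block \<open>M' x\<close> are then both
  multiplicative in \<open>x\<close>, and induction applies to \<open>M'\<close>. Only the diagonal
  matters later: for the regular representation its entries are embeddings of \<open>K\<close> whose
  product is the norm.\<close>

lemma simultaneous_triangularization:
  fixes M :: "'k::field_char_0 \<Rightarrow> complex mat"
  assumes M: "mat_rep n M"
    and B: "finite B" "\<And>x. \<exists>q :: 'k \<Rightarrow> rat. x = (\<Sum>b\<in>B. of_rat (q b) * b)"
    and alg: "\<And>x :: 'k. \<exists>p :: rat poly. p \<noteq> 0 \<and> poly (map_poly of_rat p) x = 0"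
  shows "\<exists>s :: nat \<Rightarrow> 'k \<Rightarrow> complex. (\<forall>i<n. field_hom (s i)) \<and>
           (\<forall>x. char_poly (M x) = (\<Prod>i<n. [:- s i x, 1:]))"
  using M
proof (induction n arbitrary: M)
  case 0
  have "char_poly (M x) = 1" for x
    using mat_repD(1)[OF 0, of x] by (simp add: char_poly_def char_poly_matrix_def)
  then show ?case by simp
next
  case (Suc n)
  note M = Suc.prems and c = mat_repD(1)[OF Suc.prems]
  obtain v s0 where v: "v \<in> carrier_vec (Suc n)" "v \<noteq> 0\<^sub>v (Suc n)" "\<And>x. M x *\<^sub>v v = s0 x \<cdot>\<^sub>v v"
    using common_eigenvector[OF M _ B alg] by blast
  obtain P Q where P: "P \<in> carrier_mat (Suc n) (Suc n)" and Q: "Q \<in> carrier_mat (Suc n) (Suc n)"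
    and PQ: "P * Q = 1\<^sub>m (Suc n)" and QP: "Q * P = 1\<^sub>m (Suc n)" and Pv: "P *\<^sub>v unit_vec (Suc n) 0 = v"
    using invertible_with_first_column[OF v(1,2)] by metis
  define T where "T x = Q * (M x * P)" for x
  have Tc: "T x \<in> carrier_mat (Suc n) (Suc n)" for x
    unfolding T_def by (rule mult_carrier_mat[OF Q mult_carrier_mat[OF c P]])
  have Tadd: "T (x + y) = T x + T y" for x y
    unfolding T_def mat_repD(2)[OF M]
    by (simp only: add_mult_distrib_mat[OF c c P] mult_add_distrib_mat[OF Q mult_carrier_mat[OF c P] mult_carrier_mat[OF c P]])
  have Tmult: "T (x * y) = T x * T y" for x y
  proof -
    have "T x * T y = Q * ((M x * P) * (Q * (M y * P)))"
      unfolding T_def by (rule assoc_mult_mat[OF Q mult_carrier_mat[OF c P] mult_carrier_mat[OF Q mult_carrier_mat[OF c P]]])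
    also have "(M x * P) * (Q * (M y * P)) = M x * (P * (Q * (M y * P)))"
      by (rule assoc_mult_mat[OF c P mult_carrier_mat[OF Q mult_carrier_mat[OF c P]]])
    also have "P * (Q * (M y * P)) = (P * Q) * (M y * P)"
      by (rule assoc_mult_mat[OF P Q mult_carrier_mat[OF c P], symmetric])
    also have "\<dots> = M y * P"
      unfolding PQ by (rule left_mult_one_mat[OF mult_carrier_mat[OF c P]])
    also have "M x * (M y * P) = M (x * y) * P"
      unfolding mat_repD(3)[OF M] by (rule assoc_mult_mat[OF c c P, symmetric])
    finally show ?thesis by (simp add: T_def)
  qed
  have T1: "T 1 = 1\<^sub>m (Suc n)"
    unfolding T_def mat_repD(4)[OF M] left_mult_one_mat[OF P] by (rule QP)
  have Tcol: "T x $$ (i, 0) = (if i = 0 then s0 x else 0)" if i: "i < Suc n" for x i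
  proof -
    have u: "unit_vec (Suc n) 0 \<in> carrier_vec (Suc n)" by simp
    have "T x *\<^sub>v unit_vec (Suc n) 0 = Q *\<^sub>v ((M x * P) *\<^sub>v unit_vec (Suc n) 0)"
      unfolding T_def by (rule assoc_mult_mat_vec[OF Q mult_carrier_mat[OF c P] u])
    also have "(M x * P) *\<^sub>v unit_vec (Suc n) 0 = s0 x \<cdot>\<^sub>v (P *\<^sub>v unit_vec (Suc n) 0)"
      using assoc_mult_mat_vec[OF c P u] Pv v(3) by simp
    also have "Q *\<^sub>v \<dots> = s0 x \<cdot>\<^sub>v (Q *\<^sub>v (P *\<^sub>v unit_vec (Suc n) 0))"
      by (rule mult_mat_vec[OF Q]) (use P in auto)
    also have "Q *\<^sub>v (P *\<^sub>v unit_vec (Suc n) 0) = unit_vec (Suc n) 0"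
      using assoc_mult_mat_vec[OF Q P u] unfolding QP by simp
    finally have "(T x *\<^sub>v unit_vec (Suc n) 0) $ i = (s0 x \<cdot>\<^sub>v unit_vec (Suc n) 0) $ i" by simp
    moreover have "(T x *\<^sub>v unit_vec (Suc n) 0) $ i = T x $$ (i, 0)"
      using Tc[of x] i by (simp add: scalar_prod_right_unit)
    ultimately show ?thesis using i by simp
  qed
  define M' where "M' x = mat n n (\<lambda>(i, j). T x $$ (Suc i, Suc j))" for x
  have M'mult: "M' (x * y) = M' x * M' y" for x y
  proof (intro eq_matI)
    fix i j assume "i < dim_row (M' x * M' y)" "j < dim_col (M' x * M' y)"
    then have ij: "i < n" "j < n" by (auto simp: M'_def)
    have "M' (x * y) $$ (i, j) = (\<Sum>k = 0..<Suc n. T x $$ (Suc i, k) * T y $$ (k, Suc j))"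
      using ij Tc[of x] Tc[of y] by (auto simp: M'_def Tmult scalar_prod_def intro!: sum.cong)
    also have "\<dots> = (\<Sum>k = 0..<n. T x $$ (Suc i, Suc k) * T y $$ (Suc k, Suc j))"
      using ij by (subst sum.atLeast0_lessThan_Suc_shift) (simp add: Tcol)
    finally show "M' (x * y) $$ (i, j) = (M' x * M' y) $$ (i, j)"
      using ij by (auto simp: M'_def scalar_prod_def intro!: sum.cong)
  qed (auto simp: M'_def)
  have M': "mat_rep n M'"
    unfolding mat_rep_def
  proof (intro conjI allI)
    fix x y
    show "M' (x + y) = M' x + M' y"
      using Tc[of x] Tc[of y] by (intro eq_matI) (auto simp: M'_def Tadd)
  next
    show "M' 1 = 1\<^sub>m n" by (intro eq_matI) (auto simp: M'_def T1)
  qed (auto simp: M'mult, auto simp: M'_def)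
  obtain s where s: "\<forall>i<n. field_hom (s i)" "\<forall>x. char_poly (M' x) = (\<Prod>i<n. [:- s i x, 1:])"
    using Suc.IH[OF M'] by blast
  have s0_add: "s0 (x + y) = s0 x + s0 y" for x y
    using Tcol[of 0 "x + y"] Tcol[of 0 x] Tcol[of 0 y] Tc[of x] Tc[of y] by (simp add: Tadd)
  have s0_mult: "s0 (x * y) = s0 x * s0 y" for x y
  proof -
    have "T (x * y) $$ (0, 0) = (\<Sum>k = 0..<Suc n. T x $$ (0, k) * T y $$ (k, 0))"
      using Tc[of x] Tc[of y] by (auto simp: Tmult scalar_prod_def intro!: sum.cong)
    also have "\<dots> = s0 x * s0 y"
      by (subst sum.atLeast0_lessThan_Suc_shift) (simp add: Tcol)
    finally show ?thesis by (simp add: Tcol)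
  qed
  have s0_1: "s0 1 = 1" using Tcol[of 0 1] by (simp add: T1)
  have s0_0: "s0 0 = 0" using s0_add[of 0 0] by simp
  have s0_hom: "field_hom s0"
    by unfold_locales (auto simp: s0_add s0_mult s0_1 s0_0)
  have cp: "char_poly (M x) = [:- s0 x, 1:] * char_poly (M' x)" for x
  proof -
    have "similar_mat (T x) (M x)"
      by (rule similar_matI[of _ _ Q P "Suc n"])
        (use c P Q PQ QP Tc in \<open>auto simp: T_def assoc_mult_mat[OF Q c P]\<close>)
    then have "char_poly (M x) = char_poly (T x)" by (simp add: char_poly_similar)
    also have "T x = four_block_mat (mat 1 1 (\<lambda>_. s0 x)) (mat 1 n (\<lambda>(i, j). T x $$ (0, Suc j))) (0\<^sub>m n 1) (M' x)"
      using Tc[of x] by (intro eq_matI) (auto simp: M'_def Tcol four_block_mat_def Let_def)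
    also have "char_poly \<dots> = char_poly (mat 1 1 (\<lambda>_. s0 x)) * char_poly (M' x)"
      by (rule char_poly_four_block_zeros_col) (auto simp: M'_def)
    also have "char_poly (mat 1 1 (\<lambda>_. s0 x)) = [:- s0 x, 1:]"
      by (simp add: char_poly_defs det_def sign_def)
    finally show ?thesis .
  qed
  show ?case
  proof (intro exI[of _ "\<lambda>i. case i of 0 \<Rightarrow> s0 | Suc j \<Rightarrow> s j"] conjI allI impI)
    fix i assume "i < Suc n"
    then show "field_hom (case i of 0 \<Rightarrow> s0 | Suc j \<Rightarrow> s j)"
      using s(1) s0_hom by (cases i) auto
  next
    fix x
    show "char_poly (M x) = (\<Prod>i<Suc n. [:- (case i of 0 \<Rightarrow> s0 | Suc j \<Rightarrow> s j) x, 1:])"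
      unfolding cp by (subst prod.lessThan_Suc_shift) (simp add: s(2))
  qed
qed

section \<open>Orders of number fields\<close>

text \<open>A spanning family of least length is independent, since a relation with
  \<open>q k\<close> nonzero would eliminate the member \<open>b k\<close>; \<open>e\<close>
  enumerates the remaining indices.\<close>

lemma number_field_basis:
  assumes "is_number_field TYPE('k::field_char_0)"
  obtains n :: nat and b :: "nat \<Rightarrow> 'k::field_char_0"
  where "\<And>x. \<exists>q :: nat \<Rightarrow> rat. x = (\<Sum>i<n. of_rat (q i) * b i)"
    and "\<And>q :: nat \<Rightarrow> rat. (\<Sum>i<n. of_rat (q i) * b i) = 0 \<Longrightarrow> (\<forall>i<n. q i = 0)"
proof -
  define sp where "sp n b \<longleftrightarrow> (\<forall>x. \<exists>q :: nat \<Rightarrow> rat. x = (\<Sum>i<n. of_rat (q i) * b i))"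
    for n and b :: "nat \<Rightarrow> 'k"
  obtain l :: "'k list" where l: "\<And>x. \<exists>q :: rat list.
      length q = length l \<and> x = (\<Sum>i<length l. of_rat (q ! i) * l ! i)"
    using assms unfolding is_number_field_def by blast
  have "sp (length l) (\<lambda>i. l ! i)"
    unfolding sp_def
  proof
    fix x
    obtain q :: "rat list" where "x = (\<Sum>i<length l. of_rat (q ! i) * l ! i)" using l by blast
    then show "\<exists>q :: nat \<Rightarrow> rat. x = (\<Sum>i<length l. of_rat (q i) * l ! i)"
      by (intro exI[of _ "\<lambda>i. q ! i"])
  qed
  then have ex: "\<exists>n b. sp n b" by blast
  define n where "n = (LEAST n. \<exists>b. sp n b)"
  obtain b where b: "sp n b" unfolding n_def using LeastI_ex[OF ex] by blast
  have min: "n \<le> m" if "sp m c" for m c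
    unfolding n_def by (rule Least_le) (use that in blast)
  have "\<forall>i<n. q i = 0" if q: "(\<Sum>i<n. of_rat (q i) * b i) = 0" for q :: "nat \<Rightarrow> rat"
  proof (rule ccontr)
    assume "\<not> (\<forall>i<n. q i = 0)"
    then obtain k where k: "k < n" "q k \<noteq> 0" by blast
    define e where "e i = (if i < k then i else Suc i)" for i
    have bij: "bij_betw e {..<n - 1} ({..<n} - {k})"
      by (rule bij_betw_byWitness[of _ "\<lambda>i. if i < k then i else i - 1"])
        (use k in \<open>auto simp: e_def split: if_splits\<close>)
    have "sp (n - 1) (\<lambda>i. b (e i))"
      unfolding sp_def
    proof
      fix x
      obtain r :: "nat \<Rightarrow> rat" where r: "x = (\<Sum>i<n. of_rat (r i) * b i)" using b sp_def by blast
      define d where "d i = r i - r k / q k * q i" for i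
      have "x = (\<Sum>i<n. of_rat (r i) * b i) - of_rat (r k / q k) * (\<Sum>i<n. of_rat (q i) * b i)"
        using r q by simp
      also have "\<dots> = (\<Sum>i<n. of_rat (d i) * b i)"
        unfolding d_def sum_distrib_left sum_subtractf[symmetric] of_rat_diff of_rat_mult
        by (simp only: left_diff_distrib mult.assoc)
      also have "\<dots> = (\<Sum>i\<in>{..<n} - {k}. of_rat (d i) * b i)"
        using k by (subst sum.remove[of _ k]) (auto simp: d_def)
      also have "\<dots> = (\<Sum>i<n - 1. of_rat (d (e i)) * b (e i))"
        by (rule sum.reindex_bij_betw[OF bij, symmetric])
      finally show "\<exists>q :: nat \<Rightarrow> rat. x = (\<Sum>i<n - 1. of_rat (q i) * b (e i))"
        by (intro exI[of _ "\<lambda>i. d (e i)"])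
    qed
    from min[OF this] k show False by simp
  qed
  with that b show thesis unfolding sp_def by blast
qed

lemma common_denominator:
  fixes q :: "'i \<Rightarrow> rat"
  assumes "finite F"
  obtains k :: nat where "k > 0" "\<And>i. i \<in> F \<Longrightarrow> of_nat k * q i \<in> \<int>"
proof -
  have "\<exists>k::nat>0. \<forall>i\<in>F. of_nat k * q i \<in> \<int>"
    using assms
  proof (induction F rule: finite_induct)
    case empty
    then show ?case by (intro exI[of _ 1]) auto
  next
    case (insert a F)
    then obtain k :: nat where k: "k > 0" "\<forall>i\<in>F. of_nat k * q i \<in> \<int>" by blast
    obtain m d where md: "q a = Rat.Fract m d" "d > 0" by (cases "q a") auto
    have "of_nat (k * nat d) * q i \<in> \<int>" if "i \<in> insert a F" for i
    proof (cases "i = a")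
      case True
      have "of_nat (k * nat d) * q a = of_int (int k * m)"
        using md by (simp add: Fract_of_int_quotient)
      then show ?thesis using True by (metis Ints_of_int)
    next
      case False
      then have "of_nat k * q i \<in> \<int>" using k that by blast
      then have "of_nat (nat d) * (of_nat k * q i) \<in> \<int>" by (rule Ints_mult[OF Ints_of_nat])
      moreover have "of_nat (k * nat d) * q i = of_nat (nat d) * (of_nat k * q i)" by simp
      ultimately show ?thesis by metis
    qed
    then show ?case using k md by (intro exI[of _ "k * nat d"]) auto
  qed
  then show thesis using that by blast
qed

text \<open>There are \<open>n\<close> equations in \<open>n + 1\<close> unknowns; a zero row pads
  them to a singular square matrix.\<close>

lemma homogeneous_system_nontrivial:
  fixes a :: "nat \<Rightarrow> nat \<Rightarrow> rat"
  obtains c :: "nat \<Rightarrow> rat" where "\<exists>j\<le>n. c j \<noteq> 0" "\<And>i. i < n \<Longrightarrow> (\<Sum>j\<le>n. a i j * c j) = 0"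
proof -
  define T where "T = mat (Suc n) (Suc n) (\<lambda>(i, j). if i < n then a i j else 0)"
  have T: "T \<in> carrier_mat (Suc n) (Suc n)" by (simp add: T_def)
  have "transpose_mat T *\<^sub>v unit_vec (Suc n) n = 0\<^sub>v (Suc n)"
    using T by (intro eq_vecI) (auto simp: T_def scalar_prod_right_unit)
  then have "Determinant.det (transpose_mat T) = 0"
    using det_0_iff_vec_prod_zero_field[of "transpose_mat T" "Suc n"] T
    by (metis transpose_carrier_mat unit_vec_carrier index_unit_vec(2) index_zero_vec(1) lessI zero_neq_one)
  then have "Determinant.det T = 0" using det_transpose[OF T] by simp
  then obtain v where v: "v \<in> carrier_vec (Suc n)" "v \<noteq> 0\<^sub>v (Suc n)" "T *\<^sub>v v = 0\<^sub>v (Suc n)"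
    using det_0_iff_vec_prod_zero_field[OF T] by blast
  have "\<exists>j\<le>n. v $ j \<noteq> 0"
  proof (rule ccontr)
    assume "\<not> (\<exists>j\<le>n. v $ j \<noteq> 0)"
    then have "v = 0\<^sub>v (Suc n)" using v(1) by (intro eq_vecI) auto
    with v show False by simp
  qed
  moreover have "(\<Sum>j\<le>n. a i j * v $ j) = 0" if i: "i < n" for i
  proof -
    have "(T *\<^sub>v v) $ i = (\<Sum>j = 0..<Suc n. T $$ (i, j) * v $ j)"
      using i T v(1) by (auto simp: scalar_prod_def intro!: sum.cong)
    also have "\<dots> = (\<Sum>j\<le>n. a i j * v $ j)"
      using i by (intro sum.cong) (auto simp: T_def)
    finally show ?thesis using v(3) i by simp
  qed
  ultimately show thesis using that by blast
qed

text \<open>Dirichlet's approximation theorem: among the multipliers \<open>0, ..., Q ^ n\<close>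
  two put the fractional parts into the same one of the \<open>Q ^ n\<close> boxes of side
  \<open>1 / Q\<close>.\<close>

lemma simultaneous_approximation:
  fixes c :: "nat \<Rightarrow> rat" and Q :: nat
  assumes Q: "Q > 0"
  obtains t :: nat and w :: "nat \<Rightarrow> int"
  where "1 \<le> t" "t \<le> Q ^ n" "\<And>j. j < n \<Longrightarrow> \<bar>of_nat t * c j - of_int (w j)\<bar> < 1 / of_nat Q"
proof -
  define f where "f t = (\<lambda>j\<in>{..<n}. nat \<lfloor>of_nat Q * frac (of_nat t * c j)\<rfloor>)" for t :: nat
  have "f ` {0..Q ^ n} \<subseteq> PiE {..<n} (\<lambda>_. {..<Q})"
  proof (rule image_subsetI)
    fix t
    show "f t \<in> PiE {..<n} (\<lambda>_. {..<Q})"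
    proof (intro PiE_I)
      fix j assume "j \<in> {..<n}"
      then have e: "f t j = nat \<lfloor>of_nat Q * frac (of_nat t * c j)\<rfloor>" by (simp add: f_def)
      have "of_nat Q * frac (of_nat t * c j) < of_nat Q"
        using frac_lt_1[of "of_nat t * c j"] Q by simp
      then have "\<lfloor>of_nat Q * frac (of_nat t * c j)\<rfloor> < int Q"
        by (simp add: floor_less_iff)
      then show "f t j \<in> {..<Q}" unfolding e using Q by simp
    qed (simp add: f_def)
  qed
  then have "card (f ` {0..Q ^ n}) \<le> Q ^ n"
    using card_mono[of "PiE {..<n} (\<lambda>_. {..<Q})"] by (simp add: card_PiE finite_PiE)
  then have "\<not> inj_on f {0..Q ^ n}" by (intro pigeonhole) simp
  then obtain t1 t2 where t: "t1 < t2" "t2 \<le> Q ^ n" "f t1 = f t2"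
    unfolding inj_on_def by (metis atLeastAtMost_iff linorder_neqE_nat)
  define w where "w j = \<lfloor>of_nat t2 * c j\<rfloor> - \<lfloor>of_nat t1 * c j\<rfloor>" for j
  have "\<bar>of_nat (t2 - t1) * c j - of_int (w j)\<bar> < 1 / of_nat Q" if j: "j < n" for j
  proof -
    define x where "x = frac (of_nat t1 * c j)"
    define y where "y = frac (of_nat t2 * c j)"
    have "f t1 j = f t2 j" using t by simp
    then have "nat \<lfloor>of_nat Q * x\<rfloor> = nat \<lfloor>of_nat Q * y\<rfloor>" using j by (simp add: f_def x_def y_def)
    moreover have "0 \<le> \<lfloor>of_nat Q * x\<rfloor>" "0 \<le> \<lfloor>of_nat Q * y\<rfloor>" by (simp_all add: x_def y_def)
    ultimately have "\<lfloor>of_nat Q * x\<rfloor> = \<lfloor>of_nat Q * y\<rfloor>" by linarith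
    then have "\<bar>of_nat Q * y - of_nat Q * x\<bar> < 1" by linarith
    then have "of_nat Q * \<bar>y - x\<bar> < 1" by (simp add: right_diff_distrib[symmetric] abs_mult)
    then have "\<bar>y - x\<bar> < 1 / of_nat Q" using Q by (simp add: field_simps)
    moreover have "of_nat (t2 - t1) * c j - of_int (w j) = y - x"
      using t(1) by (simp add: x_def y_def w_def frac_def of_nat_diff algebra_simps)
    ultimately show ?thesis by simp
  qed
  then show thesis using that[of "t2 - t1" w] t by auto
qed

text \<open>\<open>A\<close> is an order of \<open>K\<close>, and the homomorphisms \<open>s i\<close> multiply to the norm. They arise as the diagonal
  entries of a simultaneous triangularization of the regular representation, so that neither a primitive
  element nor the distinctness of the \<open>s i\<close> is needed. The set \<open>A\<close> is the multiplier ring of a lattice.\<close>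
locale nf_order =
  fixes A :: "'k::field_char_0 set" and n :: nat and s :: "nat \<Rightarrow> 'k \<Rightarrow> complex"
  assumes one_A: "1 \<in> A"
    and diff_A: "x \<in> A \<Longrightarrow> y \<in> A \<Longrightarrow> x - y \<in> A"
    and mult_A: "x \<in> A \<Longrightarrow> y \<in> A \<Longrightarrow> x * y \<in> A"
    and denom: "\<exists>k::nat>0. of_nat k * x \<in> A"
    and n_pos: "n > 0"
    and hom: "i < n \<Longrightarrow> field_hom (s i)"
    and char_int: "x \<in> A \<Longrightarrow> \<exists>q :: int poly. map_poly of_int q = (\<Prod>i<n. [:- s i x, 1:])"
    and approx: "\<exists>M::nat>0. \<forall>x. \<exists>t\<in>{1..M}. \<exists>y\<in>A. norm (\<Prod>i<n. s i (of_nat t * x - y)) < 1"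
    and dep: "\<exists>c :: nat \<Rightarrow> int. (\<exists>j\<le>n. c j \<noteq> 0) \<and> (\<Sum>j\<le>n. of_int (c j) * (u j :: 'k)) = 0"

lemma nf_order_exists:
  assumes "is_number_field TYPE('k::field_char_0)"
  obtains A :: "'k::field_char_0 set" and n s where "nf_order A n s"
proof -
  obtain n :: nat and b :: "nat \<Rightarrow> 'k" where
    span: "\<And>x. \<exists>q :: nat \<Rightarrow> rat. x = (\<Sum>i<n. of_rat (q i) * b i)" and
    indep: "\<And>q :: nat \<Rightarrow> rat. (\<Sum>i<n. of_rat (q i) * b i) = 0 \<Longrightarrow> \<forall>i<n. q i = 0"
    using number_field_basis[OF assms] by metis
  define cd where "cd x = (SOME q :: nat \<Rightarrow> rat. x = (\<Sum>i<n. of_rat (q i) * b i))" for x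
  have cd: "x = (\<Sum>i<n. of_rat (cd x i) * b i)" for x
    unfolding cd_def using span[of x] by (rule someI_ex)
  have cd_unique: "cd x i = q i" if "x = (\<Sum>i<n. of_rat (q i) * b i)" "i < n" for x q i
  proof -
    have "(\<Sum>i<n. of_rat (cd x i - q i) * b i) = 0"
      using cd[of x] that(1) by (simp add: of_rat_diff left_diff_distrib sum_subtractf)
    from indep[OF this] that(2) show ?thesis by simp
  qed
  have n_pos: "n > 0"
  proof (rule ccontr)
    assume "\<not> n > 0"
    then have "(1::'k) = 0" using cd[of 1] by simp
    then show False by simp
  qed
  have cd_add: "cd (x + y) i = cd x i + cd y i" if "i < n" for x y i
    by (rule cd_unique[OF _ that])
      (simp add: of_rat_add distrib_right sum.distrib flip: cd)
  have cd_diff: "cd (x - y) i = cd x i - cd y i" if "i < n" for x y i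
    by (rule cd_unique[OF _ that])
      (simp add: of_rat_diff left_diff_distrib sum_subtractf flip: cd)
  have cd_scale: "cd (of_rat q * x) i = q * cd x i" if "i < n" for x q i
    by (rule cd_unique[OF _ that])
      (simp add: of_rat_mult mult.assoc flip: cd sum_distrib_left)
  have cd_basis: "cd (b j) i = (if i = j then 1 else 0)" if "i < n" "j < n" for i j
  proof (rule cd_unique[OF _ that(1)])
    show "b j = (\<Sum>i<n. of_rat (if i = j then 1 else 0) * b i)"
      using that by (simp add: if_distrib if_distribR sum.delta cong: if_cong)
  qed
  have cd_sum: "cd (sum f F) i = (\<Sum>k\<in>F. cd (f k) i)" if "i < n" "finite F" for f :: "nat \<Rightarrow> 'k" and F i
    using that(2)
  proof (induction F rule: finite_induct)
    case empty
    show ?case using cd_scale[OF that(1), of 0 0] by simp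
  qed (simp add: cd_add[OF that(1)])
  have cd_mult: "cd (x * y * b j) i = (\<Sum>k<n. cd (x * b k) i * cd (y * b j) k)" if "i < n" for x y i j
  proof -
    have "x * y * b j = (\<Sum>k<n. of_rat (cd (y * b j) k) * (x * b k))"
      by (subst mult.assoc, subst cd[of "y * b j"]) (simp add: sum_distrib_left mult_ac)
    then have "cd (x * y * b j) i = (\<Sum>k<n. cd (of_rat (cd (y * b j) k) * (x * b k)) i)"
      using that by (simp only: cd_sum finite_lessThan)
    then show ?thesis using that by (simp only: cd_scale) (simp add: mult.commute)
  qed

  \<comment> \<open>Multiplication by an element of \<open>A\<close> has an integer matrix in the
    basis \<open>b\<close>, which is why the characteristic polynomials below are integral.\<close>
  define A where "A = {x. \<forall>i<n. \<forall>j<n. cd (x * b j) i \<in> \<int>}"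
  define M where "M x = mat n n (\<lambda>(i, j). of_rat (cd (x * b j) i) :: complex)" for x
  have M: "mat_rep n M"
    unfolding mat_rep_def
  proof (intro conjI allI)
    fix x y
    show "M (x + y) = M x + M y"
      by (intro eq_matI) (auto simp: M_def distrib_right cd_add of_rat_add)
    show "M (x * y) = M x * M y"
      by (intro eq_matI) (auto simp: M_def cd_mult scalar_prod_def of_rat_sum of_rat_mult
          atLeast0LessThan intro!: sum.cong)
    show "M 1 = 1\<^sub>m n"
      by (intro eq_matI) (auto simp: M_def cd_basis)
  qed (auto simp: M_def)

  have rdep: "\<exists>c :: nat \<Rightarrow> rat. (\<exists>j\<le>n. c j \<noteq> 0) \<and> (\<Sum>j\<le>n. of_rat (c j) * u j) = 0" for u :: "nat \<Rightarrow> 'k"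
  proof -
    obtain c :: "nat \<Rightarrow> rat" where c: "\<exists>j\<le>n. c j \<noteq> 0" "\<And>i. i < n \<Longrightarrow> (\<Sum>j\<le>n. cd (u j) i * c j) = 0"
      using homogeneous_system_nontrivial[of n "\<lambda>i j. cd (u j) i"] by blast
    have "cd (\<Sum>j\<le>n. of_rat (c j) * u j) i = 0" if "i < n" for i
      using c(2)[OF that] that by (simp add: cd_sum cd_scale mult.commute[of "cd _ _"])
    then have "(\<Sum>j\<le>n. of_rat (c j) * u j) = 0"
      by (subst cd) (simp add: sum.neutral)
    with c(1) show ?thesis by blast
  qed
  have dep: "\<exists>c :: nat \<Rightarrow> int. (\<exists>j\<le>n. c j \<noteq> 0) \<and> (\<Sum>j\<le>n. of_int (c j) * u j) = 0" for u :: "nat \<Rightarrow> 'k"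
  proof -
    obtain c :: "nat \<Rightarrow> rat" where c: "\<exists>j\<le>n. c j \<noteq> 0" "(\<Sum>j\<le>n. of_rat (c j) * u j) = 0"
      using rdep by blast
    obtain k :: nat where k: "k > 0" "\<And>j. j \<in> {..n} \<Longrightarrow> of_nat k * c j \<in> \<int>"
      using common_denominator[of "{..n}" c] by blast
    define d where "d j = \<lfloor>of_nat k * c j\<rfloor>" for j
    have d: "of_int (d j) = of_nat k * c j" if "j \<le> n" for j
      using k(2)[of j] that by (simp add: d_def)
    have "of_int (d j) = (of_nat k * of_rat (c j) :: 'k)" if "j \<le> n" for j
      using arg_cong[OF d[OF that], of "of_rat :: rat \<Rightarrow> 'k"] by (simp add: of_rat_mult)
    then have "(\<Sum>j\<le>n. of_int (d j) * u j) = of_nat k * (\<Sum>j\<le>n. of_rat (c j) * u j)"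
      by (simp add: sum_distrib_left mult.assoc)
    then have "(\<Sum>j\<le>n. of_int (d j) * u j) = 0" using c(2) by simp
    moreover have "\<exists>j\<le>n. d j \<noteq> 0"
      using c(1) d k(1) by (metis mult_eq_0_iff of_int_0 of_nat_eq_0_iff less_numeral_extra(3))
    ultimately show ?thesis by blast
  qed
  have alg: "\<exists>p :: rat poly. p \<noteq> 0 \<and> poly (map_poly of_rat p) x = 0" for x :: 'k
  proof -
    obtain c :: "nat \<Rightarrow> rat" where c: "\<exists>j\<le>n. c j \<noteq> 0" "(\<Sum>j\<le>n. of_rat (c j) * x ^ j) = 0"
      using rdep by blast
    define p where "p = (\<Sum>j\<le>n. Polynomial.monom (c j) j)"
    have cp: "coeff p j = (if j \<le> n then c j else 0)" for j
      by (auto simp: p_def coeff_sum sum.delta)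
    have dp: "degree p \<le> n" by (intro degree_le) (simp add: cp)
    have "poly (map_poly of_rat p) x = (\<Sum>j\<le>degree p. of_rat (coeff p j) * x ^ j)"
      by (simp add: poly_altdef degree_map_poly coeff_map_poly)
    also have "\<dots> = (\<Sum>j\<le>n. of_rat (coeff p j) * x ^ j)"
      using dp by (intro sum.mono_neutral_left) (auto simp: coeff_eq_0)
    finally have "poly (map_poly of_rat p) x = (\<Sum>j\<le>n. of_rat (c j) * x ^ j)"
      by (simp add: cp)
    moreover have "p \<noteq> 0" using c(1) cp by (metis coeff_0)
    ultimately show ?thesis using c(2) by metis
  qed
  have inj_b: "inj_on b {..<n}"
  proof
    fix i j assume "i \<in> {..<n}" "j \<in> {..<n}" "b i = b j"
    then show "i = j" using cd_basis[of i i] cd_basis[of i j] by (auto split: if_splits)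
  qed
  have spanB: "\<exists>q :: 'k \<Rightarrow> rat. x = (\<Sum>y\<in>b ` {..<n}. of_rat (q y) * y)" for x
  proof (intro exI)
    show "x = (\<Sum>y\<in>b ` {..<n}. of_rat (cd x (the_inv_into {..<n} b y)) * y)"
      by (subst sum.reindex[OF inj_b]) (simp add: the_inv_into_f_f[OF inj_b] flip: cd)
  qed
  obtain s :: "nat \<Rightarrow> 'k \<Rightarrow> complex" where s: "\<And>i. i < n \<Longrightarrow> field_hom (s i)"
      "\<And>x. char_poly (M x) = (\<Prod>i<n. [:- s i x, 1:])"
    using simultaneous_triangularization[OF M _ spanB alg] by auto

  have denom: "\<exists>k::nat>0. of_nat k * x \<in> A" for x
  proof -
    obtain k :: nat where k: "k > 0"
      "\<And>p. p \<in> {..<n} \<times> {..<n} \<Longrightarrow> of_nat k * (case p of (i, j) \<Rightarrow> cd (x * b j) i) \<in> \<int>"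
      using common_denominator[of "{..<n} \<times> {..<n}" "\<lambda>p. case p of (i, j) \<Rightarrow> cd (x * b j) i"] by auto
    have "cd (of_nat k * x * b j) i = of_nat k * cd (x * b j) i" if "i < n" for i j
      using cd_scale[OF that, of "of_nat k" "x * b j"] by (simp add: mult.assoc)
    then have "of_nat k * x \<in> A" using k(2) by (auto simp: A_def)
    with k(1) show ?thesis by blast
  qed
  have diff: "x - y \<in> A" if "x \<in> A" "y \<in> A" for x y
    using that by (auto simp: A_def left_diff_distrib cd_diff)
  have mult: "x * y \<in> A" if "x \<in> A" "y \<in> A" for x y
    using that by (auto simp: A_def cd_mult intro!: Ints_sum)
  have one: "1 \<in> A" by (auto simp: A_def cd_basis)
  have int_A: "of_int m \<in> A" for m
  proof -
    have "cd (of_int m * b j) i = of_int m * cd (b j) i" if "i < n" for i j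
      using cd_scale[OF that, of "of_int m" "b j"] by simp
    then show ?thesis by (auto simp: A_def cd_basis)
  qed
  have sum_A: "sum f F \<in> A" if "finite F" "\<And>j. j \<in> F \<Longrightarrow> f j \<in> A" for f :: "nat \<Rightarrow> 'k" and F
    using that
  proof (induction F rule: finite_induct)
    case empty
    then show ?case using diff[OF one one] by simp
  next
    case (insert a F)
    then have "f a - (0 - sum f F) \<in> A"
      using diff[OF one one] by (intro diff) auto
    then show ?case using insert by simp
  qed

  have char_int: "\<exists>q :: int poly. map_poly of_int q = (\<Prod>i<n. [:- s i x, 1:])" if "x \<in> A" for x
  proof -
    define Mi where "Mi = mat n n (\<lambda>(i, j). \<lfloor>cd (x * b j) i\<rfloor>)"
    have "of_rat (cd (x * b j) i) = (of_int \<lfloor>cd (x * b j) i\<rfloor> :: complex)" if "i < n" "j < n" for i j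
    proof -
      have "of_int \<lfloor>cd (x * b j) i\<rfloor> = cd (x * b j) i"
        using \<open>x \<in> A\<close> that by (simp add: A_def)
      then show ?thesis by (metis of_rat_of_int_eq)
    qed
    then have "map_mat of_int Mi = M x"
      by (intro eq_matI) (auto simp: Mi_def M_def)
    moreover have "Mi \<in> carrier_mat n n" by (simp add: Mi_def)
    ultimately have "map_poly of_int (char_poly Mi) = char_poly (M x)"
      by (metis of_int_hom.char_poly_hom)
    with s(2) show ?thesis by metis
  qed

  have approx: "\<exists>M::nat>0. \<forall>x. \<exists>t\<in>{1..M}. \<exists>y\<in>A. norm (\<Prod>i<n. s i (of_nat t * x - y)) < 1"
  proof -
    obtain k0 :: nat where k0: "k0 > 0" "\<And>j. j < n \<Longrightarrow> of_nat k0 * b j \<in> A"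
    proof -
      have "\<forall>j. \<exists>k::nat. k > 0 \<and> of_nat k * b j \<in> A" using denom by blast
      from choice[OF this] obtain kk :: "nat \<Rightarrow> nat" where kk: "\<And>j. kk j > 0 \<and> of_nat (kk j) * b j \<in> A"
        by blast
      have "of_nat (\<Prod>i<n. kk i) * b j \<in> A" if "j < n" for j
      proof -
        have "(\<Prod>i<n. kk i) = (\<Prod>i\<in>{..<n} - {j}. kk i) * kk j"
          using that by (subst prod.remove[of _ j]) auto
        then have "of_nat (\<Prod>i<n. kk i) * b j = of_int (int (\<Prod>i\<in>{..<n} - {j}. kk i)) * (of_nat (kk j) * b j)"
          by (simp add: mult.assoc)
        then show ?thesis using mult[OF int_A] kk by metis
      qed
      then show thesis using that[of "\<Prod>i<n. kk i"] kk by (simp add: prod_pos)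
    qed
    define K where "K = (\<Sum>i<n. \<Sum>j<n. norm (s i (b j))) + 1"
    have K1: "K \<ge> 1" by (simp add: K_def sum_nonneg)
    \<comment> \<open>The coordinates of \<open>of_nat t * x - y\<close> will be smaller than
      \<open>k0 / Q\<close>, since \<open>y\<close> is taken among the integral combinations of the
      elements \<open>of_nat k0 * b j\<close> of \<open>A\<close>. This choice of \<open>Q\<close>
      then makes every \<open>s i (of_nat t * x - y)\<close> smaller than 1.\<close>
    obtain Q :: nat where Q: "real Q > K * real k0" using reals_Archimedean2 by blast
    have Q0: "Q > 0" using Q K1 k0(1) by (cases Q) (auto simp: mult_less_0_iff)
    show ?thesis
    proof (intro exI[of _ "Q ^ n"] conjI allI)
      show "Q ^ n > 0" using Q0 by simp
    next
      fix x
      obtain t :: nat and w :: "nat \<Rightarrow> int" where t: "1 \<le> t" "t \<le> Q ^ n"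
        and w: "\<And>j. j < n \<Longrightarrow> \<bar>of_nat t * (cd x j / of_nat k0) - of_int (w j)\<bar> < 1 / of_nat Q"
        using simultaneous_approximation[OF Q0, of n "\<lambda>j. cd x j / of_nat k0"] by blast
      define y where "y = (\<Sum>j<n. of_int (w j) * (of_nat k0 * b j))"
      have yA: "y \<in> A" unfolding y_def by (intro sum_A mult int_A k0) auto
      define d where "d j = of_nat t * cd x j - of_nat k0 * of_int (w j)" for j
      have z: "of_nat t * x - y = (\<Sum>j<n. of_rat (d j) * b j)"
        by (subst cd[of x])
          (simp add: y_def d_def of_rat_diff of_rat_mult sum_subtractf[symmetric]
            sum_distrib_left algebra_simps)
      have dj: "\<bar>real_of_rat (d j)\<bar> < k0 / Q" if j: "j < n" for j
      proof -
        have "d j = of_nat k0 * (of_nat t * (cd x j / of_nat k0) - of_int (w j))"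
          using k0(1) by (simp add: d_def algebra_simps)
        then have "\<bar>d j\<bar> = of_nat k0 * \<bar>of_nat t * (cd x j / of_nat k0) - of_int (w j)\<bar>"
          by (simp add: abs_mult)
        also have "\<dots> < of_nat k0 * (1 / of_nat Q)"
          using w[OF j] k0(1) by (intro mult_strict_left_mono) auto
        finally have "real_of_rat \<bar>d j\<bar> < real_of_rat (of_nat k0 * (1 / of_nat Q))"
          by (simp add: of_rat_less)
        then show ?thesis by (simp add: of_rat_divide)
      qed
      have "norm (s i (of_nat t * x - y)) < 1" if i: "i < n" for i
      proof -
        interpret field_hom "s i" by (rule s(1)[OF i])
        have int: "s i (of_int m) = of_int m" for m by (rule hom_of_int)
        have rat: "s i (of_rat q) = of_rat q" for q
          by (cases q) (simp add: of_rat_rat divide_inverse hom_mult hom_inverse int)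
        have "norm (s i (of_nat t * x - y)) = norm (\<Sum>j<n. of_rat (d j) * s i (b j))"
          unfolding z by (simp add: hom_sum hom_mult rat)
        also have "\<dots> \<le> (\<Sum>j<n. norm (of_rat (d j) * s i (b j)))" by (rule norm_sum)
        also have "\<dots> \<le> (\<Sum>j<n. k0 / Q * norm (s i (b j)))"
        proof (intro sum_mono)
          fix j assume j: "j \<in> {..<n}"
          have "complex_of_rat (d j) = of_real (real_of_rat (d j))"
            by (cases "d j") (simp add: of_rat_rat)
          then have "norm (complex_of_rat (d j)) = \<bar>real_of_rat (d j)\<bar>" by simp
          then have "norm (complex_of_rat (d j)) \<le> k0 / Q" using dj[of j] j by simp
          then show "norm (of_rat (d j) * s i (b j)) \<le> k0 / Q * norm (s i (b j))"
            unfolding norm_mult by (intro mult_right_mono) auto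
        qed
        also have "\<dots> = k0 / Q * (\<Sum>j<n. norm (s i (b j)))" by (simp add: sum_distrib_left)
        also have "\<dots> \<le> k0 / Q * K"
        proof (intro mult_left_mono)
          have "(\<Sum>j<n. norm (s i (b j))) \<le> (\<Sum>i<n. \<Sum>j<n. norm (s i (b j)))"
            using i by (intro member_le_sum[of i "{..<n}" "\<lambda>i. \<Sum>j<n. norm (s i (b j))"]) (auto simp: sum_nonneg)
          then show "(\<Sum>j<n. norm (s i (b j))) \<le> K" by (simp add: K_def)
        qed simp
        also have "\<dots> < 1" using Q Q0 by (simp add: field_simps)
        finally show ?thesis .
      qed
      then have "(\<Prod>i<n. norm (s i (of_nat t * x - y))) < (\<Prod>i<n. 1)"
        using n_pos by (intro prod_mono_strict[of 0]) (auto simp: less_imp_le)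
      then have "norm (\<Prod>i<n. s i (of_nat t * x - y)) < 1" by (simp add: prod_norm)
      with t yA show "\<exists>t\<in>{1..Q ^ n}. \<exists>y\<in>A. norm (\<Prod>i<n. s i (of_nat t * x - y)) < 1"
        by (intro bexI[of _ t] bexI[of _ y]) auto
    qed
  qed

  have "nf_order A n s"
    by (rule nf_order.intro) (fact one diff mult denom n_pos s(1) char_int approx dep)+
  then show thesis by (rule that)
qed

section \<open>The norm, and ideals that are almost principal\<close>

context nf_order
begin

lemma zero_A [simp]: "0 \<in> A" using diff_A[OF one_A one_A] by simp
lemma one_A' [simp]: "1 \<in> A" by (rule one_A)
lemma uminus_A: "x \<in> A \<Longrightarrow> - x \<in> A" using diff_A[OF zero_A, of x] by simp
lemma add_A: "x \<in> A \<Longrightarrow> y \<in> A \<Longrightarrow> x + y \<in> A" using diff_A[OF _ uminus_A, of x y] by simp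
lemma of_nat_A [simp]: "of_nat k \<in> A" by (induction k) (auto intro: add_A)
lemma of_int_A [simp]: "of_int k \<in> A" by (cases k) (auto intro!: uminus_A simp del: of_nat_Suc)
lemma power_A: "x \<in> A \<Longrightarrow> x ^ k \<in> A" by (induction k) (auto intro: mult_A)
lemma sum_A: "(\<And>i. i \<in> F \<Longrightarrow> f i \<in> A) \<Longrightarrow> sum f F \<in> A"
  by (induction F rule: infinite_finite_induct) (auto intro: add_A)
lemma prod_A: "(\<And>i. i \<in> F \<Longrightarrow> f i \<in> A) \<Longrightarrow> prod f F \<in> A"
  by (induction F rule: infinite_finite_induct) (auto intro: mult_A)

lemma common_denom:
  assumes "finite F"
  shows "\<exists>k::nat>0. \<forall>x\<in>F. of_nat k * x \<in> A"
  using assms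
proof (induction F rule: finite_induct)
  case empty
  then show ?case by (intro exI[of _ 1]) auto
next
  case (insert a F)
  then obtain k :: nat where k: "k > 0" "\<forall>x\<in>F. of_nat k * x \<in> A" by blast
  obtain l :: nat where l: "l > 0" "of_nat l * a \<in> A" using denom by blast
  have "of_nat (l * k) * x \<in> A" if "x \<in> insert a F" for x
  proof (cases "x = a")
    case True
    have "of_nat k * (of_nat l * a) \<in> A" by (rule mult_A[OF of_nat_A l(2)])
    then show ?thesis using True by (simp add: mult_ac)
  next
    case False
    then have "of_nat k * x \<in> A" using k that by blast
    from mult_A[OF of_nat_A[of l] this] show ?thesis by (simp add: mult_ac)
  qed
  then show ?case using k l by (intro exI[of _ "l * k"]) auto
qed

lemma s_simps:
  assumes "i < n"
  shows "s i (x + y) = s i x + s i y" "s i (x * y) = s i x * s i y" "s i (x - y) = s i x - s i y"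
    "s i 0 = 0" "s i 1 = 1" "s i (of_int k) = of_int k" "s i (of_nat l) = of_nat l" "s i (x ^ l) = s i x ^ l"
    "s i (sum f F) = (\<Sum>j\<in>F. s i (f j))" "s i x = 0 \<longleftrightarrow> x = 0" "s i (x / y) = s i x / s i y"
    "s i (prod f F) = (\<Prod>j\<in>F. s i (f j))"
proof -
  interpret field_hom "s i" by (rule hom[OF assms])
  show "s i (x + y) = s i x + s i y" "s i (x * y) = s i x * s i y" "s i (x - y) = s i x - s i y"
    "s i 0 = 0" "s i 1 = 1" "s i (of_int k) = of_int k" "s i (of_nat l) = of_nat l" "s i (x ^ l) = s i x ^ l"
    "s i (sum f F) = (\<Sum>j\<in>F. s i (f j))" "s i x = 0 \<longleftrightarrow> x = 0" "s i (x / y) = s i x / s i y"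
    "s i (prod f F) = (\<Prod>j\<in>F. s i (f j))"
    by (simp_all add: hom_add hom_mult hom_minus hom_of_int hom_of_nat hom_power hom_sum hom_prod
        divide_inverse hom_inverse)
qed

text \<open>The norm in three guises: as a complex number, as the integer it is on \<open>A\<close>,
  and as a real absolute value on all of \<open>K\<close>.\<close>

definition NC :: "'k \<Rightarrow> complex" where "NC x = (\<Prod>i<n. s i x)"

definition NZ :: "'k \<Rightarrow> int" where "NZ x = (SOME z. of_int z = NC x)"

definition Nm :: "'k \<Rightarrow> real" where "Nm x = norm (NC x)"

lemma NC_simps: "NC (x * y) = NC x * NC y" "NC (x / y) = NC x / NC y" "NC 1 = 1"
  "NC (of_int k) = of_int k ^ n" "NC (of_nat l) = of_nat l ^ n" "NC x = 0 \<longleftrightarrow> x = 0"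
  using n_pos by (auto simp: NC_def s_simps prod.distrib prod_dividef)

lemma Nm_simps: "Nm (x * y) = Nm x * Nm y" "Nm (x / y) = Nm x / Nm y" "Nm 1 = 1"
  "Nm (of_nat l) = of_nat l ^ n" "Nm x = 0 \<longleftrightarrow> x = 0" "Nm x \<ge> 0"
  by (auto simp: Nm_def NC_simps norm_mult norm_divide norm_power)

lemma Nm_alt: "Nm x = (\<Prod>i<n. norm (s i x))"
  by (simp add: Nm_def NC_def prod_norm)

text \<open>\<open>s 0 x\<close> is a root of the integral polynomial \<open>q\<close> and
  \<open>s 0\<close> is injective, so \<open>q\<close> vanishes at \<open>x\<close>. Its constant
  term is the norm up to sign, and the remaining terms are divisible by \<open>x\<close>.\<close>

lemma norm_cofactor_aux:
  assumes x: "x \<in> A"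
  obtains z u where "of_int z = NC x" "u \<in> A" "x * u = of_int z"
proof -
  obtain q :: "int poly" where q: "map_poly of_int q = (\<Prod>i<n. [:- s i x, 1:])" using char_int[OF x] by blast
  obtain a r where ar: "q = pCons a r" by (cases q) auto
  have "poly (map_poly of_int q) (0 :: complex) = (\<Prod>i<n. - s i x)"
    unfolding q by (simp add: poly_prod)
  then have a: "of_int a = (-1) ^ n * NC x"
    by (simp add: ar map_poly_pCons NC_def prod_uminus)
  interpret s0: field_hom "s 0" by (rule hom[OF n_pos])
  have eval: "s 0 (poly (map_poly of_int p) x) = poly (map_poly of_int p) (s 0 x)" for p :: "int poly"
    by (induction p) (auto simp: map_poly_pCons s_simps[OF n_pos])
  have "poly (map_poly of_int q) (s 0 x) = 0"
    unfolding q poly_prod using n_pos by (intro prod_zero) auto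
  then have "poly (map_poly of_int q) x = 0"
    using eval[of q] s_simps(10)[OF n_pos] by simp
  then have *: "of_int a + x * poly (map_poly of_int r) x = 0"
    by (cases "a = 0 \<and> r = 0") (auto simp: ar map_poly_pCons)
  have rA: "poly (map_poly of_int p) x \<in> A" for p :: "int poly"
    by (induction p) (auto simp: map_poly_pCons intro!: add_A mult_A x)
  define z where "z = (-1) ^ n * a"
  have "of_int z = NC x" using a by (simp add: z_def flip: power_mult_distrib mult.assoc)
  moreover have "x * ((-1) ^ n * - poly (map_poly of_int r) x) = of_int z"
    using * by (simp add: z_def add_eq_0_iff2)
  moreover have "(-1) ^ n * - poly (map_poly of_int r) x \<in> A"
    by (intro mult_A power_A uminus_A rA one_A)
  ultimately show thesis using that by blast
qed

lemma NZ: "x \<in> A \<Longrightarrow> of_int (NZ x) = NC x"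
  unfolding NZ_def using norm_cofactor_aux by (metis (mono_tags, lifting) someI_ex)

lemma norm_cofactor:
  assumes x: "x \<in> A"
  obtains u where "u \<in> A" "x * u = of_int (NZ x)"
proof -
  obtain z u where "of_int z = NC x" "u \<in> A" "x * u = of_int z" using norm_cofactor_aux[OF x] by blast
  then show thesis using NZ[OF x] that by (metis of_int_eq_iff)
qed

lemma Nm_NZ: "x \<in> A \<Longrightarrow> Nm x = \<bar>of_int (NZ x)\<bar>"
  unfolding Nm_def NZ[symmetric] by simp

lemma NZ_eq_0: "x \<in> A \<Longrightarrow> NZ x = 0 \<longleftrightarrow> x = 0"
  using NZ[of x] NC_simps(6)[of x] by (metis of_int_eq_0_iff)

lemma NZ_mult: "x \<in> A \<Longrightarrow> y \<in> A \<Longrightarrow> NZ (x * y) = NZ x * NZ y"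
proof -
  assume xy: "x \<in> A" "y \<in> A"
  have "of_int (NZ (x * y)) = (of_int (NZ x * NZ y) :: complex)"
    using xy by (simp add: NZ mult_A NC_simps)
  then show ?thesis using of_int_eq_iff by blast
qed

lemma NZ_of_int: "NZ (of_int k) = k ^ n"
proof -
  have "of_int (NZ (of_int k)) = (of_int (k ^ n) :: complex)"
    using NZ[of "of_int k"] by (simp add: NC_simps)
  then show ?thesis using of_int_eq_iff by blast
qed

lemma NZ_power: "x \<in> A \<Longrightarrow> NZ (x ^ k) = NZ x ^ k"
  using NZ_of_int[of 1] by (induction k) (auto simp: NZ_mult power_A)

lemma Nm_ge_1: "x \<in> A \<Longrightarrow> x \<noteq> 0 \<Longrightarrow> Nm x \<ge> 1"
  using Nm_NZ[of x] NZ_eq_0[of x] by simp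

text \<open>A Euclidean argument up to a bounded factor, standing in for the finiteness of the class
  number. Let \<open>\<beta>\<close> have least nonzero norm in the ideal generated by
  \<open>x\<close> and \<open>y\<close>. For each \<open>z\<close> in the ideal some
  \<open>of_nat t * z\<close> with \<open>t \<le> M\<close> leaves a remainder modulo
  \<open>\<beta>\<close> of smaller norm, hence zero; \<open>fact M\<close> is a multiple of every
  such \<open>t\<close>.\<close>

lemma ideal_almost_principal:
  obtains M0 :: nat where "M0 > 0"
    "\<And>x y. x \<in> A \<Longrightarrow> y \<in> A \<Longrightarrow> x \<noteq> 0 \<or> y \<noteq> 0 \<Longrightarrow> \<exists>\<beta> a b. \<beta> \<noteq> 0 \<and> a \<in> A \<and> b \<in> A \<and>
       \<beta> = a * x + b * y \<and> of_nat M0 * x / \<beta> \<in> A \<and> of_nat M0 * y / \<beta> \<in> A"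
proof -
  obtain M :: nat where M: "M > 0" "\<And>x. \<exists>t\<in>{1..M}. \<exists>y\<in>A. Nm (of_nat t * x - y) < 1"
    using approx unfolding Nm_def NC_def by blast
  have "\<exists>\<beta> a b. \<beta> \<noteq> 0 \<and> a \<in> A \<and> b \<in> A \<and> \<beta> = a * x + b * y \<and>
      of_nat (fact M) * x / \<beta> \<in> A \<and> of_nat (fact M) * y / \<beta> \<in> A"
    if x: "x \<in> A" and y: "y \<in> A" and xy: "x \<noteq> 0 \<or> y \<noteq> 0" for x y
  proof -
    define I where "I = {z. \<exists>a\<in>A. \<exists>b\<in>A. z = a * x + b * y}"
    have IA: "I \<subseteq> A" using x y by (auto simp: I_def intro!: add_A mult_A)
    have xI: "x \<in> I" unfolding I_def by (rule CollectI, intro bexI[of _ 1] bexI[of _ 0]) auto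
    have yI: "y \<in> I" unfolding I_def by (rule CollectI, intro bexI[of _ 0] bexI[of _ 1]) auto
    have I_lin: "c * z - d * w \<in> I" if zw: "z \<in> I" "w \<in> I" and cd: "c \<in> A" "d \<in> A" for z w c d
    proof -
      obtain a b a' b' where *: "a \<in> A" "b \<in> A" "z = a * x + b * y" "a' \<in> A" "b' \<in> A" "w = a' * x + b' * y"
        using zw by (auto simp: I_def)
      have "c * z - d * w = (c * a - d * a') * x + (c * b - d * b') * y"
        by (simp add: * algebra_simps)
      moreover have "c * a - d * a' \<in> A" "c * b - d * b' \<in> A"
        using * cd by (auto intro!: diff_A mult_A)
      ultimately show ?thesis unfolding I_def by blast
    qed
    have "\<exists>z. z \<in> I \<and> z \<noteq> 0" using xI yI xy by blast
    then obtain \<beta> where \<beta>: "\<beta> \<in> I" "\<beta> \<noteq> 0"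
      and min: "\<And>z. z \<in> I \<Longrightarrow> z \<noteq> 0 \<Longrightarrow> nat \<bar>NZ \<beta>\<bar> \<le> nat \<bar>NZ z\<bar>"
      using ex_has_least_nat[of "\<lambda>z. z \<in> I \<and> z \<noteq> 0" _ "\<lambda>z. nat \<bar>NZ z\<bar>"] by blast
    have "of_nat (fact M) * z / \<beta> \<in> A" if z: "z \<in> I" for z
    proof -
      obtain t w where t: "t \<in> {1..M}" and w: "w \<in> A" and less: "Nm (of_nat t * (z / \<beta>) - w) < 1"
        using M(2)[of "z / \<beta>"] by blast
      define r where "r = of_nat t * z - w * \<beta>"
      have "r = (of_nat t * (z / \<beta>) - w) * \<beta>" using \<beta>(2) by (simp add: r_def field_simps)
      then have "Nm r = Nm (of_nat t * (z / \<beta>) - w) * Nm \<beta>" by (simp add: Nm_simps)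
      also have "\<dots> < Nm \<beta>"
        using less \<beta>(2) Nm_simps(5,6)[of \<beta>] by (simp add: less_le)
      finally have lt: "Nm r < Nm \<beta>" .
      have rI: "r \<in> I" unfolding r_def by (rule I_lin[OF z \<beta>(1) _ w]) simp
      have "r = 0"
      proof (rule ccontr)
        assume "r \<noteq> 0"
        from min[OF rI this] have "\<bar>NZ \<beta>\<bar> \<le> \<bar>NZ r\<bar>" by linarith
        then have "\<bar>real_of_int (NZ \<beta>)\<bar> \<le> \<bar>real_of_int (NZ r)\<bar>" by linarith
        with lt rI \<beta>(1) IA show False by (auto simp: Nm_NZ subset_iff)
      qed
      then have zt: "of_nat t * (z / \<beta>) = w" using \<beta>(2) by (simp add: r_def field_simps)
      obtain l where l: "fact M = l * t" using t dvd_fact[of t M] by (auto elim: dvdE simp: mult.commute)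
      have "of_nat (fact M) * z / \<beta> = of_nat l * (of_nat t * (z / \<beta>))" unfolding l by simp
      then show ?thesis unfolding zt using w by (auto intro!: mult_A)
    qed
    then show ?thesis using xI yI \<beta> unfolding I_def by blast
  qed
  then show thesis using that[of "fact M"] by simp
qed

end

text \<open>\<open>(X P : Y P)\<close> are homogeneous coordinates of \<open>P\<close> that generate an ideal containing \<open>M0\<close>.\<close>
locale nf_coords = nf_order A n s
  for A :: "'k::field_char_0 set" and n :: nat and s :: "nat \<Rightarrow> 'k \<Rightarrow> complex" +
  fixes M0 :: nat and X Y :: "'k option \<Rightarrow> 'k"
  assumes M0_pos: "M0 > 0"
    and X_A: "X P \<in> A" and Y_A: "Y P \<in> A"
    and almost_coprime: "\<exists>a\<in>A. \<exists>b\<in>A. a * X P + b * Y P = of_nat M0"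
    and Y_None: "Y None = 0" and Y_Some: "Y (Some x) \<noteq> 0" and X_Some: "X (Some x) = x * Y (Some x)"

text \<open>Integral coordinates \<open>(k x : k)\<close> are divided by an almost generator of
  their ideal; the factor \<open>M0\<close> keeps the quotients in \<open>A\<close>.\<close>

lemma (in nf_order) nf_coords_exist:
  obtains M0 X Y where "nf_coords A n s M0 X Y"
proof -
  obtain M0 :: nat where M0: "M0 > 0"
    "\<And>x y. x \<in> A \<Longrightarrow> y \<in> A \<Longrightarrow> x \<noteq> 0 \<or> y \<noteq> 0 \<Longrightarrow> \<exists>\<beta> a b. \<beta> \<noteq> 0 \<and> a \<in> A \<and> b \<in> A \<and>
       \<beta> = a * x + b * y \<and> of_nat M0 * x / \<beta> \<in> A \<and> of_nat M0 * y / \<beta> \<in> A"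
    using ideal_almost_principal by metis
  have "\<exists>u v. u \<in> A \<and> v \<in> A \<and> v \<noteq> 0 \<and> u = x * v \<and> (\<exists>a\<in>A. \<exists>b\<in>A. a * u + b * v = of_nat M0)" for x
  proof -
    obtain k :: nat where k: "k > 0" "of_nat k * x \<in> A" using denom by blast
    obtain \<beta> a b where \<beta>: "\<beta> \<noteq> 0" "a \<in> A" "b \<in> A" "\<beta> = a * (of_nat k * x) + b * of_nat k"
      "of_nat M0 * (of_nat k * x) / \<beta> \<in> A" "of_nat M0 * of_nat k / \<beta> \<in> A"
      using M0(2)[OF k(2) of_nat_A[of k]] k(1) by auto
    define u where "u = of_nat M0 * (of_nat k * x) / \<beta>"
    define v where "v = of_nat M0 * of_nat k / \<beta>"
    have "a * u + b * v = of_nat M0 * (a * (of_nat k * x) + b * of_nat k) / \<beta>"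
      by (simp add: u_def v_def add_divide_distrib algebra_simps)
    then have "a * u + b * v = of_nat M0" unfolding \<beta>(4)[symmetric] using \<beta>(1) by simp
    moreover have "v \<noteq> 0" using M0(1) k(1) \<beta>(1) by (simp add: v_def)
    moreover have "u = x * v" by (simp add: u_def v_def)
    ultimately show ?thesis using \<beta> unfolding u_def v_def by blast
  qed
  then obtain u v where uv: "\<And>x. u x \<in> A" "\<And>x. v x \<in> A" "\<And>x. v x \<noteq> 0" "\<And>x. u x = x * v x"
    "\<And>x. \<exists>a\<in>A. \<exists>b\<in>A. a * u x + b * v x = of_nat M0" by metis
  have "nf_coords A n s M0 (case_option (of_nat M0) u) (case_option 0 v)"
  proof unfold_locales
    fix P
    show "\<exists>a\<in>A. \<exists>b\<in>A. a * case_option (of_nat M0) u P + b * case_option 0 v P = of_nat M0"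
    proof (cases P)
      case None
      then show ?thesis by (intro bexI[of _ 1] bexI[of _ 0]) auto
    qed (use uv(5) in simp)
  qed (use M0 uv in \<open>auto split: option.splits\<close>)
  then show thesis by (rule that)
qed

section \<open>Localizations and their places\<close>

text \<open>The localization \<open>R = A[1/m]\<close> is a principal ideal domain since \<open>M0\<close> divides \<open>m\<close>.\<close>
locale nf_local = nf_coords A n s M0 X Y
  for A :: "'k::field_char_0 set" and n :: nat and s :: "nat \<Rightarrow> 'k \<Rightarrow> complex"
    and M0 :: nat and X Y :: "'k option \<Rightarrow> 'k" +
  fixes m :: nat
  assumes m_pos: "m > 0" and M0_dvd: "M0 dvd m"
begin

definition R :: "'k set" where "R = {x. \<exists>k. of_nat m ^ k * x \<in> A}"

lemma R_I: "of_nat m ^ k * x \<in> A \<Longrightarrow> x \<in> R" unfolding R_def by blast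

lemma A_R: "x \<in> A \<Longrightarrow> x \<in> R" using R_I[of 0] by simp

lemma R_common:
  assumes "x \<in> R" "y \<in> R"
  obtains k where "of_nat m ^ k * x \<in> A" "of_nat m ^ k * y \<in> A"
proof -
  obtain j l where j: "of_nat m ^ j * x \<in> A" and l: "of_nat m ^ l * y \<in> A"
    using assms by (auto simp: R_def)
  have "of_nat m ^ (j + l) * x = of_nat m ^ l * (of_nat m ^ j * x)"
    "of_nat m ^ (j + l) * y = of_nat m ^ j * (of_nat m ^ l * y)"
    by (simp_all add: power_add)
  then show thesis using that[of "j + l"] mult_A[OF power_A[OF of_nat_A] j] mult_A[OF power_A[OF of_nat_A] l]
    by metis
qed

lemma diff_R: "x \<in> R \<Longrightarrow> y \<in> R \<Longrightarrow> x - y \<in> R"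
  by (erule (1) R_common, rule R_I) (auto simp: right_diff_distrib intro: diff_A)
lemma add_R: "x \<in> R \<Longrightarrow> y \<in> R \<Longrightarrow> x + y \<in> R"
  by (erule (1) R_common, rule R_I) (auto simp: distrib_left intro: add_A)
lemma mult_R: assumes "x \<in> R" "y \<in> R" shows "x * y \<in> R"
proof -
  obtain k where k: "of_nat m ^ k * x \<in> A" "of_nat m ^ k * y \<in> A" using R_common[OF assms] by blast
  have "of_nat m ^ (k + k) * (x * y) = (of_nat m ^ k * x) * (of_nat m ^ k * y)"
    by (simp add: power_add)
  then have "of_nat m ^ (k + k) * (x * y) \<in> A" using mult_A[OF k] by metis
  then show ?thesis by (rule R_I)
qed
lemma zero_R [simp]: "0 \<in> R" and one_R [simp]: "1 \<in> R" by (auto intro: A_R)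
lemma power_R: "x \<in> R \<Longrightarrow> x ^ k \<in> R" by (induction k) (auto intro: mult_R)
lemma prod_R: "(\<And>i. i \<in> F \<Longrightarrow> f i \<in> R) \<Longrightarrow> prod f F \<in> R"
  by (induction F rule: infinite_finite_induct) (auto intro: mult_R)
lemma inverse_dvd_R: assumes "k dvd m" shows "1 / of_nat k \<in> R"
proof (rule R_I[of 1])
  obtain l where "m = k * l" using assms by blast
  then have "of_nat m ^ 1 * (1 / of_nat k) = (of_nat l :: 'k)" using m_pos by simp
  then show "of_nat m ^ 1 * (1 / of_nat k) \<in> A" by simp
qed

definition rdvd :: "'k \<Rightarrow> 'k \<Rightarrow> bool" where "rdvd x y \<longleftrightarrow> (\<exists>c\<in>R. y = x * c)"

lemma rdvd_refl: "rdvd x x" unfolding rdvd_def by (intro bexI[of _ 1]) auto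
lemma rdvd_trans: "rdvd x y \<Longrightarrow> rdvd y z \<Longrightarrow> rdvd x z"
  unfolding rdvd_def by (metis mult.assoc mult_R)
lemma rdvd_mult: "rdvd x y \<Longrightarrow> c \<in> R \<Longrightarrow> rdvd x (c * y)"
  unfolding rdvd_def by (metis mult.left_commute mult_R)
lemma rdvd_add: "rdvd x y \<Longrightarrow> rdvd x z \<Longrightarrow> rdvd x (y + z)"
  unfolding rdvd_def by (metis distrib_left add_R)
lemma rdvd_diff: "rdvd x y \<Longrightarrow> rdvd x z \<Longrightarrow> rdvd x (y - z)"
  unfolding rdvd_def by (metis right_diff_distrib diff_R)
lemma rdvd_0 [simp]: "rdvd x 0" unfolding rdvd_def by (intro bexI[of _ 0]) auto
lemma rdvd_prod:
  assumes "finite F" "i \<in> F" "rdvd x (f i)" "\<And>j. j \<in> F \<Longrightarrow> f j \<in> R"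
  shows "rdvd x (prod f F)"
  using assms by (subst prod.remove[of F i]) (auto simp: mult.commute[of "f i"] intro!: rdvd_mult prod_R)

text \<open>The primes of \<open>m\<close> become units in \<open>R\<close>, so only the factor
  \<open>mfree\<close> of a norm is visible there; \<open>mpart\<close> has to be controlled by
  other means.\<close>

definition mpart :: "int \<Rightarrow> nat" where
  "mpart z = (\<Prod>p\<in>prime_factors m. p ^ multiplicity p (nat \<bar>z\<bar>))"
definition mfree :: "int \<Rightarrow> nat" where "mfree z = nat \<bar>z\<bar> div mpart z"

lemma mpart_pos: "mpart z > 0"
  unfolding mpart_def by (intro prod_pos) (auto simp: in_prime_factors_iff prime_gt_0_nat)

lemma mpart_dvd: assumes "z \<noteq> 0" shows "mpart z dvd nat \<bar>z\<bar>"
proof -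
  define a where "a = nat \<bar>z\<bar>"
  have a: "a > 0" using assms by (simp add: a_def)
  have "(\<Prod>p\<in>prime_factors m. p ^ multiplicity p a) = (\<Prod>p\<in>prime_factors m \<inter> prime_factors a. p ^ multiplicity p a)"
  proof (intro prod.mono_neutral_right ballI)
    fix p assume p: "p \<in> prime_factors m - prime_factors m \<inter> prime_factors a"
    then have "\<not> p dvd a" using a by (auto simp: in_prime_factors_iff)
    then show "p ^ multiplicity p a = 1" by (simp add: not_dvd_imp_multiplicity_0)
  qed auto
  also have "\<dots> dvd (\<Prod>p\<in>prime_factors a. p ^ multiplicity p a)"
    by (intro prod_dvd_prod_subset) auto
  also have "\<dots> = a" using prime_factorization_nat[OF a] by simp
  finally show ?thesis by (simp add: mpart_def a_def)
qed

lemma mpart_mfree: "z \<noteq> 0 \<Longrightarrow> nat \<bar>z\<bar> = mpart z * mfree z"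
  using mpart_dvd[of z] by (simp add: mfree_def)

lemma mpart_mult: assumes "z \<noteq> 0" "w \<noteq> 0" shows "mpart (z * w) = mpart z * mpart w"
  unfolding mpart_def prod.distrib[symmetric]
proof (intro prod.cong refl)
  fix p assume "p \<in> prime_factors m"
  then have "prime_elem p" by (auto simp: in_prime_factors_iff)
  then have "multiplicity p (nat \<bar>z * w\<bar>) = multiplicity p (nat \<bar>z\<bar>) + multiplicity p (nat \<bar>w\<bar>)"
    using assms by (simp add: abs_mult nat_mult_distrib prime_elem_multiplicity_mult_distrib)
  then show "p ^ multiplicity p (nat \<bar>z * w\<bar>) = p ^ multiplicity p (nat \<bar>z\<bar>) * p ^ multiplicity p (nat \<bar>w\<bar>)"
    by (simp add: power_add)
qed

lemma mfree_mult: assumes "z \<noteq> 0" "w \<noteq> 0" shows "mfree (z * w) = mfree z * mfree w"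
proof -
  have "mpart (z * w) * mfree (z * w) = nat \<bar>z * w\<bar>" using mpart_mfree[of "z * w"] assms by simp
  also have "\<dots> = (mpart z * mpart w) * (mfree z * mfree w)"
    using mpart_mfree assms by (simp add: abs_mult nat_mult_distrib)
  finally show ?thesis using mpart_mult[OF assms] mpart_pos[of z] mpart_pos[of w] by simp
qed

lemma mfree_pos: "z \<noteq> 0 \<Longrightarrow> mfree z > 0"
  using mpart_mfree[of z] by (metis gr0I mult_0_right nat_0_iff zero_less_abs_iff not_le)

lemma mfree_m: "mfree (int m) = 1"
proof -
  have "mpart (int m) = m" using prime_factorization_nat[OF m_pos] by (simp add: mpart_def)
  then show ?thesis using m_pos by (simp add: mfree_def)
qed

lemma mfree_1: "mfree 1 = 1"
  using mfree_mult[of 1 1] mfree_pos[of 1] by simp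

lemma mfree_power: "z \<noteq> 0 \<Longrightarrow> mfree (z ^ k) = mfree z ^ k"
  by (induction k) (auto simp: mfree_1 mfree_mult)

lemma mfree_NZ_m: "mfree (NZ (of_nat m ^ k)) = 1"
  using NZ_power[of "of_nat m" k] NZ_of_int[of "int m"] m_pos by (simp add: mfree_power mfree_m)

lemma mpart_dvd_power: "mpart z dvd m ^ k" if "\<And>p. p \<in> prime_factors m \<Longrightarrow> multiplicity p (nat \<bar>z\<bar>) \<le> k"
proof -
  have "mpart z dvd (\<Prod>p\<in>prime_factors m. p ^ k)"
    unfolding mpart_def by (intro prod_dvd_prod le_imp_power_dvd that)
  also have "\<dots> = (\<Prod>p\<in>prime_factors m. p) ^ k" by (rule prod_power_distrib[symmetric])
  also have "\<dots> dvd (\<Prod>p\<in>prime_factors m. p ^ multiplicity p m) ^ k"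
    by (intro dvd_power_same prod_dvd_prod dvd_power) (auto simp: in_prime_factors_iff prime_multiplicity_gt_zero_iff)
  also have "(\<Prod>p\<in>prime_factors m. p ^ multiplicity p m) = m"
    using prime_factorization_nat[OF m_pos] by simp
  finally show ?thesis .
qed

text \<open>A multiplicative norm on \<open>R\<close>. For nonzero \<open>x\<close> any power of
  \<open>m\<close> that carries \<open>x\<close> into \<open>A\<close> gives the same value, since
  the norm of \<open>m\<close> has trivial \<open>mfree\<close> part.\<close>

definition NR :: "'k \<Rightarrow> nat" where
  "NR x = mfree (NZ (of_nat m ^ (SOME k. of_nat m ^ k * x \<in> A) * x))"

lemma NR_eq: assumes "of_nat m ^ k * x \<in> A" "x \<noteq> 0" shows "NR x = mfree (NZ (of_nat m ^ k * x))"
proof -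
  define j where "j = (SOME k. of_nat m ^ k * x \<in> A)"
  have j: "of_nat m ^ j * x \<in> A" unfolding j_def using assms(1) by (rule someI)
  have m0: "(of_nat m :: 'k) \<noteq> 0" using m_pos by simp
  have *: "mfree (NZ (of_nat m ^ i * y)) = mfree (NZ y)" if "y \<in> A" "y \<noteq> 0" for i y
    using that m0 by (simp add: NZ_mult power_A mfree_mult NZ_eq_0 mfree_NZ_m)
  have "mfree (NZ (of_nat m ^ j * x)) = mfree (NZ (of_nat m ^ k * (of_nat m ^ j * x)))"
    using j assms m0 by (subst *) auto
  also have "of_nat m ^ k * (of_nat m ^ j * x) = of_nat m ^ j * (of_nat m ^ k * x)" by simp
  also have "mfree (NZ \<dots>) = mfree (NZ (of_nat m ^ k * x))"
    using assms m0 by (subst *) auto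
  finally show ?thesis unfolding NR_def j_def[symmetric] .
qed

lemma NR_A: "x \<in> A \<Longrightarrow> x \<noteq> 0 \<Longrightarrow> NR x = mfree (NZ x)"
  using NR_eq[of 0 x] by simp

lemma NR_mult: assumes "x \<in> R" "y \<in> R" "x \<noteq> 0" "y \<noteq> 0" shows "NR (x * y) = NR x * NR y"
proof -
  obtain k where k: "of_nat m ^ k * x \<in> A" "of_nat m ^ k * y \<in> A" using R_common[OF assms(1,2)] by blast
  have m0: "(of_nat m :: 'k) \<noteq> 0" using m_pos by simp
  have e: "of_nat m ^ (k + k) * (x * y) = (of_nat m ^ k * x) * (of_nat m ^ k * y)"
    by (simp add: power_add)
  have "NR (x * y) = mfree (NZ ((of_nat m ^ k * x) * (of_nat m ^ k * y)))"
    using NR_eq[of "k + k" "x * y"] k assms by (simp add: e mult_A)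
  also have "\<dots> = NR x * NR y"
    using k assms m0 NR_eq[of k x] NR_eq[of k y] by (simp add: NZ_mult mfree_mult NZ_eq_0)
  finally show ?thesis .
qed

lemma NR_pos: assumes "x \<in> R" "x \<noteq> 0" shows "NR x > 0"
proof -
  obtain k where k: "of_nat m ^ k * x \<in> A" using assms by (auto simp: R_def)
  have m0: "(of_nat m :: 'k) \<noteq> 0" using m_pos by simp
  then show ?thesis using NR_eq[OF k assms(2)] k assms by (simp add: mfree_pos NZ_eq_0)
qed

lemma NR_1: "NR 1 = 1"
  using NR_mult[of 1 1] NR_pos[of 1] by simp

lemma NR_power: "x \<in> R \<Longrightarrow> x \<noteq> 0 \<Longrightarrow> NR (x ^ k) = NR x ^ k"
  by (induction k) (auto simp: NR_1 NR_mult power_R)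

lemma NR_le_of_rdvd: assumes "rdvd x y" "x \<in> R" "y \<noteq> 0" shows "NR x \<le> NR y"
proof -
  obtain c where c: "c \<in> R" "y = x * c" using assms by (auto simp: rdvd_def)
  then show ?thesis using assms NR_mult[of x c] NR_pos[of c] by auto
qed

text \<open>If only primes of \<open>m\<close> divide the norm, then the norm divides a power of
  \<open>m\<close>, and the cofactor from \<open>norm_cofactor\<close> becomes an inverse in
  \<open>R\<close>.\<close>

lemma NR_eq_1_iff: assumes x: "x \<in> R" "x \<noteq> 0" shows "NR x = 1 \<longleftrightarrow> 1 / x \<in> R"
proof
  assume "1 / x \<in> R"
  then show "NR x = 1" using NR_mult[of x "1 / x"] x NR_1 by auto
next
  assume N: "NR x = 1"
  obtain k where k: "of_nat m ^ k * x \<in> A" using x by (auto simp: R_def)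
  define y where "y = of_nat m ^ k * x"
  have m0: "(of_nat m :: 'k) \<noteq> 0" using m_pos by simp
  have y: "y \<in> A" "y \<noteq> 0" using k x m0 by (auto simp: y_def)
  have "mfree (NZ y) = 1" using N NR_eq[OF k x(2)] by (simp add: y_def)
  then have e: "nat \<bar>NZ y\<bar> = mpart (NZ y)" using mpart_mfree[of "NZ y"] y by (simp add: NZ_eq_0)
  define l where "l = (\<Sum>p\<in>prime_factors m. multiplicity p (nat \<bar>NZ y\<bar>))"
  have "mpart (NZ y) dvd m ^ l"
    by (rule mpart_dvd_power) (auto simp: l_def intro!: member_le_sum)
  then obtain c where c: "m ^ l = nat \<bar>NZ y\<bar> * c" unfolding e by blast
  obtain u where u: "u \<in> A" "y * u = of_int (NZ y)" using norm_cofactor[OF y(1)] by blast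
  have "(of_nat m ^ l :: 'k) = of_int (sgn (NZ y)) * of_int (NZ y) * of_nat c"
  proof -
    have "int (m ^ l) = sgn (NZ y) * NZ y * int c"
    proof -
      have "int (m ^ l) = \<bar>NZ y\<bar> * int c" by (simp add: c)
      also have "\<bar>NZ y\<bar> = sgn (NZ y) * NZ y" by (simp add: abs_sgn mult.commute)
      finally show ?thesis .
    qed
    then have "(of_int (int (m ^ l)) :: 'k) = of_int (sgn (NZ y) * NZ y * int c)" by simp
    then show ?thesis by simp
  qed
  then have "of_nat m ^ l * (1 / x) = of_nat m ^ k * (of_int (sgn (NZ y)) * u * of_nat c)"
    using x(2) u(2) by (simp add: field_simps y_def)
  moreover have "\<dots> \<in> A" using u by (intro mult_A power_A) auto
  ultimately show "1 / x \<in> R" by (intro R_I[of l]) simp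
qed

text \<open>The coordinates of the point \<open>x / y\<close> generate an ideal containing
  \<open>M0\<close>, which is invertible in \<open>R\<close>. So \<open>x\<close> and
  \<open>y\<close> are a common factor \<open>g\<close> times a unimodular pair.\<close>

lemma bezout:
  assumes "x \<in> R" "y \<in> R" "x \<noteq> 0 \<or> y \<noteq> 0"
  obtains g u v x' y' where "g \<in> R" "g \<noteq> 0" "u \<in> R" "v \<in> R" "g = u * x + v * y"
    "x' \<in> R" "y' \<in> R" "x = g * x'" "y = g * y'" "u * x' + v * y' = 1"
proof (cases "y = 0")
  case True
  show thesis by (rule that[of x 1 0 1 0]) (use True assms in auto)
next
  case False
  define P where "P = Some (x / y)"
  obtain a b where ab: "a \<in> A" "b \<in> A" "a * X P + b * Y P = of_nat M0" using almost_coprime by blast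
  have YP: "Y P \<noteq> 0" "X P = x / y * Y P" using Y_Some X_Some by (auto simp: P_def)
  have M0: "(of_nat M0 :: 'k) \<noteq> 0" using M0_pos by simp
  define u where "u = a * (1 / of_nat M0)"
  define v where "v = b * (1 / of_nat M0)"
  have uv: "u \<in> R" "v \<in> R" unfolding u_def v_def
    using mult_R[OF A_R inverse_dvd_R[OF M0_dvd]] ab(1,2) by blast+
  have 1: "u * X P + v * Y P = 1" using ab(3) M0 by (simp add: u_def v_def field_simps)
  define g where "g = y / Y P"
  have gx: "x = g * X P" "y = g * Y P" using YP False by (auto simp: g_def)
  have g: "g = u * x + v * y"
  proof -
    have "g * (u * X P + v * Y P) = u * (g * X P) + v * (g * Y P)" by (simp add: algebra_simps)
    then show ?thesis using 1 by (simp only: gx(1)[symmetric] gx(2)[symmetric] mult_1_right)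
  qed
  show thesis
  proof (rule that[of g u v "X P" "Y P"])
    show "g \<in> R" unfolding g by (intro add_R mult_R uv assms)
    show "g \<noteq> 0" using gx(2) False by auto
  qed (fact g gx uv 1 A_R[OF X_A] A_R[OF Y_A])+
qed

section \<open>Primes of the localization\<close>

definition rprime :: "'k \<Rightarrow> bool" where
  "rprime p \<longleftrightarrow> p \<in> R \<and> p \<noteq> 0 \<and> 1 / p \<notin> R \<and> (\<forall>x\<in>R. \<forall>y\<in>R. rdvd p (x * y) \<longrightarrow> rdvd p x \<or> rdvd p y)"

lemma rprimeD:
  assumes "rprime p"
  shows "p \<in> R" "p \<noteq> 0" "1 / p \<notin> R" "x \<in> R \<Longrightarrow> y \<in> R \<Longrightarrow> rdvd p (x * y) \<Longrightarrow> rdvd p x \<or> rdvd p y"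
  using assms by (auto simp: rprime_def)

lemma not_rprime_dvd_1: "rprime p \<Longrightarrow> \<not> rdvd p 1"
  using rprimeD(2,3) unfolding rdvd_def by (metis nonzero_mult_div_cancel_left)

lemma rprime_NR: "rprime p \<Longrightarrow> NR p \<ge> 2"
  using NR_eq_1_iff[of p] NR_pos[of p] rprimeD(1-3)[of p] by linarith

text \<open>A nonunit divisor of least \<open>NR\<close> is prime: if it divides
  \<open>u * v\<close>, its greatest common divisor with \<open>u\<close> is either a unit or an
  associate of it.\<close>

lemma rprime_divisor:
  assumes x: "x \<in> R" "x \<noteq> 0" "1 / x \<notin> R"
  obtains p where "rprime p" "rdvd p x"
proof -
  define good where "good d \<longleftrightarrow> d \<in> R \<and> d \<noteq> 0 \<and> 1 / d \<notin> R \<and> rdvd d x" for d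
  have "good x" using x rdvd_refl by (simp add: good_def)
  then obtain p where p: "good p" and min: "\<And>d. good d \<Longrightarrow> NR p \<le> NR d"
    using ex_has_least_nat[of good x NR] by blast
  have pR: "p \<in> R" "p \<noteq> 0" "1 / p \<notin> R" "rdvd p x" using p by (auto simp: good_def)
  have "rdvd p u \<or> rdvd p v" if uv: "u \<in> R" "v \<in> R" "rdvd p (u * v)" for u v
  proof -
    obtain g \<alpha> \<beta> h u' where g: "g \<in> R" "g \<noteq> 0" "\<alpha> \<in> R" "\<beta> \<in> R" "g = \<alpha> * p + \<beta> * u"
      "h \<in> R" "u' \<in> R" "p = g * h" "u = g * u'"
      by (rule bezout[OF pR(1) uv(1) disjI1[OF pR(2)]])
    show ?thesis
    proof (cases "1 / g \<in> R")
      case True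
      have e: "g * v = (\<alpha> * v) * p + \<beta> * (u * v)"
        by (subst g(5)) (simp add: algebra_simps)
      have "rdvd p ((1 / g) * (g * v))"
        unfolding e
        by (rule rdvd_mult[OF rdvd_add[OF rdvd_mult[OF rdvd_refl mult_R[OF g(3) uv(2)]] rdvd_mult[OF uv(3) g(4)]] True])
      also have "(1 / g) * (g * v) = v" using g(2) by simp
      finally show ?thesis ..
    next
      case False
      have "rdvd g p" using g(6,8) by (auto simp: rdvd_def)
      then have "rdvd g x" using pR(4) by (rule rdvd_trans)
      then have le: "NR p \<le> NR g" using g(1,2) False by (intro min) (simp add: good_def)
      have h0: "h \<noteq> 0" using g(8) pR(2) by auto
      have eq: "NR p = NR g * NR h" using NR_mult[OF g(1,6,2) h0] g(8) by simp
      have "NR h = 1"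
      proof (rule ccontr)
        assume "NR h \<noteq> 1"
        then have "NR h \<ge> 2" using NR_pos[OF g(6) h0] by linarith
        then have "NR g * 2 \<le> NR p" unfolding eq by (rule mult_le_mono2)
        then show False using le NR_pos[OF g(1,2)] by linarith
      qed
      then have "1 / h \<in> R" using NR_eq_1_iff g(6) h0 by blast
      then have "u = p * (u' * (1 / h))" using g(8,9) h0 by simp
      moreover have "u' * (1 / h) \<in> R" by (rule mult_R[OF g(7) \<open>1 / h \<in> R\<close>])
      ultimately show ?thesis unfolding rdvd_def by blast
    qed
  qed
  then have "rprime p" using pR by (simp add: rprime_def)
  with pR(4) that show thesis by blast
qed

lemma rprime_power_bound:
  assumes "rprime p" "x \<in> R" "x \<noteq> 0" "rdvd (p ^ e) x"
  shows "e < NR x"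
proof -
  have "e < 2 ^ e" by (rule less_exp)
  also have "(2::nat) ^ e \<le> NR p ^ e" using rprime_NR[OF assms(1)] by (rule power_mono) simp
  also have "\<dots> = NR (p ^ e)" using rprimeD[OF assms(1)] by (simp add: NR_power)
  also have "\<dots> \<le> NR x" using assms rprimeD[OF assms(1)] by (intro NR_le_of_rdvd) (auto intro: power_R)
  finally show ?thesis .
qed

lemma rprime_decompose:
  assumes "rprime p" "x \<in> R" "x \<noteq> 0"
  obtains e y where "x = p ^ e * y" "y \<in> R" "\<not> rdvd p y"
proof -
  define e where "e = (GREATEST e. rdvd (p ^ e) x)"
  have "rdvd (p ^ 0) x" using assms(2) by (auto simp: rdvd_def)
  then have e: "rdvd (p ^ e) x" and max: "\<And>f. rdvd (p ^ f) x \<Longrightarrow> f \<le> e"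
    unfolding e_def using GreatestI_nat[of "\<lambda>e. rdvd (p ^ e) x" 0 "NR x"] Greatest_le_nat[of "\<lambda>e. rdvd (p ^ e) x" _ "NR x"]
      rprime_power_bound[OF assms] less_imp_le by blast+
  obtain y where y: "y \<in> R" "x = p ^ e * y" using e by (auto simp: rdvd_def)
  have "\<not> rdvd p y"
  proof
    assume "rdvd p y"
    then have "rdvd (p ^ Suc e) x" using y by (auto simp: rdvd_def mult_ac)
    then show False using max[of "Suc e"] by simp
  qed
  with that y show thesis by blast
qed

text \<open>The passage from local to global. If the cofactor \<open>a'\<close> of the gcd were not
  a unit, a prime \<open>p\<close> dividing it would occur in \<open>a\<close> to one power more
  than in the gcd, hence by assumption in \<open>w\<close> to that power too, so that
  \<open>p\<close> would divide both of the coprime cofactors \<open>a'\<close> and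
  \<open>w'\<close>.\<close>

lemma rdvd_from_prime_powers:
  assumes a: "a \<in> R" "a \<noteq> 0" and w: "w \<in> R"
    and pp: "\<And>p e. rprime p \<Longrightarrow> rdvd (p ^ e) a \<Longrightarrow> rdvd (p ^ e) w"
  shows "rdvd a w"
proof -
  obtain g u v a' w' where g: "g \<in> R" "g \<noteq> 0" "u \<in> R" "v \<in> R" "g = u * a + v * w"
    "a' \<in> R" "w' \<in> R" "a = g * a'" "w = g * w'" "u * a' + v * w' = 1"
    by (rule bezout[OF a(1) w disjI1[OF a(2)]])
  have a'0: "a' \<noteq> 0" using a(2) g(8) by (metis mult_zero_right)
  show ?thesis
  proof (cases "1 / a' \<in> R")
    case True
    have "a * ((1 / a') * w') = w" unfolding g(8) using a'0 g(9) by simp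
    then have "w = a * ((1 / a') * w')" ..
    then show ?thesis using True g(7) unfolding rdvd_def by (blast intro: mult_R)
  next
    case False
    obtain p where p: "rprime p" "rdvd p a'" using rprime_divisor[OF g(6) a'0 False] by blast
    obtain j g0 where j: "g = p ^ j * g0" "g0 \<in> R" "\<not> rdvd p g0"
      using rprime_decompose[OF p(1) g(1,2)] by blast
    obtain c where c: "c \<in> R" "a' = p * c" using p(2) by (auto simp: rdvd_def)
    have "a = p ^ Suc j * (g0 * c)" unfolding g(8) j(1) c(2) by simp
    then have "rdvd (p ^ Suc j) a" using j(2) c(1) unfolding rdvd_def by (blast intro: mult_R)
    then have "rdvd (p ^ Suc j) w" by (rule pp[OF p(1)])
    then obtain d where d: "d \<in> R" "w = p ^ Suc j * d" by (auto simp: rdvd_def)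
    have "p ^ j * (g0 * w') = g * w'" by (simp add: j(1) mult.assoc)
    also have "\<dots> = p ^ Suc j * d" using g(9) d(2) by metis
    also have "\<dots> = p ^ j * (p * d)" by (simp add: mult_ac)
    finally have "g0 * w' = p * d" using rprimeD(2)[OF p(1)] by simp
    then have "rdvd p (g0 * w')" using d(1) by (auto simp: rdvd_def)
    then have "rdvd p w'" using rprimeD(4)[OF p(1) j(2) g(7)] j(3) by blast
    then have "rdvd p (u * a' + v * w')" using p(2) g(3,4) by (intro rdvd_add rdvd_mult)
    then show ?thesis using g(10) not_rprime_dvd_1[OF p(1)] by simp
  qed
qed

end

section \<open>The topology of the projective line at a place, and congruences\<close>

lemma openin_P1_topology_abs:
  "openin (P1_topology_abs a) U \<longleftrightarrow> (\<forall>x\<in>U. \<exists>e>0. \<forall>y. chordal a x y < e \<longrightarrow> y \<in> U)"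
proof -
  have "istopology (\<lambda>U. \<forall>x\<in>U. \<exists>e>0. \<forall>y. chordal a x y < e \<longrightarrow> y \<in> U)"
    unfolding istopology_def
  proof (intro conjI allI impI ballI)
    fix S T x
    assume "\<forall>x\<in>S. \<exists>e>0. \<forall>y. chordal a x y < e \<longrightarrow> y \<in> S"
      "\<forall>x\<in>T. \<exists>e>0. \<forall>y. chordal a x y < e \<longrightarrow> y \<in> T" "x \<in> S \<inter> T"
    then obtain e1 e2 where "e1 > 0" "\<forall>y. chordal a x y < e1 \<longrightarrow> y \<in> S"
      "e2 > 0" "\<forall>y. chordal a x y < e2 \<longrightarrow> y \<in> T" by blast
    then show "\<exists>e>0. \<forall>y. chordal a x y < e \<longrightarrow> y \<in> S \<inter> T"
      by (intro exI[of _ "min e1 e2"]) auto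
  next
    fix K x
    assume "\<forall>U\<in>K. \<forall>x\<in>U. \<exists>e>0. \<forall>y. chordal a x y < e \<longrightarrow> y \<in> U" "x \<in> \<Union> K"
    then show "\<exists>e>0. \<forall>y. chordal a x y < e \<longrightarrow> y \<in> \<Union> K" by (meson UnionE UnionI)
  qed
  then show ?thesis unfolding P1_topology_abs_def by (simp add: topology_inverse')
qed

lemma topspace_P1_topology: "topspace (P1_topology v) = UNIV"
proof -
  have "openin (P1_topology v) UNIV"
    unfolding P1_topology_def openin_P1_topology_abs by (auto intro: exI[of _ 1])
  then show ?thesis using openin_subset by blast
qed

context nf_coords
begin

definition D :: "'k option \<Rightarrow> 'k option \<Rightarrow> 'k" where "D P Q = X P * Y Q - X Q * Y P"

lemma D_A: "D P Q \<in> A" unfolding D_def by (intro diff_A mult_A X_A Y_A)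

lemma X_None: "X None \<noteq> 0"
  using almost_coprime[of None] Y_None M0_pos by auto

lemma D_eq_0: "D P Q = 0 \<longleftrightarrow> P = Q"
proof (cases P; cases Q)
  fix x y assume "P = Some x" "Q = Some y"
  then show ?thesis using Y_Some[of x] Y_Some[of y] by (auto simp: D_def X_Some mult_ac)
qed (use X_None Y_Some in \<open>auto simp: D_def Y_None\<close>)

lemma D_commute: "D P Q = - D Q P" by (simp add: D_def)

text \<open>These three-term relations serve as the triangle inequality for \<open>D\<close>, both
  for congruences in \<open>R\<close> and at the archimedean embeddings.\<close>

lemma pluecker: "D P Q * X W = D W Q * X P - D W P * X Q" "D P Q * Y W = D W Q * Y P - D W P * Y Q"
  by (simp_all add: D_def algebra_simps)

end

context nf_local
begin

lemma ordp_ex1: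
  assumes p: "rprime p" and x: "x \<in> R" "x \<noteq> 0"
  shows "\<exists>!e. \<exists>y\<in>R. x = p ^ e * y \<and> \<not> rdvd p y"
proof -
  obtain e y where ey: "x = p ^ e * y" "y \<in> R" "\<not> rdvd p y" using rprime_decompose[OF p x] by blast
  have *: "\<not> e < f" if "p ^ e * y = p ^ f * z" "y \<in> R" "z \<in> R" "\<not> rdvd p y" for e f y z
  proof
    assume "e < f"
    then obtain k where "f = e + Suc k" using less_imp_Suc_add by auto
    then have "p ^ e * y = p ^ e * (p * (p ^ k * z))" using that(1) by (simp add: power_add mult_ac)
    then have "y = p * (p ^ k * z)" using rprimeD(2)[OF p] by simp
    then have "rdvd p y" using rprimeD(1)[OF p] that(3) by (auto simp: rdvd_def intro!: mult_R power_R)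
    with that(4) show False by simp
  qed
  show ?thesis
  proof (intro ex1I[of _ e])
    show "\<exists>y\<in>R. x = p ^ e * y \<and> \<not> rdvd p y" using ey by blast
    fix f assume "\<exists>y\<in>R. x = p ^ f * y \<and> \<not> rdvd p y"
    then obtain z where z: "z \<in> R" "x = p ^ f * z" "\<not> rdvd p z" by blast
    have "p ^ e * y = p ^ f * z" using ey(1) z(2) by simp
    then show "f = e" using *[of e y f z] *[of f z e y] ey(2,3) z(1,3) by auto
  qed
qed

definition ordp :: "'k \<Rightarrow> 'k \<Rightarrow> nat" where
  "ordp p x = (THE e. \<exists>y\<in>R. x = p ^ e * y \<and> \<not> rdvd p y)"

lemma ordp_eqI:
  assumes "rprime p" "y \<in> R" "y \<noteq> 0" "\<not> rdvd p y"
  shows "ordp p (p ^ e * y) = e"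
proof -
  have "p ^ e * y \<in> R" "p ^ e * y \<noteq> 0" using assms rprimeD(1,2)[OF assms(1)] by (auto intro!: mult_R power_R)
  from ordp_ex1[OF assms(1) this] show ?thesis
    unfolding ordp_def by (rule the1_equality) (use assms in blast)
qed

lemma ordp_decompose:
  assumes "rprime p" "x \<in> R" "x \<noteq> 0"
  obtains y where "y \<in> R" "y \<noteq> 0" "x = p ^ ordp p x * y" "\<not> rdvd p y"
proof -
  obtain y where "y \<in> R" "x = p ^ ordp p x * y" "\<not> rdvd p y"
    using theI'[OF ordp_ex1[OF assms]] unfolding ordp_def[symmetric] by blast
  moreover from this have "y \<noteq> 0" using assms(3) by (metis mult_zero_right)
  ultimately show thesis by (intro that)
qed

lemma ordp_mult:
  assumes p: "rprime p" and "x \<in> R" "x \<noteq> 0" "y \<in> R" "y \<noteq> 0"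
  shows "ordp p (x * y) = ordp p x + ordp p y"
proof -
  obtain u where u: "u \<in> R" "u \<noteq> 0" "x = p ^ ordp p x * u" "\<not> rdvd p u" using ordp_decompose[OF p assms(2,3)] by blast
  obtain v where v: "v \<in> R" "v \<noteq> 0" "y = p ^ ordp p y * v" "\<not> rdvd p v" using ordp_decompose[OF p assms(4,5)] by blast
  have "x * y = (p ^ ordp p x * u) * (p ^ ordp p y * v)" using u(3) v(3) by simp
  also have "\<dots> = p ^ (ordp p x + ordp p y) * (u * v)" by (simp add: power_add)
  finally have "x * y = p ^ (ordp p x + ordp p y) * (u * v)" .
  then show ?thesis using ordp_eqI[OF p, of "u * v"] u v rprimeD(4)[OF p u(1) v(1)] by (auto intro: mult_R)
qed

lemma le_ordp_iff:
  assumes p: "rprime p" and x: "x \<in> R" "x \<noteq> 0"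
  shows "e \<le> ordp p x \<longleftrightarrow> rdvd (p ^ e) x"
proof
  obtain y where y: "y \<in> R" "x = p ^ ordp p x * y" using ordp_decompose[OF p x] by blast
  assume "e \<le> ordp p x"
  then have "x = p ^ e * (p ^ (ordp p x - e) * y)"
    using y(2) by (simp flip: mult.assoc power_add)
  then show "rdvd (p ^ e) x" using y(1) rprimeD(1)[OF p] unfolding rdvd_def by (blast intro: mult_R power_R)
next
  assume "rdvd (p ^ e) x"
  then obtain z where z: "z \<in> R" "x = p ^ e * z" by (auto simp: rdvd_def)
  then have "z \<noteq> 0" using x by auto
  then obtain w where w: "w \<in> R" "w \<noteq> 0" "z = p ^ ordp p z * w" "\<not> rdvd p w" using ordp_decompose[OF p z(1)] by blast
  have "x = p ^ (e + ordp p z) * w" using z(2) w(3) by (metis power_add mult.assoc)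
  then have "ordp p x = e + ordp p z" using ordp_eqI[OF p w(1,2,4)] by simp
  then show "e \<le> ordp p x" by simp
qed

lemma ordp_1: "rprime p \<Longrightarrow> ordp p 1 = 0"
  using ordp_eqI[of p 1 0] not_rprime_dvd_1 by simp

lemma ordp_self: "rprime p \<Longrightarrow> ordp p p = 1"
  using ordp_eqI[of p 1 1] not_rprime_dvd_1 by simp

text \<open>The \<open>p\<close>-adic absolute value, normalized to 1/2 at \<open>p\<close>; any
  other base above 1 would define the same place. A natural denominator \<open>k\<close> reduces to
  elements of \<open>R\<close>, and \<open>aval_frac\<close> shows that its choice does not
  matter.\<close>

definition aval :: "'k \<Rightarrow> 'k \<Rightarrow> real" where
  "aval p x = (if x = 0 then 0 else
     let k = SOME k::nat. k > 0 \<and> of_nat k * x \<in> A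
     in 2 powr (real (ordp p (of_nat k)) - real (ordp p (of_nat k * x))))"

lemma aval_frac:
  assumes p: "rprime p" and ab: "a \<in> R" "a \<noteq> 0" "b \<in> R" "b \<noteq> 0"
  shows "aval p (a / b) = 2 powr (real (ordp p b) - real (ordp p a))"
proof -
  define k where "k = (SOME k::nat. k > 0 \<and> of_nat k * (a / b) \<in> A)"
  have k: "k > 0 \<and> of_nat k * (a / b) \<in> A"
    unfolding k_def by (rule someI_ex) (use denom[of "a / b"] in blast)
  have k0: "(of_nat k :: 'k) \<noteq> 0" using k by simp
  define c where "c = of_nat k * (a / b)"
  have c: "c \<in> R" "c \<noteq> 0" using k k0 ab by (auto simp: c_def intro: A_R)
  have "c * b = of_nat k * a" using ab by (simp add: c_def)
  then have "ordp p c + ordp p b = ordp p (of_nat k) + ordp p a"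
    using ordp_mult[OF p c ab(3,4)] ordp_mult[OF p A_R[OF of_nat_A] k0 ab(1,2)] by metis
  then have "real (ordp p (of_nat k)) - real (ordp p c) = real (ordp p b) - real (ordp p a)"
    by linarith
  then show ?thesis unfolding aval_def Let_def k_def[symmetric] c_def[symmetric] using ab by simp
qed

lemma aval_R: "rprime p \<Longrightarrow> x \<in> R \<Longrightarrow> x \<noteq> 0 \<Longrightarrow> aval p x = 2 powr - real (ordp p x)"
  using aval_frac[of p x 1] by (simp add: ordp_1)

lemma fraction_repr:
  assumes "x \<noteq> 0" obtains a b where "a \<in> R" "a \<noteq> 0" "b \<in> R" "b \<noteq> 0" "x = a / b"
proof -
  obtain k :: nat where k: "k > 0" "of_nat k * x \<in> A" using denom by blast
  show thesis
    by (rule that[of "of_nat k * x" "of_nat k"]) (use k A_R[OF k(2)] A_R[OF of_nat_A] assms in auto)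
qed

lemma aval_0 [simp]: "aval p 0 = 0" by (simp add: aval_def)

lemma aval_mult: assumes p: "rprime p" shows "aval p (x * y) = aval p x * aval p y"
proof (cases "x = 0 \<or> y = 0")
  case False
  then obtain a b c d where "a \<in> R" "a \<noteq> 0" "b \<in> R" "b \<noteq> 0" "x = a / b" "c \<in> R" "c \<noteq> 0" "d \<in> R" "d \<noteq> 0" "y = c / d"
    by (metis fraction_repr)
  then show ?thesis
    using aval_frac[OF p, of "a * c" "b * d"] aval_frac[OF p, of a b] aval_frac[OF p, of c d]
    by (simp add: mult_R ordp_mult[OF p] flip: powr_add) (simp add: algebra_simps)
qed auto

lemma aval_add: assumes p: "rprime p" shows "aval p (x + y) \<le> max (aval p x) (aval p y)"
proof (cases "x = 0 \<or> y = 0 \<or> x + y = 0")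
  case False
  then obtain a b c d where ab: "a \<in> R" "a \<noteq> 0" "b \<in> R" "b \<noteq> 0" "x = a / b"
    and cd: "c \<in> R" "c \<noteq> 0" "d \<in> R" "d \<noteq> 0" "y = c / d"
    by (metis fraction_repr)
  define e where "e = min (ordp p (a * d)) (ordp p (c * b))"
  have xy: "x + y = (a * d + c * b) / (b * d)" using ab cd by (simp add: field_simps)
  have R: "a * d + c * b \<in> R" "b * d \<in> R" "a * d \<in> R" "c * b \<in> R" "a * d \<noteq> 0" "c * b \<noteq> 0" "b * d \<noteq> 0"
    using ab cd by (auto intro!: add_R mult_R)
  have nz: "a * d + c * b \<noteq> 0" using xy False by auto
  have "rdvd (p ^ e) (a * d)" "rdvd (p ^ e) (c * b)"
    using R by (auto simp: e_def simp flip: le_ordp_iff[OF p])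
  then have "rdvd (p ^ e) (a * d + c * b)" by (rule rdvd_add)
  then have "e \<le> ordp p (a * d + c * b)" using le_ordp_iff[OF p R(1) nz] by simp
  then have "aval p (x + y) \<le> 2 powr (real (ordp p (b * d)) - real e)"
    unfolding xy using aval_frac[OF p R(1) nz R(2) R(7)] by simp
  also have "\<dots> \<le> max (aval p x) (aval p y)"
  proof -
    have "aval p x = 2 powr (real (ordp p (b * d)) - real (ordp p (a * d)))"
      "aval p y = 2 powr (real (ordp p (b * d)) - real (ordp p (c * b)))"
      using ab cd aval_frac[OF p, of a b] aval_frac[OF p, of c d] by (simp_all add: ordp_mult[OF p])
    then show ?thesis by (auto simp: e_def min_def le_max_iff_disj)
  qed
  finally show ?thesis .
next
  case True
  have "aval p z \<ge> 0" for z by (simp add: aval_def Let_def)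
  then show ?thesis using True by (auto simp: le_max_iff_disj)
qed

lemma nontrivial_aval: assumes p: "rprime p" shows "nontrivial_abs_val (aval p)"
  unfolding nontrivial_abs_val_def is_abs_val_def
proof (intro conjI allI)
  show nn: "aval p x \<ge> 0" for x by (simp add: aval_def Let_def)
  show "aval p x = 0 \<longleftrightarrow> x = 0" for x by (simp add: aval_def Let_def)
  show "aval p (x * y) = aval p x * aval p y" for x y by (rule aval_mult[OF p])
  show "aval p (x + y) \<le> aval p x + aval p y" for x y
    using aval_add[OF p, of x y] nn[of x] nn[of y] by linarith
  show "\<exists>x. x \<noteq> 0 \<and> aval p x \<noteq> 1"
    using aval_R[OF p rprimeD(1,2)[OF p]] rprimeD(2)[OF p] by (intro exI[of _ p]) (simp add: ordp_self[OF p])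
qed

definition place :: "'k \<Rightarrow> ('k \<Rightarrow> real) set" where
  "place p = {b. nontrivial_abs_val b \<and> equiv_abs_val (aval p) b}"

lemma place_in_places: "rprime p \<Longrightarrow> place p \<in> places"
  unfolding places_def place_def using nontrivial_aval by blast

lemma aval_in_place: "rprime p \<Longrightarrow> aval p \<in> place p"
  unfolding place_def equiv_abs_val_def using nontrivial_aval[of p]
  by (auto intro!: exI[of _ 1] simp: nontrivial_abs_val_def is_abs_val_def)

text \<open>Formulated for every member \<open>b\<close> of the place, because
  \<open>P1_topology\<close> works with an arbitrarily selected one.\<close>

lemma place_le_iff:
  assumes p: "rprime p" and b: "b \<in> place p" and x: "x \<in> R"
  shows "b x \<le> b p ^ e \<longleftrightarrow> rdvd (p ^ e) x"
proof -
  obtain c where c: "c > 0" "\<And>x. b x = aval p x powr c" using b by (auto simp: place_def equiv_abs_val_def)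
  have bx: "b x = 2 powr (- c * real (ordp p x))" if "x \<in> R" "x \<noteq> 0" for x
    unfolding c(2) aval_R[OF p that] powr_powr by (simp add: mult.commute)
  have "b p = 2 powr - c" using bx[OF rprimeD(1,2)[OF p]] by (simp add: ordp_self[OF p])
  then have pe: "b p ^ e = 2 powr (- c * real e)" by (simp add: powr_power mult.commute)
  show ?thesis
  proof (cases "x = 0")
    case True
    then show ?thesis unfolding pe c(2) by simp
  next
    case False
    then show ?thesis unfolding pe bx[OF x False] le_ordp_iff[OF p x False, symmetric] using c(1) by simp
  qed
qed

lemma placeD:
  assumes "b \<in> place p"
  shows "b x \<ge> 0" "b (x * y) = b x * b y" "b x = 0 \<longleftrightarrow> x = 0"
  using assms by (auto simp: place_def nontrivial_abs_val_def is_abs_val_def)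

lemma place_1: assumes b: "b \<in> place p" shows "b 1 = 1"
  using placeD(2)[OF b, of 1 1] placeD(3)[OF b, of 1] by simp

lemma place_R_le_1: "rprime p \<Longrightarrow> b \<in> place p \<Longrightarrow> x \<in> R \<Longrightarrow> b x \<le> 1"
  using place_le_iff[of p b x 0] by (auto simp: rdvd_def)

lemma place_eq_1:
  assumes p: "rprime p" and b: "b \<in> place p" and x: "x \<in> R" "\<not> rdvd p x"
  shows "b x = 1"
proof -
  obtain c where c: "c > 0" "\<And>x. b x = aval p x powr c" using b by (auto simp: place_def equiv_abs_val_def)
  have x0: "x \<noteq> 0" using x by auto
  have "ordp p x = 0" using le_ordp_iff[OF p x(1) x0, of 1] x(2) by simp
  then show ?thesis unfolding c(2) using aval_R[OF p x(1) x0] by simp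
qed

lemma coprime_coords: obtains u v where "u \<in> R" "v \<in> R" "u * X P + v * Y P = 1"
proof -
  obtain a b where ab: "a \<in> A" "b \<in> A" "a * X P + b * Y P = of_nat M0" using almost_coprime by blast
  have M0: "(of_nat M0 :: 'k) \<noteq> 0" using M0_pos by simp
  have iM: "1 / of_nat M0 \<in> R" by (rule inverse_dvd_R[OF M0_dvd])
  have "(a * (1 / of_nat M0)) * X P + (b * (1 / of_nat M0)) * Y P = (a * X P + b * Y P) * (1 / of_nat M0)"
    by (simp add: algebra_simps add_divide_distrib)
  also have "\<dots> = 1" unfolding ab(3) using M0 by simp
  finally show thesis by (rule that[OF mult_R[OF A_R[OF ab(1)] iM] mult_R[OF A_R[OF ab(2)] iM]])
qed

lemma XY_R: "X P \<in> R" "Y P \<in> R" "D P Q \<in> R"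
  by (auto intro: A_R X_A Y_A D_A)

lemma max_coords:
  assumes p: "rprime p" and b: "b \<in> place p"
  shows "max (b (X P)) (b (Y P)) = 1"
proof -
  obtain u v where uv: "u \<in> R" "v \<in> R" "u * X P + v * Y P = 1" by (rule coprime_coords)
  have "\<not> (rdvd p (X P) \<and> rdvd p (Y P))"
  proof
    assume "rdvd p (X P) \<and> rdvd p (Y P)"
    then have "rdvd p (u * X P + v * Y P)" using uv(1,2) by (intro rdvd_add rdvd_mult) auto
    then show False unfolding uv(3) using not_rprime_dvd_1[OF p] by simp
  qed
  then have "b (X P) = 1 \<or> b (Y P) = 1" using place_eq_1[OF p b] XY_R by blast
  moreover have "b (X P) \<le> 1" "b (Y P) \<le> 1" using place_R_le_1[OF p b] XY_R by blast+
  ultimately show ?thesis by linarith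
qed

text \<open>The selected coordinates have maximum 1 at \<open>b\<close>, so
  \<open>1 / max 1 (b x)\<close> is the absolute value of the second coordinate, and the
  denominators of the chordal metric turn into the factors that clear denominators in
  \<open>x - y\<close>.\<close>

lemma chordal_D:
  assumes p: "rprime p" and b: "b \<in> place p"
  shows "chordal b P Q = b (D P Q)"
proof -
  have 1: "1 / max 1 (b x) = b (Y (Some x))" for x
  proof -
    have "b (Y (Some x)) > 0"
      using placeD(1)[OF b, of "Y (Some x)"] placeD(3)[OF b, of "Y (Some x)"] Y_Some[of x]
      by (simp add: less_le)
    moreover have "b (X (Some x)) = b x * b (Y (Some x))" unfolding X_Some by (rule placeD(2)[OF b])
    ultimately have "max 1 (b x) * b (Y (Some x)) = 1"
      using max_coords[OF p b, of "Some x"] by (simp add: max_mult_distrib_right max.commute)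
    then show ?thesis by (metis nonzero_eq_divide_eq mult.commute mult_zero_left zero_neq_one)
  qed
  have N: "b (X None) = 1" using max_coords[OF p b, of None] placeD(1)[OF b, of "X None"] placeD(3)[OF b, of 0]
    by (auto simp: Y_None max_def split: if_splits)
  have uminus: "b (- x) = b x" for x
  proof -
    have "b (-1) * b (-1) = 1" using placeD(2)[OF b, of "-1" "-1"] place_1[OF b] by simp
    then have "b (-1) = 1" using placeD(1)[OF b, of "-1"] by (metis abs_of_nonneg real_sqrt_abs2 real_sqrt_one)
    then show ?thesis using placeD(2)[OF b, of "-1" x] by simp
  qed
  show ?thesis
  proof (cases P)
    case None
    show ?thesis
    proof (cases Q)
      case None
      then show ?thesis using \<open>P = None\<close> placeD(3)[OF b, of 0] by (simp add: D_def)
    next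
      case (Some y)
      then show ?thesis using \<open>P = None\<close> 1[of y] N placeD(2)[OF b] by (simp add: D_def Y_None)
    qed
  next
    case (Some x)
    show ?thesis
    proof (cases Q)
      case None
      then show ?thesis using \<open>P = Some x\<close> 1[of x] N placeD(2)[OF b] by (simp add: D_def Y_None uminus)
    next
      case (Some y)
      have "chordal b P Q = b (x - y) * (1 / max 1 (b x)) * (1 / max 1 (b y))"
        using \<open>P = Some x\<close> Some by simp
      also have "\<dots> = b ((x - y) * Y (Some x) * Y (Some y))"
        unfolding 1 by (simp add: placeD(2)[OF b])
      also have "(x - y) * Y (Some x) * Y (Some y) = D P Q"
        using \<open>P = Some x\<close> Some by (simp add: D_def X_Some algebra_simps)
      finally show ?thesis .
    qed
  qed
qed

text \<open>Write 1 as a combination of the coordinates of the middle point \<open>W\<close> and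
  expand \<open>D P Q\<close> by the Pluecker relations.\<close>

lemma rdvd_D_trans:
  assumes "rdvd q (D P W)" "rdvd q (D W Q)"
  shows "rdvd q (D P Q)"
proof -
  obtain u v where uv: "u \<in> R" "v \<in> R" "u * X W + v * Y W = 1" by (rule coprime_coords)
  have "D P Q = u * (D P Q * X W) + v * (D P Q * Y W)"
  proof -
    have "D P Q = D P Q * (u * X W + v * Y W)" using uv(3) by simp
    then show ?thesis by (simp add: algebra_simps)
  qed
  also have "\<dots> = u * (X P * D W Q + X Q * D P W) + v * (Y P * D W Q + Y Q * D P W)"
    unfolding pluecker[of P Q W] D_commute[of P W] by (simp add: algebra_simps)
  finally have e: "D P Q = \<dots>" .
  show ?thesis unfolding e using assms uv XY_R by (intro rdvd_add rdvd_mult)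
qed

lemma rdvd_uminus: "rdvd q (- x) \<longleftrightarrow> rdvd q x"
  using rdvd_diff[of q 0 x] rdvd_diff[of q 0 "- x"] by auto

lemma rdvd_D_sym: "rdvd q (D P Q) \<longleftrightarrow> rdvd q (D Q P)"
  by (subst D_commute) (rule rdvd_uminus)

lemma openin_congruence_class:
  assumes p: "rprime p"
  shows "openin (P1_topology (place p)) {Q. rdvd (p ^ e) (D P Q)}"
proof -
  define b where "b = (SOME a. a \<in> place p)"
  have b: "b \<in> place p" unfolding b_def by (rule someI[of "\<lambda>a. a \<in> place p", OF aval_in_place[OF p]])
  have "b p \<noteq> 0" using placeD(3)[OF b, of p] rprimeD(2)[OF p] by blast
  then have "b p > 0" using placeD(1)[OF b, of p] by linarith
  then have pos: "b p ^ e > 0" by (rule zero_less_power)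
  have "rdvd (p ^ e) (D P W)" if "rdvd (p ^ e) (D P Q)" "chordal b Q W < b p ^ e" for Q W
  proof -
    have "b (D Q W) \<le> b p ^ e" using that(2) chordal_D[OF p b, of Q W] by simp
    then have "rdvd (p ^ e) (D Q W)" using place_le_iff[OF p b XY_R(3)] by blast
    with that(1) show ?thesis by (rule rdvd_D_trans)
  qed
  then have "openin (P1_topology_abs b) {Q. rdvd (p ^ e) (D P Q)}"
    unfolding openin_P1_topology_abs using pos by blast
  then show ?thesis by (simp only: P1_topology_def b_def)
qed

text \<open>Serves to guarantee a place outside \<open>S\<close>. A rational prime \<open>q\<close>
  larger than \<open>m\<close> is a nonunit of \<open>R\<close>, because otherwise
  \<open>q ^ n\<close> would divide a power of \<open>m\<close>.\<close>

lemma rprime_ex: obtains p where "rprime p"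
proof -
  obtain q :: nat where q: "prime q" "q > m" using bigger_prime by blast
  have cop: "\<not> q dvd m" using q m_pos by (auto dest: dvd_imp_le)
  define x where "x = (of_nat q :: 'k)"
  have x: "x \<in> R" "x \<noteq> 0" using q by (auto simp: x_def A_R prime_gt_0_nat)
  have "1 / x \<notin> R"
  proof
    assume "1 / x \<in> R"
    then obtain k where k: "of_nat m ^ k * (1 / x) \<in> A" by (auto simp: R_def)
    define y where "y = of_nat m ^ k * (1 / x)"
    have "x * y = of_int (int m ^ k)" using x by (simp add: y_def)
    then have "NZ x * NZ y = NZ (of_int (int m ^ k))" using NZ_mult[of x y] k by (simp add: x_def y_def)
    then have "int q ^ n * NZ y = (int m ^ k) ^ n"
      using NZ_of_int[of "int q"] NZ_of_int[of "int m ^ k"] by (simp add: x_def)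
    then have "int q ^ n dvd int m ^ (k * n)" by (metis dvd_triv_left power_mult)
    moreover have "int q dvd int q ^ n" using n_pos by simp
    ultimately have "int q dvd int m ^ (k * n)" by (rule dvd_trans[rotated])
    then have "q dvd m" using q(1) by (metis int_dvd_int_iff of_nat_power prime_dvd_power)
    with cop show False by simp
  qed
  from rprime_divisor[OF x this] that show thesis by blast
qed

text \<open>The condition on \<open>S\<close> puts \<open>m\<close> into the maximal ideal of each
  finite place of \<open>S\<close>. But \<open>m\<close> is invertible in \<open>R\<close>, so it
  cannot have absolute value below 1 at \<open>place p\<close>.\<close>

lemma place_notin:
  assumes p: "rprime p"
    and S: "\<And>v. v \<in> S \<Longrightarrow> \<exists>a\<in>v. (\<forall>j::nat. a (of_nat j) \<le> 1) \<and> (\<exists>k::nat>0. a (of_nat k) < 1) \<Longrightarrow>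
      \<exists>a\<in>v. a (of_nat m) < 1"
  shows "place p \<notin> S"
proof
  assume mem: "place p \<in> S"
  define b where "b = aval p"
  have b: "b \<in> place p" unfolding b_def by (rule aval_in_place[OF p])
  \<comment> \<open>The prime \<open>p\<close> divides the norm of its associate
    \<open>of_nat m ^ j * p\<close>, which produces a positive integer of absolute value below 1, as
    the condition on \<open>S\<close> demands.\<close>
  obtain j where j: "of_nat m ^ j * p \<in> A" using rprimeD(1)[OF p] by (auto simp: R_def)
  obtain u where u: "u \<in> A" "of_nat m ^ j * p * u = of_int (NZ (of_nat m ^ j * p))"
    using norm_cofactor[OF j] by blast
  define z where "z = NZ (of_nat m ^ j * p)"
  have z0: "z \<noteq> 0" using NZ_eq_0[OF j] m_pos rprimeD(2)[OF p] by (simp add: z_def)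
  have "of_nat (nat \<bar>z\<bar>) = (of_int (sgn z) * of_int z :: 'k)"
  proof -
    have "int (nat \<bar>z\<bar>) = sgn z * z" by (simp add: sgn_if)
    then have "(of_int (int (nat \<bar>z\<bar>)) :: 'k) = of_int (sgn z * z)" by simp
    then show ?thesis by simp
  qed
  also have "\<dots> = p * (of_int (sgn z) * of_nat m ^ j * u)"
    using u(2) by (simp add: z_def mult_ac)
  finally have "rdvd (p ^ 1) (of_nat (nat \<bar>z\<bar>))"
    unfolding rdvd_def power_one_right 
    by (rule bexI[OF _ A_R[OF mult_A[OF mult_A[OF of_int_A power_A[OF of_nat_A]] u(1)]]])
  then have "b (of_nat (nat \<bar>z\<bar>)) \<le> b p ^ 1" using place_le_iff[OF p b A_R[OF of_nat_A]] by blast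
  also have "b p < 1 ^ 1"
    unfolding b_def using aval_R[OF p rprimeD(1,2)[OF p]] by (simp add: ordp_self[OF p] powr_minus)
  finally have lt: "b (of_nat (nat \<bar>z\<bar>)) < 1" by simp
  have "\<exists>a\<in>place p. (\<forall>j::nat. a (of_nat j) \<le> 1) \<and> (\<exists>k::nat>0. a (of_nat k) < 1)"
    using b z0 lt place_R_le_1[OF p b A_R[OF of_nat_A]]
    by (intro bexI[of _ b] conjI allI exI[of _ "nat \<bar>z\<bar>"]) auto
  from S[OF mem this] obtain a where a: "a \<in> place p" "a (of_nat m) < 1" by blast
  have "a (of_nat m * (1 / of_nat m)) = 1" using m_pos place_1[OF a(1)] by simp
  then have "a (of_nat m) * a (1 / of_nat m) = 1" by (simp only: placeD(2)[OF a(1)])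
  moreover have "a (1 / of_nat m) \<le> 1" using place_R_le_1[OF p a(1) inverse_dvd_R[OF dvd_refl]] .
  moreover have "a (of_nat m) \<ge> 0" by (rule placeD(1)[OF a(1)])
  ultimately have "1 \<le> a (of_nat m)" by (metis mult.right_neutral mult_left_mono)
  then show False using a(2) by simp
qed

end

section \<open>Binary forms and resultants\<close>

text \<open>The homogenization of \<open>p\<close> in a degree \<open>k\<close> that may exceed the
  degree of \<open>p\<close>: both polynomials of a rational map are homogenized in the same
  degree.\<close>

definition hform :: "nat \<Rightarrow> 'a::field poly \<Rightarrow> 'a \<Rightarrow> 'a \<Rightarrow> 'a" where
  "hform k p x y = (\<Sum>i\<le>k. coeff p i * x ^ i * y ^ (k - i))"

lemma hform_eq: "degree p \<le> k \<Longrightarrow> y \<noteq> 0 \<Longrightarrow> hform k p x y = y ^ k * poly p (x / y)"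
proof -
  assume d: "degree p \<le> k" and y: "y \<noteq> 0"
  have "poly p (x / y) = (\<Sum>i\<le>k. coeff p i * (x / y) ^ i)"
    unfolding poly_altdef using d by (intro sum.mono_neutral_left) (auto simp: coeff_eq_0)
  then show ?thesis
    using y by (auto simp: hform_def sum_distrib_left power_divide power_diff intro!: sum.cong)
qed

lemma hform_0: "hform k p x 0 = coeff p k * x ^ k"
proof -
  have "hform k p x 0 = (\<Sum>i\<in>{k}. coeff p i * x ^ i * 0 ^ (k - i))"
    unfolding hform_def by (intro sum.mono_neutral_right) auto
  then show ?thesis by simp
qed

lemma hform_add: "hform k (p + q) x y = hform k p x y + hform k q x y"
  by (simp add: hform_def algebra_simps sum.distrib)

lemma hform_mult:
  assumes "degree p \<le> a" "degree q \<le> b"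
  shows "hform (a + b) (p * q) x y = hform a p x y * hform b q x y"
proof (cases "y = 0")
  case True
  have "coeff (p * q) (a + b) = (\<Sum>i\<in>{a}. coeff p i * coeff q (a + b - i))"
    unfolding coeff_mult
  proof (intro sum.mono_neutral_right ballI)
    fix i assume "i \<in> {..a + b} - {a}"
    then consider "i < a" | "i > a" by force
    then show "coeff p i * coeff q (a + b - i) = 0"
      using assms by cases (auto simp: coeff_eq_0)
  qed auto
  then show ?thesis using True by (simp add: hform_0 power_add)
next
  case False
  have "degree (p * q) \<le> a + b" using degree_mult_le[of p q] assms by linarith
  then show ?thesis using False assms by (simp add: hform_eq power_add)
qed

lemma poly_bezout:
  fixes f g :: "'a::field poly"
  assumes "coprime f g"
  obtains u w where "u * f + w * g = 1"
proof -
  define I where "I = {h. \<exists>u w. h = u * f + w * g}"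
  have fI: "f \<in> I" unfolding I_def by (rule CollectI, rule exI[of _ 1], rule exI[of _ 0]) simp
  have gI: "g \<in> I" unfolding I_def by (rule CollectI, rule exI[of _ 0], rule exI[of _ 1]) simp
  have lin: "a - c * b \<in> I" if ab: "a \<in> I" "b \<in> I" for a b c
  proof -
    obtain u w u' w' where e: "a = u * f + w * g" "b = u' * f + w' * g" using ab unfolding I_def by blast
    have "a - c * b = (u - c * u') * f + (w - c * w') * g" unfolding e by (simp add: algebra_simps)
    then show ?thesis unfolding I_def by blast
  qed
  have "f \<noteq> 0 \<or> g \<noteq> 0" using assms by auto
  then have "\<exists>h. h \<in> I \<and> h \<noteq> 0" using fI gI by blast
  then obtain h where h: "h \<in> I" "h \<noteq> 0" and min: "\<And>r. r \<in> I \<Longrightarrow> r \<noteq> 0 \<Longrightarrow> degree h \<le> degree r"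
    using ex_has_least_nat[of "\<lambda>h. h \<in> I \<and> h \<noteq> 0" _ degree] by blast
  have dvd: "h dvd r" if "r \<in> I" for r
  proof (rule ccontr)
    assume "\<not> h dvd r"
    then have nz: "r mod h \<noteq> 0" by (simp add: dvd_eq_mod_eq_0)
    have "r mod h \<in> I" using lin[OF that h(1), of "r div h"] by (simp add: minus_div_mult_eq_mod)
    from min[OF this nz] show False using degree_mod_less[OF h(2), of r] nz by simp
  qed
  from assms dvd[OF fI] dvd[OF gI] have "is_unit h" by (rule coprime_common_divisor)
  then obtain v where v: "1 = h * v" by (elim dvdE)
  obtain u w where "h = u * f + w * g" using h(1) unfolding I_def by blast
  then have "(v * u) * f + (v * w) * g = 1" using v by (simp add: algebra_simps)
  then show thesis by (rule that)
qed

text \<open>In the binomial expansion every term contains \<open>u ^ j\<close> or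
  \<open>v ^ k\<close>. The set \<open>S\<close> keeps track of the coefficients, which later have
  to lie in \<open>A\<close>.\<close>

lemma binomial_in_powers:
  fixes u v :: "'a::comm_ring_1"
  assumes S: "1 \<in> S" "0 \<in> S" "\<And>x y. x \<in> S \<Longrightarrow> y \<in> S \<Longrightarrow> x + y \<in> S" "\<And>x y. x \<in> S \<Longrightarrow> y \<in> S \<Longrightarrow> x * y \<in> S"
    and uv: "u \<in> S" "v \<in> S"
  shows "\<exists>\<alpha>\<in>S. \<exists>\<beta>\<in>S. (u + v) ^ (j + k) = \<alpha> * u ^ j + \<beta> * v ^ k"
proof (induction "j + k" arbitrary: j k)
  case 0
  then show ?case using S(1,2) by (intro bexI[of _ 1] bexI[of _ 0]) auto
next
  case (Suc N)
  have pw: "(u + v) ^ i \<in> S" for i by (induction i) (auto intro: S uv)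
  show ?case
  proof (cases "j = 0 \<or> k = 0")
    case True
    then show ?thesis
    proof
      assume "j = 0"
      then show ?thesis using pw S(2) by (intro bexI[of _ "(u + v) ^ (j + k)"] bexI[of _ 0]) auto
    next
      assume "k = 0"
      then show ?thesis using pw S(2) by (intro bexI[of _ 0] bexI[of _ "(u + v) ^ (j + k)"]) auto
    qed
  next
    case False
    then obtain j' k' where jk: "j = Suc j'" "k = Suc k'" by (metis not0_implies_Suc)
    have N: "N = j' + k" "N = j + k'" using Suc(2) jk by auto
    obtain a b where ab: "a \<in> S" "b \<in> S" "(u + v) ^ N = a * u ^ j' + b * v ^ k"
      using Suc(1)[OF N(1)] N(1) by auto
    obtain a' b' where ab': "a' \<in> S" "b' \<in> S" "(u + v) ^ N = a' * u ^ j + b' * v ^ k'"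
      using Suc(1)[OF N(2)] N(2) by auto
    have "(u + v) ^ (j + k) = u * (u + v) ^ N + v * (u + v) ^ N"
      unfolding Suc(2)[symmetric] by (simp add: algebra_simps)
    also have "\<dots> = u * (a * u ^ j' + b * v ^ k) + v * (a' * u ^ j + b' * v ^ k')"
      using ab(3) ab'(3) by metis
    also have "\<dots> = (a + v * a') * u ^ j + (u * b + b') * v ^ k"
      by (simp add: jk algebra_simps)
    finally have "(u + v) ^ (j + k) = \<dots>" .
    moreover have "a + v * a' \<in> S" "u * b + b' \<in> S" using ab ab' S uv by auto
    ultimately show ?thesis by blast
  qed
qed

context nf_order
begin

text \<open>Abstracts from binary forms of degree \<open>e\<close> over \<open>A\<close> the properties needed for height estimates.\<close>
definition is_form :: "nat \<Rightarrow> ('k \<Rightarrow> 'k \<Rightarrow> 'k) \<Rightarrow> bool" where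
  "is_form e \<alpha> \<longleftrightarrow> (\<forall>x\<in>A. \<forall>y\<in>A. \<alpha> x y \<in> A) \<and>
     (\<exists>C\<ge>0. \<forall>x y. \<forall>i<n. norm (s i (\<alpha> x y)) \<le> C * max (norm (s i x)) (norm (s i y)) ^ e)"

lemma is_formE:
  assumes "is_form e \<alpha>"
  obtains C where "C \<ge> 0" "\<And>x y i. i < n \<Longrightarrow> norm (s i (\<alpha> x y)) \<le> C * max (norm (s i x)) (norm (s i y)) ^ e"
  using assms unfolding is_form_def by blast

lemma is_form_A: "is_form e \<alpha> \<Longrightarrow> x \<in> A \<Longrightarrow> y \<in> A \<Longrightarrow> \<alpha> x y \<in> A"
  unfolding is_form_def by blast

lemma is_form_const: "c \<in> A \<Longrightarrow> is_form 0 (\<lambda>_ _. c)"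
  unfolding is_form_def
proof (intro conjI)
  show "\<exists>C\<ge>0. \<forall>x y. \<forall>i<n. norm (s i c) \<le> C * max (norm (s i x)) (norm (s i y)) ^ 0"
    by (intro exI[of _ "\<Sum>i<n. norm (s i c)"]) (auto intro!: sum_nonneg member_le_sum)
qed auto

lemma is_form_fst: "is_form 1 (\<lambda>x _. x)" and is_form_snd: "is_form 1 (\<lambda>_ y. y)"
  unfolding is_form_def by (auto intro!: exI[of _ 1])

lemma is_form_add:
  assumes "is_form e \<alpha>" "is_form e \<beta>"
  shows "is_form e (\<lambda>x y. \<alpha> x y + \<beta> x y)"
proof -
  obtain C where C: "C \<ge> 0" "\<And>x y i. i < n \<Longrightarrow> norm (s i (\<alpha> x y)) \<le> C * max (norm (s i x)) (norm (s i y)) ^ e"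
    using is_formE[OF assms(1)] by metis
  obtain C' where C': "C' \<ge> 0" "\<And>x y i. i < n \<Longrightarrow> norm (s i (\<beta> x y)) \<le> C' * max (norm (s i x)) (norm (s i y)) ^ e"
    using is_formE[OF assms(2)] by metis
  have "norm (s i (\<alpha> x y + \<beta> x y)) \<le> (C + C') * max (norm (s i x)) (norm (s i y)) ^ e" if "i < n" for x y i
    using norm_triangle_ineq[of "s i (\<alpha> x y)" "s i (\<beta> x y)"] C(2)[OF that, of x y] C'(2)[OF that, of x y]
    by (simp only: s_simps(1)[OF that] distrib_right)
  moreover have "C + C' \<ge> 0" using C(1) C'(1) by simp
  ultimately show ?thesis
    using is_form_A[OF assms(1)] is_form_A[OF assms(2)] add_A unfolding is_form_def by blast
qed

lemma is_form_mult:
  assumes "is_form e \<alpha>" "is_form e' \<beta>"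
  shows "is_form (e + e') (\<lambda>x y. \<alpha> x y * \<beta> x y)"
proof -
  obtain C where C: "C \<ge> 0" "\<And>x y i. i < n \<Longrightarrow> norm (s i (\<alpha> x y)) \<le> C * max (norm (s i x)) (norm (s i y)) ^ e"
    using is_formE[OF assms(1)] by metis
  obtain C' where C': "C' \<ge> 0" "\<And>x y i. i < n \<Longrightarrow> norm (s i (\<beta> x y)) \<le> C' * max (norm (s i x)) (norm (s i y)) ^ e'"
    using is_formE[OF assms(2)] by metis
  have "norm (s i (\<alpha> x y * \<beta> x y)) \<le> (C * C') * max (norm (s i x)) (norm (s i y)) ^ (e + e')" if "i < n" for x y i
  proof -
    have "norm (s i (\<alpha> x y)) * norm (s i (\<beta> x y)) \<le>
      (C * max (norm (s i x)) (norm (s i y)) ^ e) * (C' * max (norm (s i x)) (norm (s i y)) ^ e')"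
      using C(1) by (intro mult_mono C(2) C'(2) that) (auto simp: le_max_iff_disj)
    then show ?thesis by (simp add: s_simps[OF that] norm_mult power_add mult_ac)
  qed
  moreover have "C * C' \<ge> 0" using C(1) C'(1) by simp
  ultimately show ?thesis
    using is_form_A[OF assms(1)] is_form_A[OF assms(2)] mult_A unfolding is_form_def by blast
qed

lemma is_form_power: "is_form e \<alpha> \<Longrightarrow> is_form (e * k) (\<lambda>x y. \<alpha> x y ^ k)"
  by (induction k) (auto simp: is_form_const dest: is_form_mult)

lemma is_form_sum:
  assumes "finite F" "F \<noteq> {}" "\<And>j. j \<in> F \<Longrightarrow> is_form e (\<alpha> j)"
  shows "is_form e (\<lambda>x y. \<Sum>j\<in>F. \<alpha> j x y)"
  using assms by (induction F rule: finite_ne_induct) (auto intro: is_form_add)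

lemma is_form_smult: "c \<in> A \<Longrightarrow> is_form e \<alpha> \<Longrightarrow> is_form e (\<lambda>x y. c * \<alpha> x y)"
  using is_form_mult[OF is_form_const, of c e \<alpha>] by simp

lemma is_form_monomial: "c \<in> A \<Longrightarrow> is_form (i + j) (\<lambda>x y. c * x ^ i * y ^ j)"
  using is_form_mult[OF is_form_smult[OF _ is_form_power[OF is_form_fst]] is_form_power[OF is_form_snd], of c i j]
  by simp

lemma is_form_hform:
  assumes "\<And>i. coeff p i \<in> A"
  shows "is_form k (hform k p)"
proof -
  have "is_form k (\<lambda>x y. \<Sum>i\<le>k. coeff p i * x ^ i * y ^ (k - i))"
  proof (intro is_form_sum)
    fix i assume "i \<in> {..k}"
    then show "is_form k (\<lambda>x y. coeff p i * x ^ i * y ^ (k - i))"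
      using is_form_monomial[OF assms[of i], of i "k - i"] by simp
  qed auto
  then show ?thesis by (simp add: hform_def[abs_def])
qed

lemma poly_common_denom:
  obtains k :: nat where "k > 0" "\<And>i. coeff (Polynomial.smult (of_nat k) p) i \<in> A" "\<And>i. coeff (Polynomial.smult (of_nat k) q) i \<in> A"
proof -
  obtain k :: nat where k: "k > 0" "\<forall>x\<in>coeff p ` {..degree p} \<union> coeff q ` {..degree q}. of_nat k * x \<in> A"
    using common_denom[of "coeff p ` {..degree p} \<union> coeff q ` {..degree q}"] by auto
  have "of_nat k * coeff p i \<in> A" for i
    using k(2) by (cases "i \<le> degree p") (auto simp: coeff_eq_0)
  moreover have "of_nat k * coeff q i \<in> A" for i
    using k(2) by (cases "i \<le> degree q") (auto simp: coeff_eq_0)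
  ultimately show thesis using that k(1) by simp
qed

text \<open>The affine Bezout identity, cleared of denominators and homogenized. Affine polynomials
  do not see the point at infinity, so the result is a power of \<open>y\<close>.\<close>

lemma resultant_y:
  assumes "coprime f g" "degree f \<le> d" "degree g \<le> d"
  obtains \<rho> :: nat and e \<alpha> \<beta> where "\<rho> > 0" "is_form e \<alpha>" "is_form e \<beta>"
    "\<And>x y. \<alpha> x y * hform d f x y + \<beta> x y * hform d g x y = of_nat \<rho> * y ^ (e + d)"
proof -
  obtain u w where uw: "u * f + w * g = 1" using poly_bezout[OF assms(1)] by blast
  obtain k :: nat where k: "k > 0" "\<And>i. coeff (Polynomial.smult (of_nat k) u) i \<in> A"
    "\<And>i. coeff (Polynomial.smult (of_nat k) w) i \<in> A" using poly_common_denom[of u w] by blast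
  define u' where "u' = Polynomial.smult (of_nat k) u"
  define w' where "w' = Polynomial.smult (of_nat k) w"
  define e where "e = max (degree u') (degree w')"
  have "u' * f + w' * g = Polynomial.smult (of_nat k) (u * f + w * g)"
    by (simp add: u'_def w'_def smult_add_right)
  then have uw': "u' * f + w' * g = [:of_nat k:]" using uw by simp
  have const: "hform K [:c:] x y = c * y ^ K" for K :: nat and c x y :: 'k
    unfolding hform_def by (subst sum.atMost_shift) simp
  have "hform e u' x y * hform d f x y + hform e w' x y * hform d g x y = of_nat k * y ^ (e + d)" for x y
  proof -
    have "hform e u' x y * hform d f x y + hform e w' x y * hform d g x y = hform (e + d) (u' * f + w' * g) x y"
      using assms by (simp add: hform_add hform_mult e_def)
    then show ?thesis by (simp add: uw' const)
  qed
  moreover have "is_form e (hform e u')" "is_form e (hform e w')"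
    using k unfolding u'_def w'_def by (blast intro: is_form_hform)+
  ultimately show thesis using that k(1) by blast
qed

text \<open>If \<open>f\<close> has degree \<open>d\<close>, write \<open>F = c X^d + Y Q\<close> and raise \<open>c X^d = F - Y Q\<close> to a power
  to pass from a power of \<open>Y\<close> to a power of \<open>X\<close> in the ideal \<open>(F, G)\<close>.\<close>
lemma resultant_xy_aux:
  assumes f: "\<And>i. coeff f i \<in> A" and g: "\<And>i. coeff g i \<in> A"
    and cop: "coprime f g" and d: "degree f = d" "degree g \<le> d" "d \<ge> 1"
  obtains \<rho> :: nat and e \<alpha> \<beta> \<alpha>' \<beta>' where "\<rho> > 0" "is_form e \<alpha>" "is_form e \<beta>" "is_form e \<alpha>'" "is_form e \<beta>'"
    "\<And>x y. \<alpha> x y * hform d f x y + \<beta> x y * hform d g x y = of_nat \<rho> * x ^ (e + d)"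
    "\<And>x y. \<alpha>' x y * hform d f x y + \<beta>' x y * hform d g x y = of_nat \<rho> * y ^ (e + d)"
proof -
  have df: "degree f \<le> d" using d(1) by simp
  obtain r :: nat and e u w where r: "r > 0" "is_form e u" "is_form e w"
    "\<And>x y. u x y * hform d f x y + w x y * hform d g x y = of_nat r * y ^ (e + d)"
    by (rule resultant_y[OF cop df d(2)]) (rule that)
  define K where "K = e + d"
  define c where "c = coeff f d"
  have cA: "c \<in> A" and c0: "c \<noteq> 0" using f d(1,3) by (auto simp: c_def)
  obtain t where t: "t \<in> A" "c * t = of_int (NZ c)" using norm_cofactor[OF cA] by blast
  define z where "z = NZ c"
  have z0: "z \<noteq> 0" using NZ_eq_0[OF cA] c0 by (simp add: z_def)
  define Q where "Q = (\<lambda>x y. \<Sum>i\<le>d - 1. coeff f i * x ^ i * y ^ (d - 1 - i))"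
  have Q: "is_form (d - 1) Q" unfolding Q_def
  proof (intro is_form_sum)
    fix i assume "i \<in> {..d - 1}"
    then have "i + (d - 1 - i) = d - 1" by auto
    then show "is_form (d - 1) (\<lambda>x y. coeff f i * x ^ i * y ^ (d - 1 - i))"
      using is_form_monomial[OF f[of i], of i "d - 1 - i"] by metis
  qed auto
  have FQ: "hform d f x y = c * x ^ d + y * Q x y" for x y
  proof -
    have "{..d} = insert d {..d - 1}" using d(3) by auto
    then have "hform d f x y = c * x ^ d + (\<Sum>i\<le>d - 1. coeff f i * x ^ i * y ^ (d - i))"
      using d(3) by (simp add: hform_def c_def)
    also have "(\<Sum>i\<le>d - 1. coeff f i * x ^ i * y ^ (d - i)) = y * Q x y"
      unfolding Q_def sum_distrib_left
    proof (intro sum.cong refl)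
      fix i assume "i \<in> {..d - 1}"
      then have "d - i = Suc (d - 1 - i)" using d(3) by auto
      then show "coeff f i * x ^ i * y ^ (d - i) = y * (coeff f i * x ^ i * y ^ (d - 1 - i))" by simp
    qed
    finally show ?thesis .
  qed
  \<comment> \<open>The cofactor of \<open>c * x ^ d + y * Q x y\<close> in the difference of the
    \<open>K\<close>-th powers of \<open>c * x ^ d\<close> and \<open>- (y * Q x y)\<close>. The
    exponent \<open>K = e + d\<close> is the one for which \<open>resultant_y\<close> puts
    \<open>of_nat r * y ^ K\<close> into the ideal.\<close>
  define S where "S = (\<lambda>x y. \<Sum>j<K. (c * x ^ d) ^ j * (- (y * Q x y)) ^ (K - 1 - j))"
  have K: "K \<ge> 1" using d(3) by (simp add: K_def)
  have yQ: "is_form d (\<lambda>x y. y * Q x y)"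
    using is_form_mult[OF is_form_snd Q] d(3) by simp
  have myQ: "is_form d (\<lambda>x y. - (y * Q x y))"
    using is_form_smult[OF of_int_A[of "-1"] yQ] by simp
  have cxd: "is_form d (\<lambda>x y. c * x ^ d)"
    using is_form_monomial[OF cA, of d 0] by simp
  have S: "is_form (d * (K - 1)) S"
    unfolding S_def
  proof (intro is_form_sum)
    fix j assume "j \<in> {..<K}"
    then have "d * j + d * (K - 1 - j) = d * (K - 1)" by (auto simp: add_mult_distrib2[symmetric])
    then show "is_form (d * (K - 1)) (\<lambda>x y. (c * x ^ d) ^ j * (- (y * Q x y)) ^ (K - 1 - j))"
      using is_form_mult[OF is_form_power[OF cxd, of j] is_form_power[OF myQ, of "K - 1 - j"]] by simp
  qed (use K in \<open>auto simp: lessThan_empty_iff\<close>)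
  have id: "(c * x ^ d) ^ K = hform d f x y * S x y + (- 1) ^ K * y ^ K * Q x y ^ K" for x y
  proof -
    have "(c * x ^ d) ^ K - (- (y * Q x y)) ^ K = (c * x ^ d - (- (y * Q x y))) * S x y"
      unfolding S_def
      by (subst power_diff_sumr2) (simp add: mult.commute[of "(c * x ^ d) ^ _"])
    moreover have "(- (y * Q x y)) ^ K = (- 1) ^ K * y ^ K * Q x y ^ K"
      by (subst minus_mult_left, subst power_mult_distrib, subst power_minus) simp
    ultimately show ?thesis by (simp add: FQ algebra_simps)
  qed
  define E where "E = d * (K - 1)"
  have EK: "E + d = d * K" using K by (simp add: E_def algebra_simps flip: mult_Suc_right)
  have Ee: "(d - 1) * K + e = E" using EK d(3) by (simp add: K_def algebra_simps) (simp add: mult_eq_if split: if_splits)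
  \<comment> \<open>\<open>b * c ^ K\<close> has to be a positive integer: \<open>t ^ K\<close>
    turns \<open>c ^ K\<close> into \<open>z ^ K\<close>, and the second factor \<open>z ^ K\<close>
    makes the exponent even.\<close>
  define b where "b = of_int z ^ K * t ^ K"
  have bA: "b \<in> A" using t(1) by (auto simp: b_def intro!: mult_A power_A)
  define \<rho> where "\<rho> = r * nat \<bar>z\<bar> ^ (2 * K)"
  have bc: "b * c ^ K = of_nat (nat \<bar>z\<bar> ^ (2 * K))"
  proof -
    have "b * c ^ K = of_int z ^ K * (c * t) ^ K" by (simp add: b_def power_mult_distrib mult_ac)
    also have "\<dots> = of_int (z ^ (2 * K))" unfolding t(2) z_def[symmetric] by (simp add: power_mult power2_eq_square power_mult_distrib)
    also have "z ^ (2 * K) = int (nat \<bar>z\<bar> ^ (2 * K))" by (simp add: power_even_abs)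
    finally show ?thesis by simp
  qed
  define \<alpha> where "\<alpha> = (\<lambda>x y. b * (of_nat r * S x y + (of_int ((- 1) ^ K) * (Q x y ^ K * u x y))))"
  define \<beta> where "\<beta> = (\<lambda>x y. b * (of_int ((- 1) ^ K) * (Q x y ^ K * w x y)))"
  have Qu: "is_form E (\<lambda>x y. Q x y ^ K * u x y)" "is_form E (\<lambda>x y. Q x y ^ K * w x y)"
    using is_form_mult[OF is_form_power[OF Q, of K] r(2)] is_form_mult[OF is_form_power[OF Q, of K] r(3)] Ee by simp_all
  have \<alpha>: "is_form E \<alpha>" unfolding \<alpha>_def
    using S Qu bA unfolding E_def by (intro is_form_smult is_form_add of_int_A of_nat_A)
  have \<beta>: "is_form E \<beta>" unfolding \<beta>_def using Qu bA by (intro is_form_smult of_int_A)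
  have 1: "\<alpha> x y * hform d f x y + \<beta> x y * hform d g x y = of_nat \<rho> * x ^ (E + d)" for x y
  proof -
    have "\<alpha> x y * hform d f x y + \<beta> x y * hform d g x y =
      b * (of_nat r * (hform d f x y * S x y) + (- 1) ^ K * Q x y ^ K * (u x y * hform d f x y + w x y * hform d g x y))"
      by (simp add: \<alpha>_def \<beta>_def algebra_simps)
    also have "\<dots> = b * of_nat r * (hform d f x y * S x y + (- 1) ^ K * y ^ K * Q x y ^ K)"
      unfolding r(4) K_def[symmetric] by (simp add: algebra_simps)
    also have "\<dots> = of_nat r * (b * c ^ K) * x ^ (d * K)"
      unfolding id[symmetric] power_mult_distrib power_mult by (simp add: mult_ac)
    finally show ?thesis unfolding bc EK by (simp add: \<rho>_def)
  qed
  \<comment> \<open>The identity for \<open>y\<close> is multiplied by \<open>a\<close> and by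
    \<open>y ^ (E - e)\<close>, so that both identities share the constant \<open>\<rho>\<close> and
    the degree \<open>E\<close>.\<close>
  define a where "a = (of_nat (nat \<bar>z\<bar> ^ (2 * K)) :: 'k)"
  define \<alpha>' where "\<alpha>' = (\<lambda>x y. a * (y ^ (E - e) * u x y))"
  define \<beta>' where "\<beta>' = (\<lambda>x y. a * (y ^ (E - e) * w x y))"
  have le: "e \<le> E" using Ee by simp
  have \<alpha>\<beta>': "is_form E \<alpha>'" "is_form E \<beta>'"
  proof -
    have aA: "a \<in> A" unfolding a_def by (rule of_nat_A)
    have Ee': "1 * (E - e) + e = E" using le by simp
    show "is_form E \<alpha>'" unfolding \<alpha>'_def
      using is_form_smult[OF aA is_form_mult[OF is_form_power[OF is_form_snd, of "E - e"] r(2)]] unfolding Ee' .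
    show "is_form E \<beta>'" unfolding \<beta>'_def
      using is_form_smult[OF aA is_form_mult[OF is_form_power[OF is_form_snd, of "E - e"] r(3)]] unfolding Ee' .
  qed
  have 2: "\<alpha>' x y * hform d f x y + \<beta>' x y * hform d g x y = of_nat \<rho> * y ^ (E + d)" for x y
  proof -
    have "\<alpha>' x y * hform d f x y + \<beta>' x y * hform d g x y =
        a * y ^ (E - e) * (u x y * hform d f x y + w x y * hform d g x y)"
      by (simp add: \<alpha>'_def \<beta>'_def algebra_simps)
    also have "\<dots> = of_nat r * a * (y ^ (E - e) * y ^ (e + d))"
      unfolding r(4) by simp
    also have "y ^ (E - e) * y ^ (e + d) = y ^ (E + d)" using le by (simp flip: power_add)
    finally show ?thesis by (simp add: \<rho>_def a_def)
  qed
  have "\<rho> > 0" using r(1) z0 by (simp add: \<rho>_def)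
  from that[OF this \<alpha> \<beta> \<alpha>\<beta>' 1 2] show thesis .
qed

lemma resultant_xy:
  assumes f: "\<And>i. coeff f i \<in> A" and g: "\<And>i. coeff g i \<in> A"
    and cop: "coprime f g" and d: "max (degree f) (degree g) = d" "d \<ge> 1"
  obtains \<rho> :: nat and e \<alpha> \<beta> \<alpha>' \<beta>' where "\<rho> > 0" "is_form e \<alpha>" "is_form e \<beta>" "is_form e \<alpha>'" "is_form e \<beta>'"
    "\<And>x y. \<alpha> x y * hform d f x y + \<beta> x y * hform d g x y = of_nat \<rho> * x ^ (e + d)"
    "\<And>x y. \<alpha>' x y * hform d f x y + \<beta>' x y * hform d g x y = of_nat \<rho> * y ^ (e + d)"
proof (cases "degree f = d")
  case True
  have "degree g \<le> d" using d(1) by auto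
  from resultant_xy_aux[OF f g cop True this d(2) that] show thesis .
next
  case False
  then have dg: "degree g = d" and df: "degree f \<le> d" using d(1) by auto
  have cop': "coprime g f" using cop by (simp add: coprime_commute)
  obtain \<rho> :: nat and e \<alpha> \<beta> \<alpha>' \<beta>' where *: "\<rho> > 0" "is_form e \<alpha>" "is_form e \<beta>" "is_form e \<alpha>'" "is_form e \<beta>'"
    "\<And>x y. \<alpha> x y * hform d g x y + \<beta> x y * hform d f x y = of_nat \<rho> * x ^ (e + d)"
    "\<And>x y. \<alpha>' x y * hform d g x y + \<beta>' x y * hform d f x y = of_nat \<rho> * y ^ (e + d)"
    by (rule resultant_xy_aux[OF g f cop' dg df d(2)]) (rule that)
  have "\<beta> x y * hform d f x y + \<alpha> x y * hform d g x y = of_nat \<rho> * x ^ (e + d)"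
    "\<beta>' x y * hform d f x y + \<alpha>' x y * hform d g x y = of_nat \<rho> * y ^ (e + d)" for x y
    using *(6,7)[of x y] by (simp_all add: add.commute[of "\<beta> x y * _"] add.commute[of "\<beta>' x y * _"])
  from that[OF *(1,3,2,5,4) this] show thesis .
qed

end

section \<open>Heights\<close>

lemma finite_pos_lower_bound:
  fixes f :: "'a \<Rightarrow> real"
  assumes "finite S" "\<And>x. x \<in> S \<Longrightarrow> f x > 0"
  obtains \<delta> where "\<delta> > 0" "\<And>x. x \<in> S \<Longrightarrow> \<delta> \<le> f x"
proof -
  have "Min (insert 1 (f ` S)) > 0" using assms by (subst Min_gr_iff) auto
  moreover have "Min (insert 1 (f ` S)) \<le> f x" if "x \<in> S" for x
    using assms(1) that by (intro Min_le) auto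
  ultimately show thesis using that by blast
qed

section \<open>Divisibility by a rational prime\<close>

context nf_order
begin

text \<open>Let \<open>E\<close> be the exponent of \<open>p\<close> in the norm of
  \<open>\<alpha>\<close>. The cofactor \<open>u\<close> has norm
  \<open>NZ \<alpha> ^ (n - 1)\<close>; if \<open>p ^ t\<close> is the largest power of
  \<open>p\<close> dividing it in \<open>A\<close>, comparing norms gives
  \<open>t * n \<le> (n - 1) * E\<close>. After division by \<open>p ^ t\<close> at least
  \<open>E / n > c\<close> powers of \<open>p\<close> are left in the product with
  \<open>\<alpha>\<close>.\<close>

lemma prime_divides_norm_cofactor:
  fixes p :: nat
  assumes p: "prime p" and \<alpha>: "\<alpha> \<in> A" "\<alpha> \<noteq> 0" and big: "n * c < multiplicity p (nat \<bar>NZ \<alpha>\<bar>)"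
  obtains u v where "u \<in> A" "u / of_nat p \<notin> A" "v \<in> A" "\<alpha> * u = of_nat p ^ Suc c * v"
proof -
  define E where "E = multiplicity p (nat \<bar>NZ \<alpha>\<bar>)"
  have N0: "NZ \<alpha> \<noteq> 0" using NZ_eq_0 \<alpha> by blast
  have pp: "prime_elem p" "p > 0" using p by (auto simp: prime_gt_0_nat)
  have pK: "(of_nat p :: 'k) \<noteq> 0" using pp by simp
  obtain u where u: "u \<in> A" "\<alpha> * u = of_int (NZ \<alpha>)" using norm_cofactor[OF \<alpha>(1)] by blast
  have u0: "u \<noteq> 0" using u(2) N0 by auto
  have "NZ \<alpha> * NZ u = NZ \<alpha> ^ n"
    using NZ_mult[OF \<alpha>(1) u(1)] NZ_of_int[of "NZ \<alpha>"] u(2) by simp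
  also have "\<dots> = NZ \<alpha> * NZ \<alpha> ^ (n - 1)" using n_pos by (cases n) auto
  finally have Nu: "NZ u = NZ \<alpha> ^ (n - 1)" using N0 by simp
  have bound: "t * n \<le> (n - 1) * E" if t: "u / of_nat p ^ t \<in> A" for t
  proof -
    define w where "w = u / of_nat p ^ t"
    have w: "w \<in> A" "u = of_nat p ^ t * w" using t pK by (auto simp: w_def)
    have "NZ u = (int p ^ n) ^ t * NZ w"
      using NZ_mult[OF power_A[OF of_nat_A] w(1), of p t] NZ_power[OF of_nat_A, of p t] NZ_of_int[of "int p"] w(2)
      by simp
    then have "int p ^ (t * n) dvd NZ \<alpha> ^ (n - 1)"
      unfolding Nu by (simp add: power_mult[symmetric] mult.commute)
    then have "int (p ^ (t * n)) dvd int (nat \<bar>NZ \<alpha>\<bar> ^ (n - 1))"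
      by (simp flip: power_abs)
    then have "p ^ (t * n) dvd nat \<bar>NZ \<alpha>\<bar> ^ (n - 1)" by (simp only: int_dvd_int_iff)
    then have "t * n \<le> multiplicity p (nat \<bar>NZ \<alpha>\<bar> ^ (n - 1))"
      using pp N0 p by (intro multiplicity_geI) (auto simp: not_prime_1)
    also have "\<dots> = (n - 1) * E"
      using pp N0 by (simp add: prime_elem_multiplicity_power_distrib E_def)
    finally show ?thesis .
  qed
  define t where "t = (GREATEST t. u / of_nat p ^ t \<in> A)"
  have t0: "u / of_nat p ^ 0 \<in> A" using u by simp
  have bd: "t \<le> (n - 1) * E" if "u / of_nat p ^ t \<in> A" for t
  proof -
    have "t * 1 \<le> t * n" using n_pos by (intro mult_le_mono2) auto
    then show ?thesis using bound[OF that] by linarith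
  qed
  have tA: "u / of_nat p ^ t \<in> A"
    unfolding t_def by (rule GreatestI_nat[of "\<lambda>t. u / of_nat p ^ t \<in> A", OF t0]) (use bd in blast)
  have "u / of_nat p ^ Suc t \<notin> A"
  proof
    assume "u / of_nat p ^ Suc t \<in> A"
    then have "Suc t \<le> t"
      unfolding t_def by (rule Greatest_le_nat[of "\<lambda>t. u / of_nat p ^ t \<in> A"]) (use bd in blast)
    then show False by simp
  qed
  then have notp: "u / of_nat p ^ t / of_nat p \<notin> A" by (simp add: mult.commute)
  have "t + Suc c \<le> E"
  proof (rule ccontr)
    assume "\<not> t + Suc c \<le> E"
    then have "E \<le> t + c" by simp
    then have "n * E \<le> n * t + n * c" by (metis add_mult_distrib2 mult_le_mono2)
    also have "\<dots> < (n - 1) * E + E" using bound[OF tA] big by (simp add: E_def mult.commute)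
    also have "\<dots> = n * E" using n_pos by (cases n) auto
    finally show False by simp
  qed
  then have "p ^ (t + Suc c) dvd nat \<bar>NZ \<alpha>\<bar>" unfolding E_def by (rule multiplicity_dvd')
  then have "int p ^ (t + Suc c) dvd NZ \<alpha>" by (metis dvd_abs_iff int_dvd_int_iff int_nat_eq of_nat_power abs_ge_zero)
  then obtain z where z: "NZ \<alpha> = int p ^ (t + Suc c) * z" by (elim dvdE)
  have "\<alpha> * (u / of_nat p ^ t) = of_int (NZ \<alpha>) / of_nat p ^ t" using u(2) by simp
  also have "\<dots> = of_nat p ^ Suc c * of_int z" unfolding z using pK by (simp add: power_add)
  finally have "\<alpha> * (u / of_nat p ^ t) = of_nat p ^ Suc c * of_int z" .
  from that[OF tA notp of_int_A this] show thesis .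
qed

text \<open>A nontrivial integral relation of least total size cannot have all coefficients
  divisible by \<open>p\<close>, as dividing them by \<open>p\<close> would shrink it.\<close>

lemma primitive_dependency:
  fixes p :: nat and u :: "nat \<Rightarrow> 'k"
  assumes p: "prime p"
  obtains c :: "nat \<Rightarrow> int" and k where "k \<le> n" "\<not> int p dvd c k" "(\<Sum>j\<le>n. of_int (c j) * u j) = 0"
proof -
  define good where "good c \<longleftrightarrow> (\<exists>j\<le>n. c j \<noteq> 0) \<and> (\<Sum>j\<le>n. of_int (c j) * u j) = 0" for c :: "nat \<Rightarrow> int"
  have "\<exists>c. good c" using dep[of u] unfolding good_def by blast
  then obtain c where c: "good c" and min: "\<And>b. good b \<Longrightarrow> (\<Sum>j\<le>n. nat \<bar>c j\<bar>) \<le> (\<Sum>j\<le>n. nat \<bar>b j\<bar>)"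
    using ex_has_least_nat[of good _ "\<lambda>c. \<Sum>j\<le>n. nat \<bar>c j\<bar>"] by blast
  have "\<exists>k\<le>n. \<not> int p dvd c k"
  proof (rule ccontr)
    assume "\<not> ?thesis"
    then have "\<forall>k\<in>{..n}. \<exists>b. c k = int p * b" by (auto elim: dvdE)
    from bchoice[OF this] obtain b where b: "\<And>k. k \<le> n \<Longrightarrow> c k = int p * b k" by auto
    have p2: "p \<ge> 2" using p by (rule prime_ge_2_nat)
    have "(\<Sum>j\<le>n. of_int (c j) * u j) = of_nat p * (\<Sum>j\<le>n. of_int (b j) * u j)"
      unfolding sum_distrib_left by (intro sum.cong) (auto simp: b)
    then have "good b" using c b p2 by (auto simp: good_def)
    have "(\<Sum>j\<le>n. nat \<bar>c j\<bar>) = p * (\<Sum>j\<le>n. nat \<bar>b j\<bar>)"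
      unfolding sum_distrib_left by (intro sum.cong) (auto simp: b abs_mult nat_mult_distrib)
    moreover obtain j where "j \<le> n" "b j \<noteq> 0" using \<open>good b\<close> unfolding good_def by blast
    then have "(\<Sum>j\<le>n. nat \<bar>b j\<bar>) > 0" by (intro sum_pos2[of _ j]) auto
    moreover have "2 * (\<Sum>j\<le>n. nat \<bar>b j\<bar>) \<le> p * (\<Sum>j\<le>n. nat \<bar>b j\<bar>)" using p2 by (rule mult_le_mono1)
    ultimately show False using min[OF \<open>good b\<close>] by linarith
  qed
  with c that show thesis unfolding good_def by blast
qed

text \<open>A replacement for the places of \<open>K\<close> above \<open>p\<close>, of which there are at most \<open>n\<close>: pairwise
  almost comaximal elements cannot be highly divisible by \<open>p\<close> more than \<open>n\<close> times.\<close>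
lemma not_all_highly_divisible:
  fixes p \<Delta> :: nat
  assumes p: "prime p" and \<Delta>: "\<Delta> > 0"
    and \<alpha>: "\<And>j. j \<le> n \<Longrightarrow> \<alpha> j \<in> A" "\<And>j. j \<le> n \<Longrightarrow> \<alpha> j \<noteq> 0"
    and comax: "\<And>j k. j \<le> n \<Longrightarrow> k \<le> n \<Longrightarrow> j \<noteq> k \<Longrightarrow> \<exists>a\<in>A. \<exists>b\<in>A. a * \<alpha> j + b * \<alpha> k = of_nat \<Delta>"
  shows "\<exists>j\<le>n. multiplicity p (nat \<bar>NZ (\<alpha> j)\<bar>) \<le> n * (n * multiplicity p \<Delta>)"
proof (rule ccontr)
  assume nall: "\<not> ?thesis"
  \<comment> \<open>The exact exponent of \<open>p\<close> in \<open>\<Delta> ^ n\<close>; the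
    negated claim provides one power of \<open>p\<close> more.\<close>
  define c where "c = n * multiplicity p \<Delta>"
  have big: "n * c < multiplicity p (nat \<bar>NZ (\<alpha> j)\<bar>)" if "j \<le> n" for j
    using nall that unfolding c_def by (metis not_le)
  have pK: "(of_nat p :: 'k) \<noteq> 0" using p by (auto simp: prime_gt_0_nat)
  have "\<forall>j\<in>{..n}. \<exists>u v. u \<in> A \<and> u / of_nat p \<notin> A \<and> v \<in> A \<and> \<alpha> j * u = of_nat p ^ Suc c * v"
  proof
    fix j assume "j \<in> {..n}"
    then have j: "j \<le> n" by simp
    show "\<exists>u v. u \<in> A \<and> u / of_nat p \<notin> A \<and> v \<in> A \<and> \<alpha> j * u = of_nat p ^ Suc c * v"
      by (rule prime_divides_norm_cofactor[OF p \<alpha>[OF j] big[OF j]]) blast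
  qed
  from bchoice[OF this] obtain u where "\<forall>j\<in>{..n}. \<exists>v. u j \<in> A \<and> u j / of_nat p \<notin> A \<and> v \<in> A \<and> \<alpha> j * u j = of_nat p ^ Suc c * v"
    by blast
  from bchoice[OF this] obtain v where
    uv: "\<And>j. j \<le> n \<Longrightarrow> u j \<in> A" "\<And>j. j \<le> n \<Longrightarrow> u j / of_nat p \<notin> A" "\<And>j. j \<le> n \<Longrightarrow> v j \<in> A"
      "\<And>j. j \<le> n \<Longrightarrow> \<alpha> j * u j = of_nat p ^ Suc c * v j" by auto
  obtain b :: "nat \<Rightarrow> int" and k where k: "k \<le> n" "\<not> int p dvd b k" "(\<Sum>j\<le>n. of_int (b j) * u j) = 0"
    using primitive_dependency[OF p] by blast
  define I where "I = {of_nat p ^ Suc c * w | w. w \<in> A}"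
  have I_add: "x + y \<in> I" if xy: "x \<in> I" "y \<in> I" for x y
  proof -
    obtain w z where "w \<in> A" "z \<in> A" "x = of_nat p ^ Suc c * w" "y = of_nat p ^ Suc c * z"
      using xy by (auto simp: I_def)
    then have "x + y = of_nat p ^ Suc c * (w + z)" "w + z \<in> A" by (auto simp: distrib_left add_A)
    then show ?thesis by (auto simp: I_def)
  qed
  have I_mult: "a * x \<in> I" if ax: "a \<in> A" "x \<in> I" for a x
  proof -
    obtain w where "w \<in> A" "x = of_nat p ^ Suc c * w" using ax by (auto simp: I_def)
    then have "a * x = of_nat p ^ Suc c * (a * w)" "a * w \<in> A" using ax by (auto simp: mult_A)
    then show ?thesis by (auto simp: I_def)
  qed
  have I_sum: "sum h F \<in> I" if "\<And>j. j \<in> F \<Longrightarrow> h j \<in> I" for h :: "nat \<Rightarrow> 'k" and F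
  proof -
    have "0 \<in> I" by (auto simp: I_def intro: exI[of _ 0])
    then show ?thesis using that by (induction F rule: infinite_finite_induct) (auto intro: I_add)
  qed
  \<comment> \<open>Multiplying the relations between \<open>\<alpha> k\<close> and each other
    element shows that \<open>\<alpha> k\<close> and the product of the \<open>n\<close> others are
    almost comaximal, at the cost of replacing \<open>\<Delta>\<close> by
    \<open>\<Delta> ^ n\<close>.\<close>
  have comax_prod: "\<exists>a\<in>A. \<exists>b\<in>A. of_nat \<Delta> ^ card F = a * \<alpha> k + b * (\<Prod>j\<in>F. \<alpha> j)"
    if "finite F" "F \<subseteq> {..n} - {k}" for F
    using that
  proof (induction F rule: finite_induct)
    case empty
    then show ?case by (intro bexI[of _ 0] bexI[of _ 1]) auto
  next
    case (insert j F)
    then obtain a b where ab: "a \<in> A" "b \<in> A" "of_nat \<Delta> ^ card F = a * \<alpha> k + b * (\<Prod>j\<in>F. \<alpha> j)" by blast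
    obtain a' b' where ab': "a' \<in> A" "b' \<in> A" "a' * \<alpha> k + b' * \<alpha> j = of_nat \<Delta>"
      using comax[of k j] insert.prems k(1) by auto
    have "of_nat \<Delta> ^ card (insert j F) = (a' * \<alpha> k + b' * \<alpha> j) * (a * \<alpha> k + b * (\<Prod>j\<in>F. \<alpha> j))"
      using insert.hyps by (simp add: ab'(3) flip: ab(3))
    also have "\<dots> = (a' * (a * \<alpha> k + b * (\<Prod>j\<in>F. \<alpha> j)) + b' * \<alpha> j * a) * \<alpha> k + (b' * b) * (\<Prod>j\<in>insert j F. \<alpha> j)"
      using insert.hyps by (simp add: algebra_simps)
    finally have e: "of_nat \<Delta> ^ card (insert j F) = \<dots>" .
    have "a' * (a * \<alpha> k + b * (\<Prod>j\<in>F. \<alpha> j)) + b' * \<alpha> j * a \<in> A"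
      using ab ab' \<alpha>(1) insert.prems k(1) by (intro add_A mult_A prod_A) auto
    moreover have "b' * b \<in> A" using ab ab' by (intro mult_A)
    ultimately show ?case using e by blast
  qed
  define G where "G = {..n} - {k}"
  have cardG: "card G = n" using k(1) by (simp add: G_def)
  obtain a b' where ab: "a \<in> A" "b' \<in> A" "of_nat \<Delta> ^ n = a * \<alpha> k + b' * (\<Prod>j\<in>G. \<alpha> j)"
    using comax_prod[of G] cardG by (auto simp: G_def)
  have "(\<Sum>j\<le>n. of_int (b j) * u j) = of_int (b k) * u k + (\<Sum>j\<in>G. of_int (b j) * u j)"
    using k(1) by (subst sum.remove[of _ k]) (auto simp: G_def)
  then have bk: "of_int (b k) * u k = - (\<Sum>j\<in>G. of_int (b j) * u j)" using k(3) by (simp add: add_eq_0_iff2)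
  \<comment> \<open>The dependence expresses \<open>of_int (b k) * u k\<close> through the other
    \<open>u j\<close>, each of which is killed modulo \<open>p ^ Suc c\<close> by its factor
    \<open>\<alpha> j\<close> of the product. Since \<open>\<alpha> k\<close> kills
    \<open>u k\<close>, so does \<open>of_int (b k) * of_nat \<Delta> ^ n\<close>. Cancelling
    \<open>p ^ c\<close> leaves a coefficient prime to \<open>p\<close>, so \<open>u k\<close> would
    be divisible by \<open>p\<close>.\<close>
  have "of_int (b k) * u k * (\<Prod>j\<in>G. \<alpha> j) = (\<Sum>j\<in>G. (- of_int (b j) * (\<Prod>l\<in>G - {j}. \<alpha> l)) * (\<alpha> j * u j))"
    unfolding bk minus_mult_left[symmetric] sum_distrib_right sum_negf[symmetric]
  proof (intro sum.cong refl)
    fix j assume "j \<in> G"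
    then have "(\<Prod>j\<in>G. \<alpha> j) = \<alpha> j * (\<Prod>l\<in>G - {j}. \<alpha> l)" by (intro prod.remove) (auto simp: G_def)
    then show "- (of_int (b j) * u j * (\<Prod>j\<in>G. \<alpha> j)) = - (of_int (b j) * (\<Prod>l\<in>G - {j}. \<alpha> l) * (\<alpha> j * u j))" by simp
  qed
  also have "\<dots> \<in> I"
  proof (rule I_sum)
    fix j assume j: "j \<in> G"
    then have jn: "j \<le> n" by (auto simp: G_def)
    have "- of_int (b j) * (\<Prod>l\<in>G - {j}. \<alpha> l) \<in> A"
      using \<alpha>(1) by (intro mult_A uminus_A prod_A of_int_A) (auto simp: G_def)
    moreover have "\<alpha> j * u j \<in> I" using uv(3,4) jn by (auto simp: I_def)
    ultimately show "- of_int (b j) * (\<Prod>l\<in>G - {j}. \<alpha> l) * (\<alpha> j * u j) \<in> I" by (rule I_mult)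
  qed
  finally have 1: "of_int (b k) * u k * (\<Prod>j\<in>G. \<alpha> j) \<in> I" .
  have 2: "\<alpha> k * u k \<in> I" using uv(3,4) k(1) by (auto simp: I_def)
  have "of_int (b k) * of_nat \<Delta> ^ n * u k = (of_int (b k) * a) * (\<alpha> k * u k) + b' * (of_int (b k) * u k * (\<Prod>j\<in>G. \<alpha> j))"
    unfolding ab(3) by (simp add: algebra_simps)
  also have "\<dots> \<in> I" by (rule I_add[OF I_mult[OF mult_A[OF of_int_A ab(1)] 2] I_mult[OF ab(2) 1]])
  finally obtain w where w: "w \<in> A" "of_int (b k) * of_nat \<Delta> ^ n * u k = of_nat p ^ Suc c * w" by (auto simp: I_def)
  have pe: "prime_elem p" using p by simp
  obtain y where y: "\<Delta> = p ^ multiplicity p \<Delta> * y" "\<not> p dvd y"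
    using multiplicity_decompose'[of \<Delta> p] \<Delta> p by (metis not_prime_unit neq0_conv)
  have Dn: "\<Delta> ^ n = p ^ c * y ^ n"
    by (subst y(1)) (simp add: power_mult_distrib c_def power_mult[symmetric] mult.commute)
  define z where "z = b k * int y ^ n"
  have D': "(of_nat \<Delta> :: 'k) ^ n = of_nat p ^ c * of_nat y ^ n"
    using arg_cong[OF Dn, of "of_nat :: nat \<Rightarrow> 'k"] by simp
  have "of_nat p ^ c * (of_int z * u k) = of_int (b k) * of_nat \<Delta> ^ n * u k"
    unfolding D' by (simp add: z_def)
  also have "\<dots> = of_nat p ^ c * (of_nat p * w)" unfolding w(2) by (simp add: mult_ac)
  finally have "of_nat p ^ c * (of_int z * u k) = of_nat p ^ c * (of_nat p * w)" .
  then have zu: "of_int z * u k = of_nat p * w" using pK by simp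
  have "\<not> int p dvd z"
  proof
    assume "int p dvd z"
    moreover have pi: "prime (int p)" using p by simp
    ultimately have "int p dvd int y ^ n" using k(2) prime_dvd_mult_iff[OF pi] by (auto simp: z_def)
    then have "int p dvd int y" using pi prime_dvd_power by blast
    with y(2) show False by simp
  qed
  then have "coprime (int p) z" using p by (simp add: prime_imp_coprime)
  moreover obtain r t where "r * int p + t * z = gcd (int p) z" using bezout_int by blast
  ultimately have rt: "r * int p + t * z = 1" by simp
  have "u k = of_int (r * int p + t * z) * u k" unfolding rt by simp
  also have "\<dots> = of_int r * of_nat p * u k + of_int t * (of_int z * u k)" by (simp add: algebra_simps)
  also have "\<dots> = of_nat p * (of_int r * u k + of_int t * w)" unfolding zu by (simp add: algebra_simps)
  finally have "u k / of_nat p = of_nat p * (of_int r * u k + of_int t * w) / of_nat p" by (rule arg_cong)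
  also have "\<dots> = of_int r * u k + of_int t * w" using pK by (rule nonzero_mult_div_cancel_left)
  finally have "u k / of_nat p = of_int r * u k + of_int t * w" .
  moreover have "of_int r * u k + of_int t * w \<in> A" using uv(1) k(1) w(1) by (intro add_A mult_A) auto
  ultimately show False using uv(2)[OF k(1)] by simp
qed

end

section \<open>The height and Northcott finiteness\<close>

context nf_coords
begin

definition mx :: "nat \<Rightarrow> 'k option \<Rightarrow> real" where "mx i P = max (norm (s i (X P))) (norm (s i (Y P)))"

text \<open>The multiplicative height relative to \<open>K\<close>, up to a bounded factor: since
  the coordinates are almost coprime, the finite places contribute boundedly and only the embeddings
  are kept.\<close>

definition H :: "'k option \<Rightarrow> real" where "H P = (\<Prod>i<n. mx i P)"

lemma X_or_Y: "X P \<noteq> 0 \<or> Y P \<noteq> 0"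
  using X_None Y_Some by (cases P) auto

lemma mx_pos: "i < n \<Longrightarrow> mx i P > 0"
  using X_or_Y[of P] by (auto simp: mx_def less_max_iff_disj s_simps)

lemma mx_ge: "norm (s i (X P)) \<le> mx i P" "norm (s i (Y P)) \<le> mx i P"
  by (auto simp: mx_def)

lemma H_ge_1: "H P \<ge> 1"
proof -
  have "Nm (X P) \<le> H P" "Nm (Y P) \<le> H P"
    unfolding Nm_alt H_def by (auto intro!: prod_mono simp: mx_ge)
  then show ?thesis using X_or_Y[of P] Nm_ge_1[OF X_A, of P] Nm_ge_1[OF Y_A, of P] by linarith
qed

lemma Nm_D_le: "Nm (D P Q) \<le> 2 ^ n * H P * H Q"
proof -
  have "norm (s i (D P Q)) \<le> 2 * mx i P * mx i Q" if i: "i < n" for i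
  proof -
    have "norm (s i (D P Q)) \<le> norm (s i (X P)) * norm (s i (Y Q)) + norm (s i (X Q)) * norm (s i (Y P))"
      unfolding D_def s_simps[OF i] by (metis norm_triangle_ineq4 norm_mult)
    also have "\<dots> \<le> mx i P * mx i Q + mx i Q * mx i P"
      using mx_pos[OF i] by (intro add_mono mult_mono mx_ge) (auto intro: less_imp_le)
    finally show ?thesis by simp
  qed
  then have "Nm (D P Q) \<le> (\<Prod>i<n. 2 * mx i P * mx i Q)"
    unfolding Nm_alt by (intro prod_mono) auto
  then show ?thesis by (simp add: prod.distrib H_def)
qed

text \<open>The norms of \<open>of_nat t * Y P - X P\<close> for \<open>t = 0, ..., n\<close> are
  integers bounded in terms of the height. These \<open>n + 1\<close> values determine the
  polynomial \<open>q\<close> of degree at most \<open>n\<close> that takes them at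
  \<open>0, ..., n\<close>, and \<open>s 0 x\<close> is one of its roots for
  \<open>P = Some x\<close>. So only finitely many points share the same values.\<close>

lemma northcott: "finite {P. H P \<le> B}"
proof -
  define v where "v P = (\<lambda>t\<in>{..n}. NZ (of_nat t * Y P - X P))" for P
  define c where "c = \<lceil>real (n + 1) ^ n * B\<rceil>"
  have tA: "of_nat t * Y P - X P \<in> A" for t P
    by (intro diff_A mult_A X_A Y_A of_nat_A)
  have "v ` {P. H P \<le> B} \<subseteq> PiE {..n} (\<lambda>_. {- c..c})"
  proof (intro image_subsetI PiE_I)
    fix P t assume P: "P \<in> {P. H P \<le> B}" and t: "t \<in> {..n}"
    have "norm (s i (of_nat t * Y P - X P)) \<le> real (n + 1) * mx i P" if i: "i < n" for i
    proof -
      have "norm (s i (of_nat t * Y P - X P)) \<le> norm (of_nat t * s i (Y P)) + norm (s i (X P))"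
        unfolding s_simps[OF i] by (rule norm_triangle_ineq4)
      also have "\<dots> \<le> real n * mx i P + mx i P"
        using t unfolding norm_mult by (intro add_mono mult_mono mx_ge) auto
      finally show ?thesis by (simp add: algebra_simps)
    qed
    then have "Nm (of_nat t * Y P - X P) \<le> (\<Prod>i<n. real (n + 1) * mx i P)"
      unfolding Nm_alt by (intro prod_mono) auto
    also have "\<dots> = real (n + 1) ^ n * H P" by (simp add: prod.distrib H_def)
    also have "\<dots> \<le> real (n + 1) ^ n * B" using P by (intro mult_left_mono) auto
    finally have "\<bar>real_of_int (NZ (of_nat t * Y P - X P))\<bar> \<le> real (n + 1) ^ n * B"
      by (simp add: Nm_NZ[OF tA])
    then have "\<bar>NZ (of_nat t * Y P - X P)\<bar> \<le> c" unfolding c_def by linarith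
    then show "v P t \<in> {- c..c}" using t by (auto simp: v_def abs_le_iff)
  qed (simp add: v_def)
  then have fin: "finite (v ` {P. H P \<le> B})" by (rule finite_subset) (simp add: finite_PiE)
  have fib: "finite {P. v P = w}" for w
  proof (cases "\<exists>x0. v (Some x0) = w")
    case False
    then have "{P. v P = w} \<subseteq> {None}" by (auto, metis option.exhaust)
    then show ?thesis by (rule finite_subset) simp
  next
    case True
    then obtain x0 where x0: "v (Some x0) = w" by blast
    define q where "q x = (\<Prod>i<n. [:- s i (X (Some x)), s i (Y (Some x)):])" for x
    have nz: "q x \<noteq> 0" for x
      unfolding q_def using Y_Some by (auto simp: s_simps)
    have deg: "degree (q x) \<le> n" for x
    proof -
      have "degree (q x) \<le> (\<Sum>i<n. degree [:- s i (X (Some x)), s i (Y (Some x)):])"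
        unfolding q_def using degree_prod_sum_le[of "{..<n}" "\<lambda>i. [:- s i (X (Some x)), s i (Y (Some x)):]"]
        by (simp add: o_def)
      also have "\<dots> \<le> (\<Sum>i<n. 1)" by (intro sum_mono) simp
      finally show ?thesis by simp
    qed
    have val: "poly (q x) (of_nat t) = of_int (NZ (of_nat t * Y (Some x) - X (Some x)))" for x t
      unfolding NZ[OF tA] NC_def q_def poly_prod by (intro prod.cong) (auto simp: s_simps)
    have eq: "q x = q x0" if "v (Some x) = w" for x
    proof (rule poly_eqI_degree)
      fix y assume "y \<in> (of_nat ` {..n} :: complex set)"
      then obtain t where t: "y = of_nat t" "t \<le> n" by auto
      have "v (Some x) t = v (Some x0) t" using that x0 by simp
      then show "poly (q x) y = poly (q x0) y" using t by (simp add: val v_def)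
    next
      have "card (of_nat ` {..n} :: complex set) = Suc n" by (subst card_image) (auto simp: inj_on_def)
      then show "degree (q x) < card (of_nat ` {..n} :: complex set)" "degree (q x0) < card (of_nat ` {..n} :: complex set)"
        using deg[of x] deg[of x0] by auto
    qed
    have root: "poly (q x) (s 0 x) = 0" for x
      unfolding q_def poly_prod using n_pos by (intro prod_zero) (auto simp: X_Some s_simps intro!: bexI[of _ 0])
    interpret s0: field_hom "s 0" by (rule hom[OF n_pos])
    have "inj (s 0)" by (rule injI) simp
    then have "finite (s 0 -` {y. poly (q x0) y = 0})"
      using poly_roots_finite[OF nz[of x0]] by (intro finite_vimageI)
    moreover have "{P. v P = w} \<subseteq> insert None (Some ` (s 0 -` {y. poly (q x0) y = 0}))"
    proof
      fix P assume P: "P \<in> {P. v P = w}"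
      show "P \<in> insert None (Some ` (s 0 -` {y. poly (q x0) y = 0}))"
      proof (cases P)
        case (Some x)
        then have "q x = q x0" using P by (intro eq) simp
        then have "poly (q x0) (s 0 x) = 0" using root[of x] by simp
        then show ?thesis using Some by blast
      qed simp
    qed
    ultimately show ?thesis by (meson finite_imageI finite_insert finite_subset)
  qed
  have "{P. H P \<le> B} \<subseteq> (\<Union>w\<in>v ` {P. H P \<le> B}. {P. v P = w})" by auto
  then show ?thesis using fin fib by (meson finite_UN_I finite_subset)
qed

end

context nf_local
begin

lemma NR_D: "P \<noteq> Q \<Longrightarrow> NR (D P Q) = mfree (NZ (D P Q))"
  by (rule NR_A[OF D_A]) (simp add: D_eq_0)

text \<open>Each archimedean embedding spoils at most one of the points \<open>W j\<close> and each prime dividing \<open>m\<close>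
  at most \<open>n\<close> of them, so for some \<open>j\<close> the point \<open>Q\<close> is not close to \<open>W j\<close> anywhere outside \<open>R\<close>.\<close>
lemma exists_far_point:
  fixes W :: "nat \<Rightarrow> 'k option"
  defines "L \<equiv> n + card (prime_factors m) * n + 1"
  assumes inj: "inj_on W {..<L}"
  obtains c where "c > 0" "\<And>Q. Q \<notin> W ` {..<L} \<Longrightarrow> \<exists>j<L. c * H Q \<le> real (NR (D Q (W j)))"
proof -
  have W: "W j \<noteq> W k" if "j < L" "k < L" "j \<noteq> k" for j k
    using inj that by (auto simp: inj_on_def)
  define \<mu> where "\<mu> = 1 + (\<Sum>i<n. \<Sum>l<L. mx i (W l))"
  have mx0: "i < n \<Longrightarrow> 0 \<le> mx i P" for i P using mx_pos[of i P] by simp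
  have \<mu>: "mx i (W l) \<le> \<mu>" if i: "i < n" and l: "l < L" for i l
  proof -
    have "mx i (W l) \<le> (\<Sum>l<L. mx i (W l))"
      using i l mx0 by (intro member_le_sum) auto
    also have "\<dots> \<le> (\<Sum>i<n. \<Sum>l<L. mx i (W l))"
      using i mx0 by (intro member_le_sum[of i "{..<n}" "\<lambda>i. \<Sum>l<L. mx i (W l)"]) (auto intro!: sum_nonneg)
    finally show ?thesis by (simp add: \<mu>_def)
  qed
  have \<mu>1: "\<mu> > 0" unfolding \<mu>_def using mx0 by (intro add_pos_nonneg sum_nonneg) auto
  define T where "T = {t \<in> {..<n} \<times> {..<L} \<times> {..<L}. fst (snd t) \<noteq> snd (snd t)}"
  have "finite T" by (simp add: T_def)
  moreover have "norm (s (fst t) (D (W (fst (snd t))) (W (snd (snd t))))) > 0" if "t \<in> T" for t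
    using that W by (auto simp: T_def s_simps D_eq_0)
  ultimately obtain \<delta> where \<delta>: "\<delta> > 0" "\<And>t. t \<in> T \<Longrightarrow> \<delta> \<le> norm (s (fst t) (D (W (fst (snd t))) (W (snd (snd t)))))"
    using finite_pos_lower_bound[of T "\<lambda>t. norm (s (fst t) (D (W (fst (snd t))) (W (snd (snd t)))))"] by blast
  \<comment> \<open>Two points \<open>W j\<close>, \<open>W k\<close> both close to \<open>Q\<close>
    at one embedding would by the Pluecker relations force
    \<open>\<delta> * mx i Q < 2 * \<kappa> * \<mu> * mx i Q\<close>; for this value of
    \<open>\<kappa>\<close> the two sides agree.\<close>
  define \<kappa> where "\<kappa> = \<delta> / (2 * \<mu>)"
  have \<kappa>: "\<kappa> > 0" using \<delta>(1) \<mu>1 by (simp add: \<kappa>_def)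
  \<comment> \<open>By the Pluecker relations any two of the elements \<open>D Q (W j)\<close>
    generate an ideal containing this number, whatever \<open>Q\<close> is. Hence the exponents
    \<open>Bd p\<close> do not depend on \<open>Q\<close>.\<close>
  define \<Delta> where "\<Delta> = M0 * (\<Prod>t\<in>{t \<in> {..<L} \<times> {..<L}. fst t \<noteq> snd t}. nat \<bar>NZ (D (W (fst t)) (W (snd t)))\<bar>)"
  have NZ0: "NZ (D P Q) \<noteq> 0" if "P \<noteq> Q" for P Q
    using NZ_eq_0[OF D_A] that by (simp add: D_eq_0)
  have \<Delta>0: "\<Delta> > 0"
    unfolding \<Delta>_def using M0_pos W NZ0 by (auto intro!: prod_pos)
  define Bd where "Bd p = n * (n * multiplicity p \<Delta>)" for p :: nat
  define C where "C = (\<Prod>p\<in>prime_factors m. p ^ Bd p)"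
  have C0: "C > 0" unfolding C_def by (intro prod_pos) (auto simp: in_prime_factors_iff prime_gt_0_nat)
  show thesis
  proof (rule that)
    show "\<kappa> ^ n / real C > 0" using \<kappa> C0 by simp
  next
    fix Q assume Q: "Q \<notin> W ` {..<L}"
    then have QW: "Q \<noteq> W j" if "j < L" for j using that by blast
    define B1 where "B1 i = {j \<in> {..<L}. norm (s i (D Q (W j))) < \<kappa> * mx i Q}" for i
    define B2 where "B2 p = {j \<in> {..<L}. Bd p < multiplicity p (nat \<bar>NZ (D Q (W j))\<bar>)}" for p
    have B1: "card (B1 i) \<le> 1" if i: "i < n" for i
    proof -
      have "j = k" if jk: "j \<in> B1 i" "k \<in> B1 i" for j k
      proof (rule ccontr)
        assume ne: "j \<noteq> k"
        have jk': "j < L" "k < L" using jk by (auto simp: B1_def)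
        define a where "a = norm (s i (D Q (W j)))"
        define b where "b = norm (s i (D Q (W k)))"
        have ab: "a + b < 2 * \<kappa> * mx i Q" "a \<ge> 0" "b \<ge> 0" using jk by (auto simp: B1_def a_def b_def)
        define e where "e = norm (s i (D (W j) (W k)))"
        have e: "\<delta> \<le> e" using \<delta>(2)[of "(i, j, k)"] i jk' ne by (simp add: T_def e_def)
        have XY: "norm (s i (D Q (W k)) * s i u - s i (D Q (W j)) * s i v) \<le> (a + b) * \<mu>"
          if "norm (s i u) \<le> mx i (W j)" "norm (s i v) \<le> mx i (W k)" for u v
        proof -
          have "norm (s i (D Q (W k)) * s i u - s i (D Q (W j)) * s i v) \<le> b * norm (s i u) + a * norm (s i v)"
            unfolding a_def b_def by (metis norm_triangle_ineq4 norm_mult)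
          also have "\<dots> \<le> b * \<mu> + a * \<mu>"
            using that \<mu>[OF i jk'(1)] \<mu>[OF i jk'(2)] ab by (intro add_mono mult_left_mono) auto
          finally show ?thesis by (simp add: algebra_simps)
        qed
        have "e * norm (s i (X Q)) = norm (s i (D Q (W k)) * s i (X (W j)) - s i (D Q (W j)) * s i (X (W k)))"
          using arg_cong[OF pluecker(1)[of "W j" "W k" Q], of "s i"]
          by (simp add: e_def s_simps[OF i] flip: norm_mult)
        then have 1: "e * norm (s i (X Q)) \<le> (a + b) * \<mu>" using XY[OF mx_ge(1) mx_ge(1)] by simp
        have "e * norm (s i (Y Q)) = norm (s i (D Q (W k)) * s i (Y (W j)) - s i (D Q (W j)) * s i (Y (W k)))"
          using arg_cong[OF pluecker(2)[of "W j" "W k" Q], of "s i"]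
          by (simp add: e_def s_simps[OF i] flip: norm_mult)
        then have 2: "e * norm (s i (Y Q)) \<le> (a + b) * \<mu>" using XY[OF mx_ge(2) mx_ge(2)] by simp
        have "\<delta> * mx i Q \<le> e * mx i Q" using e mx0[OF i] by (intro mult_right_mono) auto
        also have "\<dots> \<le> (a + b) * \<mu>" using 1 2 by (simp add: mx_def max_def)
        also have "\<dots> < (2 * \<kappa> * mx i Q) * \<mu>" using ab(1) \<mu>1 by (rule mult_strict_right_mono)
        also have "\<dots> = \<delta> * mx i Q" using \<mu>1 by (simp add: \<kappa>_def)
        finally show False by simp
      qed
      moreover have "finite (B1 i)" by (simp add: B1_def)
      ultimately show ?thesis by (simp add: card_le_Suc0_iff_eq)
    qed
    have comax: "\<exists>a\<in>A. \<exists>b\<in>A. a * D Q (W j) + b * D Q (W k) = of_nat \<Delta>" if jk: "j < L" "k < L" "j \<noteq> k" for j k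
    proof -
      obtain a b where ab: "a \<in> A" "b \<in> A" "a * X Q + b * Y Q = of_nat M0" using almost_coprime by blast
      define E where "E = D (W j) (W k)"
      obtain u where u: "u \<in> A" "E * u = of_int (NZ E)" using norm_cofactor[OF D_A] unfolding E_def by blast
      define S where "S = {t \<in> {..<L} \<times> {..<L}. fst t \<noteq> snd t}"
      have "finite S" "(j, k) \<in> S" using jk by (auto simp: S_def)
      then have "\<Delta> = M0 * (nat \<bar>NZ E\<bar> * (\<Prod>t\<in>S - {(j, k)}. nat \<bar>NZ (D (W (fst t)) (W (snd t)))\<bar>))"
        unfolding \<Delta>_def S_def[symmetric] E_def by (subst prod.remove[of S "(j, k)"]) auto
      then obtain r where r: "\<Delta> = M0 * (nat \<bar>NZ E\<bar> * r)" by blast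
      have "of_nat (nat \<bar>NZ E\<bar>) = (of_int (sgn (NZ E)) * of_int (NZ E) :: 'k)"
      proof -
        have "int (nat \<bar>NZ E\<bar>) = sgn (NZ E) * NZ E" by (simp add: sgn_if)
        then have "(of_int (int (nat \<bar>NZ E\<bar>)) :: 'k) = of_int (sgn (NZ E) * NZ E)" by simp
        then show ?thesis by simp
      qed
      then have nE: "of_nat (nat \<bar>NZ E\<bar>) = of_int (sgn (NZ E)) * (E * u)" by (simp add: u(2))
      define t where "t = of_int (sgn (NZ E)) * u * of_nat r"
      have tA: "t \<in> A" using u(1) by (auto simp: t_def intro!: mult_A)
      have "of_nat \<Delta> = t * (E * (a * X Q + b * Y Q))"
        unfolding r ab(3) by (simp add: nE t_def mult_ac)
      also have "E * (a * X Q + b * Y Q) = a * (E * X Q) + b * (E * Y Q)" by (simp add: algebra_simps)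
      also have "\<dots> = a * (D Q (W k) * X (W j) - D Q (W j) * X (W k)) + b * (D Q (W k) * Y (W j) - D Q (W j) * Y (W k))"
        unfolding E_def pluecker[of "W j" "W k" Q] ..
      also have "t * \<dots> = (- (t * (a * X (W k) + b * Y (W k)))) * D Q (W j) + (t * (a * X (W j) + b * Y (W j))) * D Q (W k)"
        by (simp add: algebra_simps)
      finally have "(- (t * (a * X (W k) + b * Y (W k)))) * D Q (W j) + (t * (a * X (W j) + b * Y (W j))) * D Q (W k) = of_nat \<Delta>" ..
      moreover have "- (t * (a * X (W k) + b * Y (W k))) \<in> A" "t * (a * X (W j) + b * Y (W j)) \<in> A"
        using tA ab by (auto intro!: uminus_A mult_A add_A X_A Y_A)
      ultimately show ?thesis by blast
    qed
    have B2: "card (B2 p) \<le> n" if p: "p \<in> prime_factors m" for p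
    proof (rule ccontr)
      assume "\<not> card (B2 p) \<le> n"
      then have "Suc n \<le> card (B2 p)" by simp
      then obtain U where U: "U \<subseteq> B2 p" "card U = Suc n" "finite U" by (rule obtain_subset_with_card_n)
      obtain e where e: "bij_betw e {0..<Suc n} U" using ex_bij_betw_nat_finite[OF U(3)] U(2) by auto
      have eU: "e j \<in> B2 p" if "j \<le> n" for j using e U(1) that by (auto simp: bij_betw_def)
      then have eL: "e j < L" if "j \<le> n" for j using that by (auto simp: B2_def)
      have "\<exists>j\<le>n. multiplicity p (nat \<bar>NZ (D Q (W (e j)))\<bar>) \<le> n * (n * multiplicity p \<Delta>)"
      proof (rule not_all_highly_divisible[OF _ \<Delta>0])
        show "prime p" using p by auto
        show "D Q (W (e j)) \<noteq> 0" if "j \<le> n" for j using QW[OF eL[OF that]] by (simp add: D_eq_0)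
        show "\<exists>a\<in>A. \<exists>b\<in>A. a * D Q (W (e j)) + b * D Q (W (e k)) = of_nat \<Delta>" if "j \<le> n" "k \<le> n" "j \<noteq> k" for j k
        proof (rule comax[OF eL[OF that(1)] eL[OF that(2)]])
          show "e j \<noteq> e k" using e that by (auto simp: bij_betw_def inj_on_def)
        qed
      qed (rule D_A)
      then show False using eU unfolding B2_def Bd_def by fastforce
    qed
    define Bad where "Bad = (\<Union>i<n. B1 i) \<union> (\<Union>p\<in>prime_factors m. B2 p)"
    have "card Bad \<le> card (\<Union>i<n. B1 i) + card (\<Union>p\<in>prime_factors m. B2 p)"
      unfolding Bad_def by (rule card_Un_le)
    also have "card (\<Union>i<n. B1 i) \<le> (\<Sum>i<n. card (B1 i))" by (rule card_UN_le) simp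
    also have "\<dots> \<le> (\<Sum>i<n. 1)" using B1 by (intro sum_mono) auto
    also have "card (\<Union>p\<in>prime_factors m. B2 p) \<le> (\<Sum>p\<in>prime_factors m. card (B2 p))" by (rule card_UN_le) simp
    also have "\<dots> \<le> (\<Sum>p\<in>prime_factors m. n)" using B2 by (intro sum_mono) auto
    finally have "card Bad < L" by (simp add: L_def)
    moreover have "finite Bad" by (auto simp: Bad_def B1_def B2_def)
    ultimately have "\<not> {..<L} \<subseteq> Bad" using card_mono[of Bad "{..<L}"] by auto
    then obtain j where j: "j < L" "j \<notin> Bad" by auto
    have good1: "\<kappa> * mx i Q \<le> norm (s i (D Q (W j)))" if "i < n" for i
      using j that by (auto simp: Bad_def B1_def not_less)
    have good2: "multiplicity p (nat \<bar>NZ (D Q (W j))\<bar>) \<le> Bd p" if "p \<in> prime_factors m" for p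
    proof -
      have "j \<notin> B2 p" using j(2) that unfolding Bad_def by blast
      then show ?thesis using j(1) by (simp add: B2_def not_less)
    qed
    \<comment> \<open>The product formula in disguise: the archimedean lower bound for the norm of
      \<open>D Q (W j)\<close> passes to its factor prime to \<open>m\<close>, because the factor at
      the primes of \<open>m\<close> is at most \<open>C\<close>.\<close>
    have "\<kappa> ^ n * H Q = (\<Prod>i<n. \<kappa> * mx i Q)" by (simp add: prod.distrib H_def)
    also have "\<dots> \<le> Nm (D Q (W j))"
      unfolding Nm_alt using good1 \<kappa> mx0 by (intro prod_mono) auto
    also have "\<dots> = real (nat \<bar>NZ (D Q (W j))\<bar>)" by (simp add: Nm_NZ[OF D_A])
    also have "\<dots> = real (mpart (NZ (D Q (W j)))) * real (mfree (NZ (D Q (W j))))"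
      using mpart_mfree[OF NZ0[OF QW[OF j(1)]]] by simp
    also have "\<dots> \<le> real C * real (mfree (NZ (D Q (W j))))"
    proof (intro mult_right_mono)
      have "mpart (NZ (D Q (W j))) \<le> C"
        unfolding mpart_def C_def using good2
        by (intro prod_mono conjI power_increasing) (auto simp: in_prime_factors_iff Suc_le_eq prime_gt_0_nat)
      then show "real (mpart (NZ (D Q (W j)))) \<le> real C" by simp
    qed simp
    finally have "\<kappa> ^ n / real C * H Q \<le> real (NR (D Q (W j)))"
      using C0 NR_D[OF QW[OF j(1)]] by (simp add: field_simps)
    with j(1) show "\<exists>j<L. \<kappa> ^ n / real C * H Q \<le> real (NR (D Q (W j)))" by blast
  qed
qed

end

section \<open>Heights under the rational map\<close>

locale nf_dyn = nf_coords A n s M0 X Y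
  for A :: "'k::field_char_0 set" and n :: nat and s :: "nat \<Rightarrow> 'k \<Rightarrow> complex"
    and M0 :: nat and X Y :: "'k option \<Rightarrow> 'k" +
  fixes f g :: "'k poly" and d :: nat
  assumes f_A: "coeff f i \<in> A" and g_A: "coeff g i \<in> A"
    and cop: "coprime f g" and d_eq: "max (degree f) (degree g) = d" and d_ge: "d \<ge> 2"
begin

abbreviation phi :: "'k option \<Rightarrow> 'k option" where "phi \<equiv> rat_map f g"

definition F :: "'k option \<Rightarrow> 'k" where "F P = hform d f (X P) (Y P)"
definition G :: "'k option \<Rightarrow> 'k" where "G P = hform d g (X P) (Y P)"

text \<open>\<open>F P\<close> and \<open>G P\<close> are homogeneous coordinates of the image also
  at infinity, and coprimality prevents them from vanishing together. The factor \<open>l\<close>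
  measures their deviation from the selected coordinates.\<close>

lemma lambda_ex: "\<exists>l. l \<noteq> 0 \<and> F P = l * X (phi P) \<and> G P = l * Y (phi P)"
proof (cases P)
  case None
  have F: "F None = coeff f d * X None ^ d" and G: "G None = coeff g d * X None ^ d"
    by (simp_all add: F_def G_def Y_None hform_0)
  show ?thesis
  proof (cases "degree g < degree f")
    case True
    then have "coeff g d = 0" "coeff f d \<noteq> 0" using d_eq d_ge by (auto simp: coeff_eq_0)
    then show ?thesis using None True F G X_None Y_None
      by (intro exI[of _ "F None / X None"]) auto
  next
    case False
    then have dg: "degree g = d" using d_eq by auto
    have gd: "coeff g d \<noteq> 0" using dg d_ge by auto
    define y where "y = coeff f d / coeff g d"
    have ph: "phi P = Some y" using None False dg by (simp add: y_def)
    show ?thesis unfolding ph using None F G X_None gd Y_Some[of y]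
      by (intro exI[of _ "G None / Y (Some y)"]) (auto simp: X_Some y_def)
  qed
next
  case (Some x)
  have dle: "degree f \<le> d" "degree g \<le> d" using d_eq by auto
  have Y0: "Y P \<noteq> 0" and XP: "X P / Y P = x" using Some Y_Some[of x] X_Some[of x] by auto
  have F: "F P = Y P ^ d * poly f x" and G: "G P = Y P ^ d * poly g x"
    unfolding F_def G_def using hform_eq[OF dle(1) Y0, of "X P"] hform_eq[OF dle(2) Y0, of "X P"] XP by auto
  show ?thesis
  proof (cases "poly g x = 0")
    case True
    obtain u w where "u * f + w * g = 1" using poly_bezout[OF cop] by blast
    then have "poly (u * f + w * g) x = 1" by simp
    then have "poly f x \<noteq> 0" using True by auto
    then show ?thesis using Some True F G Y0 X_None Y_None by (intro exI[of _ "F P / X None"]) auto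
  next
    case False
    define y where "y = poly f x / poly g x"
    have ph: "phi P = Some y" using Some False by (simp add: y_def)
    show ?thesis unfolding ph using F G Y0 False Y_Some[of y]
      by (intro exI[of _ "G P / Y (Some y)"]) (auto simp: X_Some y_def)
  qed
qed

definition lam :: "'k option \<Rightarrow> 'k" where "lam P = (SOME l. l \<noteq> 0 \<and> F P = l * X (phi P) \<and> G P = l * Y (phi P))"

lemma lam: "lam P \<noteq> 0" "F P = lam P * X (phi P)" "G P = lam P * Y (phi P)"
  using someI_ex[OF lambda_ex[of P]] unfolding lam_def[symmetric] by blast+

lemma FG_A: "F P \<in> A" "G P \<in> A"
  unfolding F_def G_def using is_form_A[OF is_form_hform] f_A g_A X_A Y_A by blast+

lemma resultant:
  obtains \<rho> :: nat and e \<alpha> \<beta> \<alpha>' \<beta>' where "\<rho> > 0" "is_form e \<alpha>" "is_form e \<beta>" "is_form e \<alpha>'" "is_form e \<beta>'"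
    "\<And>P. \<alpha> (X P) (Y P) * F P + \<beta> (X P) (Y P) * G P = of_nat \<rho> * X P ^ (e + d)"
    "\<And>P. \<alpha>' (X P) (Y P) * F P + \<beta>' (X P) (Y P) * G P = of_nat \<rho> * Y P ^ (e + d)"
proof -
  have d1: "d \<ge> 1" using d_ge by simp
  obtain \<rho> :: nat and e \<alpha> \<beta> \<alpha>' \<beta>' where *: "\<rho> > 0" "is_form e \<alpha>" "is_form e \<beta>" "is_form e \<alpha>'" "is_form e \<beta>'"
    "\<And>x y. \<alpha> x y * hform d f x y + \<beta> x y * hform d g x y = of_nat \<rho> * x ^ (e + d)"
    "\<And>x y. \<alpha>' x y * hform d f x y + \<beta>' x y * hform d g x y = of_nat \<rho> * y ^ (e + d)"
    by (rule resultant_xy[OF f_A g_A cop d_eq d1]) (rule that)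
  show thesis by (rule that[OF *(1-5)]) (simp_all only: F_def G_def *(6,7))
qed

text \<open>\<open>lam P\<close> divides \<open>F P\<close> and \<open>G P\<close>, hence by the
  resultant identities \<open>\<rho> * X P ^ K\<close> and \<open>\<rho> * Y P ^ K\<close>, hence
  \<open>\<rho> * M0 ^ (K + K)\<close>. Conversely \<open>M0 * lam P\<close> is a combination of
  \<open>F P\<close> and \<open>G P\<close> over \<open>A\<close>. Both bounds are uniform in
  \<open>P\<close>.\<close>

lemma lambda_bound:
  obtains N0 :: nat where "N0 > 0" "\<And>P. of_nat N0 * lam P \<in> A" "\<And>P. of_nat N0 / lam P \<in> A"
proof -
  obtain \<rho> :: nat and e \<alpha> \<beta> \<alpha>' \<beta>' where r: "\<rho> > 0" "is_form e \<alpha>" "is_form e \<beta>" "is_form e \<alpha>'" "is_form e \<beta>'"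
    "\<And>P. \<alpha> (X P) (Y P) * F P + \<beta> (X P) (Y P) * G P = of_nat \<rho> * X P ^ (e + d)"
    "\<And>P. \<alpha>' (X P) (Y P) * F P + \<beta>' (X P) (Y P) * G P = of_nat \<rho> * Y P ^ (e + d)"
    by (rule resultant) (rule that)
  define K where "K = e + d"
  define N1 where "N1 = \<rho> * M0 ^ (K + K)"
  have 1: "of_nat M0 * lam P \<in> A" for P
  proof -
    obtain a b where ab: "a \<in> A" "b \<in> A" "a * X (phi P) + b * Y (phi P) = of_nat M0" using almost_coprime by blast
    have "of_nat M0 * lam P = a * F P + b * G P" unfolding lam(2,3) ab(3)[symmetric] by (simp add: algebra_simps)
    then show ?thesis using ab FG_A by (auto intro!: add_A mult_A)
  qed
  have 2: "of_nat N1 / lam P \<in> A" for P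
  proof -
    obtain a b where ab: "a \<in> A" "b \<in> A" "a * X P + b * Y P = of_nat M0" using almost_coprime by blast
    have "\<exists>p\<in>A. \<exists>q\<in>A. (a * X P + b * Y P) ^ (K + K) = p * (a * X P) ^ K + q * (b * Y P) ^ K"
    proof (rule binomial_in_powers)
      show "a * X P \<in> A" "b * Y P \<in> A" using ab by (auto intro: mult_A X_A Y_A)
    qed (auto intro: add_A mult_A)
    then obtain p q where pq: "p \<in> A" "q \<in> A" "of_nat M0 ^ (K + K) = p * (a * X P) ^ K + q * (b * Y P) ^ K"
      unfolding ab(3) by blast
    define x where "x = \<alpha> (X P) (Y P) * X (phi P) + \<beta> (X P) (Y P) * Y (phi P)"
    define y where "y = \<alpha>' (X P) (Y P) * X (phi P) + \<beta>' (X P) (Y P) * Y (phi P)"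
    have xy: "of_nat \<rho> * X P ^ K = lam P * x" "of_nat \<rho> * Y P ^ K = lam P * y"
      using r(6,7)[of P] unfolding K_def[symmetric] lam(2)[of P] lam(3)[of P] x_def y_def
      by (simp_all add: algebra_simps)
    have xyA: "x \<in> A" "y \<in> A"
      unfolding x_def y_def
      by (intro add_A mult_A X_A Y_A is_form_A[OF r(2)] is_form_A[OF r(3)] is_form_A[OF r(4)] is_form_A[OF r(5)])+
    have "of_nat N1 = p * a ^ K * (of_nat \<rho> * X P ^ K) + q * b ^ K * (of_nat \<rho> * Y P ^ K)"
      unfolding N1_def of_nat_mult of_nat_power pq(3) power_mult_distrib by (simp only: distrib_left mult_ac)
    also have "\<dots> = lam P * (p * a ^ K * x + q * b ^ K * y)" unfolding xy by (simp add: algebra_simps)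
    finally have "of_nat N1 / lam P = p * a ^ K * x + q * b ^ K * y" using lam(1) by simp
    then show ?thesis using pq ab xyA by (auto intro!: add_A mult_A power_A)
  qed
  show thesis
  proof (rule that[of "M0 * N1"])
    show "M0 * N1 > 0" using M0_pos r(1) by (simp add: N1_def)
    show "of_nat (M0 * N1) * lam P \<in> A" for P
      using mult_A[OF of_nat_A 1, of N1 P] by (simp add: mult_ac)
    show "of_nat (M0 * N1) / lam P \<in> A" for P
      using mult_A[OF of_nat_A 2, of M0 P] by simp
  qed
qed

definition hgt :: "'k option \<Rightarrow> real" where "hgt P = ln (H P)"

lemma hgt_nonneg: "hgt P \<ge> 0" using H_ge_1 by (simp add: hgt_def)

text \<open>At each embedding the larger of \<open>F P\<close> and \<open>G P\<close> is comparable
  with \<open>mx i P ^ d\<close>, from above by the size of the coefficients and from below by the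
  resultant identities. The product over the embeddings leaves the norm of \<open>lam P\<close>,
  which lies between \<open>1 / M\<close> and \<open>M\<close>.\<close>

lemma height_functorial:
  obtains c where "c \<ge> 0" "\<And>P. \<bar>hgt (phi P) - real d * hgt P\<bar> \<le> c"
proof -
  obtain \<rho> :: nat and e \<alpha> \<beta> \<alpha>' \<beta>' where r: "\<rho> > 0" "is_form e \<alpha>" "is_form e \<beta>" "is_form e \<alpha>'" "is_form e \<beta>'"
    "\<And>P. \<alpha> (X P) (Y P) * F P + \<beta> (X P) (Y P) * G P = of_nat \<rho> * X P ^ (e + d)"
    "\<And>P. \<alpha>' (X P) (Y P) * F P + \<beta>' (X P) (Y P) * G P = of_nat \<rho> * Y P ^ (e + d)"
    by (rule resultant) (rule that)
  obtain N0 :: nat where N0: "N0 > 0" "\<And>P. of_nat N0 * lam P \<in> A" "\<And>P. of_nat N0 / lam P \<in> A"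
    by (rule lambda_bound) (rule that)
  have ex: "\<exists>C\<ge>0. \<forall>P. \<forall>i<n. norm (s i (\<gamma> (X P) (Y P))) \<le> C * mx i P ^ l" if \<gamma>: "is_form l \<gamma>" for l \<gamma>
    using \<gamma> unfolding is_form_def mx_def by blast
  obtain C1 where C1: "C1 \<ge> 0" "\<And>P i. i < n \<Longrightarrow> norm (s i (F P)) \<le> C1 * mx i P ^ d"
    using ex[OF is_form_hform[of f d, OF f_A]] unfolding F_def by blast
  obtain C2 where C2: "C2 \<ge> 0" "\<And>P i. i < n \<Longrightarrow> norm (s i (G P)) \<le> C2 * mx i P ^ d"
    using ex[OF is_form_hform[of g d, OF g_A]] unfolding G_def by blast
  obtain E1 where E1: "E1 \<ge> 0" "\<And>P i. i < n \<Longrightarrow> norm (s i (\<alpha> (X P) (Y P))) \<le> E1 * mx i P ^ e" using ex[OF r(2)] by blast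
  obtain E2 where E2: "E2 \<ge> 0" "\<And>P i. i < n \<Longrightarrow> norm (s i (\<beta> (X P) (Y P))) \<le> E2 * mx i P ^ e" using ex[OF r(3)] by blast
  obtain E3 where E3: "E3 \<ge> 0" "\<And>P i. i < n \<Longrightarrow> norm (s i (\<alpha>' (X P) (Y P))) \<le> E3 * mx i P ^ e" using ex[OF r(4)] by blast
  obtain E4 where E4: "E4 \<ge> 0" "\<And>P i. i < n \<Longrightarrow> norm (s i (\<beta>' (X P) (Y P))) \<le> E4 * mx i P ^ e" using ex[OF r(5)] by blast
  define B where "B = C1 + C2 + 1"
  define E where "E = E1 + E2 + E3 + E4 + 1"
  define b where "b = real \<rho> / E"
  have Bpos: "B > 0" and Epos: "E > 0" using C1(1) C2(1) E1(1) E2(1) E3(1) E4(1) by (auto simp: B_def E_def)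
  have bpos: "b > 0" using Epos r(1) by (simp add: b_def)
  define T where "T i P = max (norm (s i (F P))) (norm (s i (G P)))" for i P
  have T_lam: "T i P = norm (s i (lam P)) * mx i (phi P)" if i: "i < n" for i P
    unfolding T_def lam(2,3) mx_def s_simps[OF i] norm_mult by (simp add: max_mult_distrib_left)
  have T_upper: "T i P \<le> B * mx i P ^ d" if i: "i < n" for i P
  proof -
    have m0: "mx i P ^ d \<ge> 0" using mx_pos[OF i, of P] by simp
    have "C1 * mx i P ^ d \<le> B * mx i P ^ d" "C2 * mx i P ^ d \<le> B * mx i P ^ d"
      using m0 C1(1) C2(1) by (auto simp: B_def intro!: mult_right_mono)
    then show ?thesis using C1(2)[OF i, of P] C2(2)[OF i, of P] by (simp add: T_def)
  qed
  have T_lower: "b * mx i P ^ d \<le> T i P" if i: "i < n" for i P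
  proof -
    have mpos: "mx i P > 0" by (rule mx_pos[OF i])
    have T0: "T i P \<ge> 0" by (simp add: T_def le_max_iff_disj)
    have comb: "norm (s i (u * F P + w * G P)) \<le> E * mx i P ^ e * T i P"
      if u: "norm (s i u) \<le> U * mx i P ^ e" and w: "norm (s i w) \<le> V * mx i P ^ e" and UV: "U + V \<le> E" for u w U V
    proof -
      have "norm (s i (u * F P + w * G P)) \<le> norm (s i u) * norm (s i (F P)) + norm (s i w) * norm (s i (G P))"
        unfolding s_simps[OF i] by (metis norm_triangle_ineq norm_mult)
      also have "\<dots> \<le> (U * mx i P ^ e) * T i P + (V * mx i P ^ e) * T i P"
        using u w by (intro add_mono mult_mono) (auto simp: T_def intro: order_trans[OF norm_ge_zero])
      also have "\<dots> = (U + V) * (mx i P ^ e * T i P)" by (simp add: algebra_simps)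
      also have "\<dots> \<le> E * (mx i P ^ e * T i P)" using UV T0 mpos by (intro mult_right_mono) auto
      finally show ?thesis by (simp add: mult.assoc)
    qed
    have nrm: "norm (s i (of_nat \<rho> * z ^ (e + d))) = real \<rho> * norm (s i z) ^ (e + d)" for z
      by (simp add: s_simps[OF i] norm_mult norm_power)
    have 1: "real \<rho> * norm (s i (X P)) ^ (e + d) \<le> E * mx i P ^ e * T i P"
      using comb[OF E1(2)[OF i] E2(2)[OF i]] E3(1) E4(1) unfolding r(6) nrm by (simp add: E_def)
    have 2: "real \<rho> * norm (s i (Y P)) ^ (e + d) \<le> E * mx i P ^ e * T i P"
      using comb[OF E3(2)[OF i] E4(2)[OF i]] E1(1) E2(1) unfolding r(7) nrm by (simp add: E_def)
    have "real \<rho> * mx i P ^ (e + d) \<le> E * mx i P ^ e * T i P"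
      using 1 2 by (simp add: mx_def max_def split: if_splits)
    then have "mx i P ^ e * (real \<rho> * mx i P ^ d) \<le> mx i P ^ e * (E * T i P)" by (simp add: power_add mult_ac)
    then have "real \<rho> * mx i P ^ d \<le> E * T i P" using mpos by simp
    then show ?thesis using Epos by (simp add: b_def field_simps)
  qed
  have prodT: "(\<Prod>i<n. T i P) = Nm (lam P) * H (phi P)" for P
    unfolding Nm_alt H_def prod.distrib[symmetric] by (intro prod.cong) (auto simp: T_lam)
  have up: "Nm (lam P) * H (phi P) \<le> B ^ n * H P ^ d" for P
  proof -
    have "(\<Prod>i<n. T i P) \<le> (\<Prod>i<n. B * mx i P ^ d)"
      using T_upper by (intro prod_mono) (auto simp: T_def le_max_iff_disj)
    then show ?thesis unfolding prodT by (simp add: prod.distrib H_def prod_power_distrib)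
  qed
  have lo: "b ^ n * H P ^ d \<le> Nm (lam P) * H (phi P)" for P
  proof -
    have "(\<Prod>i<n. b * mx i P ^ d) \<le> (\<Prod>i<n. T i P)"
      using T_lower bpos mx_pos by (intro prod_mono) (auto intro!: mult_nonneg_nonneg less_imp_le[OF bpos] zero_le_power less_imp_le)
    then show ?thesis unfolding prodT by (simp add: prod.distrib H_def prod_power_distrib)
  qed
  define M where "M = real N0 ^ n"
  have Mpos: "M > 0" using N0(1) by (simp add: M_def)
  have lamM: "1 / M \<le> Nm (lam P)" "Nm (lam P) \<le> M" and lampos: "Nm (lam P) > 0" for P
  proof -
    have "Nm (of_nat N0 * lam P) \<ge> 1" by (rule Nm_ge_1[OF N0(2)]) (use N0(1) lam(1) in simp)
    then show "1 / M \<le> Nm (lam P)" using Mpos by (simp add: Nm_simps M_def field_simps)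
    show lampos: "Nm (lam P) > 0" using Nm_simps(5,6)[of "lam P"] lam(1) by (simp add: less_le)
    have "Nm (of_nat N0 / lam P) \<ge> 1" by (rule Nm_ge_1[OF N0(3)]) (use N0(1) lam(1) in simp)
    then show "Nm (lam P) \<le> M" using lampos by (simp add: Nm_simps M_def field_simps)
  qed
  show thesis
  proof (rule that)
    show "0 \<le> \<bar>ln (B ^ n)\<bar> + \<bar>ln (b ^ n)\<bar> + \<bar>ln M\<bar>" by simp
    fix P
    have Hp: "H P > 0" "H (phi P) > 0" using H_ge_1[of P] H_ge_1[of "phi P"] by auto
    have "ln (Nm (lam P) * H (phi P)) \<le> ln (B ^ n * H P ^ d)"
      using up[of P] lampos[of P] Hp Bpos by (subst ln_le_cancel_iff) auto
    then have 1: "ln (Nm (lam P)) + hgt (phi P) \<le> ln (B ^ n) + real d * hgt P"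
      using lampos[of P] Hp Bpos by (simp add: ln_mult ln_realpow hgt_def)
    have "ln (b ^ n * H P ^ d) \<le> ln (Nm (lam P) * H (phi P))"
      using lo[of P] lampos[of P] Hp bpos by (subst ln_le_cancel_iff) auto
    then have 2: "ln (b ^ n) + real d * hgt P \<le> ln (Nm (lam P)) + hgt (phi P)"
      using lampos[of P] Hp bpos by (simp add: ln_mult ln_realpow hgt_def)
    have "ln (Nm (lam P)) \<le> ln M" "ln (1 / M) \<le> ln (Nm (lam P))"
      using lamM[of P] lampos[of P] Mpos by (subst ln_le_cancel_iff; simp)+
    moreover have "ln (1 / M) = - ln M" using Mpos by (simp add: ln_div)
    ultimately show "\<bar>hgt (phi P) - real d * hgt P\<bar> \<le> \<bar>ln (B ^ n)\<bar> + \<bar>ln (b ^ n)\<bar> + \<bar>ln M\<bar>"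
      using 1 2 by linarith
  qed
qed

end

section \<open>The orbit modulo prime powers\<close>

lemma (in nf_local) rdvd_power_diff:
  assumes "a \<in> R" "b \<in> R" "rdvd q (a - b)"
  shows "rdvd q (a ^ k - b ^ k)"
proof (induction k)
  case (Suc k)
  have "a ^ Suc k - b ^ Suc k = a * (a ^ k - b ^ k) + b ^ k * (a - b)" by (simp add: algebra_simps)
  also have "rdvd q \<dots>" using Suc assms by (intro rdvd_add rdvd_mult power_R)
  finally show ?case .
qed simp

lemma (in nf_local) rdvd_sum: "(\<And>i. i \<in> I \<Longrightarrow> rdvd q (h i)) \<Longrightarrow> rdvd q (sum h I)"
  by (induction I rule: infinite_finite_induct) (auto intro: rdvd_add)

text \<open>As \<open>N0\<close> divides \<open>m\<close>, all \<open>lam P\<close> are units of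
  \<open>R\<close>: the map has good reduction at every prime of \<open>R\<close>.\<close>

locale nf_full = nf_local A n s M0 X Y m + nf_dyn A n s M0 X Y f g d
  for A :: "'k::field_char_0 set" and n :: nat and s :: "nat \<Rightarrow> 'k \<Rightarrow> complex"
    and M0 :: nat and X Y :: "'k option \<Rightarrow> 'k" and m :: nat and f g :: "'k poly" and d :: nat +
  fixes N0 :: nat
  assumes N0: "N0 dvd m" "of_nat N0 * lam P \<in> A" "of_nat N0 / lam P \<in> A"
begin

lemma inverse_lam_R: "1 / lam P \<in> R"
proof -
  have "(of_nat N0 :: 'k) \<noteq> 0" using N0(1) m_pos by auto
  then have "1 / lam P = (1 / of_nat N0) * (of_nat N0 / lam P)" by simp
  then show ?thesis using mult_R[OF inverse_dvd_R[OF N0(1)] A_R[OF N0(3)]] by metis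
qed

text \<open>Modulo \<open>q\<close> the products \<open>x1 * y2\<close> and \<open>x2 * y1\<close>
  agree; once the common monomial is split off, what remains is the difference of their
  \<open>(j - i)\<close>-th powers.\<close>

lemma rdvd_monomials:
  assumes x: "x1 \<in> R" "y1 \<in> R" "x2 \<in> R" "y2 \<in> R" and q: "rdvd q (x1 * y2 - x2 * y1)" and le: "i \<le> j" "j \<le> d"
  shows "rdvd q ((x1 ^ i * y1 ^ (d - i)) * (x2 ^ j * y2 ^ (d - j)) - (x2 ^ i * y2 ^ (d - i)) * (x1 ^ j * y1 ^ (d - j)))"
proof -
  obtain k where k: "j = i + k" using le by (metis le_add_diff_inverse)
  obtain l where l: "d = i + k + l" using le k by (metis le_add_diff_inverse)
  have "(x1 ^ i * y1 ^ (d - i)) * (x2 ^ j * y2 ^ (d - j)) - (x2 ^ i * y2 ^ (d - i)) * (x1 ^ j * y1 ^ (d - j)) =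
    (x1 ^ i * x2 ^ i * y1 ^ l * y2 ^ l) * ((x2 * y1) ^ k - (x1 * y2) ^ k)"
    by (simp add: k l power_add power_mult_distrib algebra_simps)
  also have "rdvd q \<dots>"
  proof (intro rdvd_mult mult_R power_R x rdvd_power_diff)
    have "rdvd q (- (x1 * y2 - x2 * y1))" using q by (simp only: rdvd_uminus)
    then show "rdvd q (x2 * y1 - x1 * y2)" by simp
  qed
  finally show ?thesis .
qed

text \<open>\<open>F P * G Q - F Q * G P\<close> is a combination of minors of the vectors of degree
  \<open>d\<close> monomials, each divisible by \<open>q\<close>, and it equals
  \<open>D (phi P) (phi Q)\<close> up to the unit \<open>lam P * lam Q\<close>.\<close>

lemma rdvd_D_phi:
  assumes q: "rdvd q (D P Q)"
  shows "rdvd q (D (phi P) (phi Q))"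
proof -
  define u where "u i P = X P ^ i * Y P ^ (d - i)" for i P
  have trm: "rdvd q (u i P * u j Q - u i Q * u j P)" if "i \<le> d" "j \<le> d" for i j
  proof (cases "i \<le> j")
    case True
    then show ?thesis
      using rdvd_monomials[OF XY_R(1,2)[of P] XY_R(1,2)[of Q] q[unfolded D_def] True that(2)] by (simp add: u_def)
  next
    case False
    then have "j \<le> i" by simp
    have "rdvd q (D Q P)" using q by (simp add: rdvd_D_sym)
    from rdvd_monomials[OF XY_R(1,2)[of Q] XY_R(1,2)[of P] this[unfolded D_def] \<open>j \<le> i\<close> that(1)]
    show ?thesis by (simp add: u_def mult.commute)
  qed
  have F: "F P = (\<Sum>i\<le>d. coeff f i * u i P)" and G: "G P = (\<Sum>i\<le>d. coeff g i * u i P)" for P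
    by (simp_all add: F_def G_def hform_def u_def mult.assoc)
  have "F P * G Q - F Q * G P =
    (\<Sum>i\<le>d. \<Sum>j\<le>d. coeff f i * u i P * (coeff g j * u j Q)) - (\<Sum>i\<le>d. \<Sum>j\<le>d. coeff f i * u i Q * (coeff g j * u j P))"
    unfolding F G sum_product ..
  also have "\<dots> = (\<Sum>i\<le>d. \<Sum>j\<le>d. (coeff f i * coeff g j) * (u i P * u j Q - u i Q * u j P))"
    unfolding sum_subtractf[symmetric] by (intro sum.cong refl) (simp add: algebra_simps)
  finally have e: "F P * G Q - F Q * G P = \<dots>" .
  have "rdvd q (F P * G Q - F Q * G P)"
    unfolding e by (intro rdvd_sum rdvd_mult trm mult_R A_R f_A g_A) auto
  moreover have "F P * G Q - F Q * G P = lam P * lam Q * D (phi P) (phi Q)"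
    unfolding lam(2,3) D_def by (simp add: algebra_simps)
  ultimately have "rdvd q (lam P * lam Q * D (phi P) (phi Q))" by simp
  from rdvd_mult[OF rdvd_mult[OF this inverse_lam_R[of Q]] inverse_lam_R[of P]]
  show ?thesis using lam(1) by simp
qed

lemma rdvd_D_funpow: "rdvd q (D P Q) \<Longrightarrow> rdvd q (D ((phi ^^ k) P) ((phi ^^ k) Q))"
  by (induction k) (auto intro: rdvd_D_phi)

lemma funpow_shift: "(phi ^^ (a + b)) P = (phi ^^ a) ((phi ^^ b) P)"
  by (simp add: funpow_add)

text \<open>Modulo \<open>q\<close> the orbit of \<open>P\<close> is periodic from \<open>s\<close> on with period \<open>k\<close>, and \<open>z\<close> lies on the cycle.\<close>
lemma congruent_cycle:
  assumes q: "rdvd q (D ((phi ^^ (b + k)) P) ((phi ^^ b) P))" and z: "rdvd q (D ((phi ^^ t) P) z)" and t: "b \<le> t"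
  shows "rdvd q (D ((phi ^^ k) z) z)" and "k > 0 \<Longrightarrow> \<exists>i. rdvd q (D ((phi ^^ b) P) ((phi ^^ i) z))"
proof -
  have per: "rdvd q (D ((phi ^^ (j + k)) P) ((phi ^^ j) P))" if "b \<le> j" for j
  proof -
    have "(phi ^^ (j + k)) P = (phi ^^ (j - b)) ((phi ^^ (b + k)) P)"
      "(phi ^^ j) P = (phi ^^ (j - b)) ((phi ^^ b) P)"
      using that by (simp_all flip: funpow_shift)
    then show ?thesis using rdvd_D_funpow[OF q] by metis
  qed
  have kz: "rdvd q (D ((phi ^^ (t + k)) P) ((phi ^^ k) z))"
    using rdvd_D_funpow[OF z, of k] by (simp add: add.commute flip: funpow_shift)
  then have "rdvd q (D ((phi ^^ k) z) ((phi ^^ (t + k)) P))" by (simp only: rdvd_D_sym)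
  then show "rdvd q (D ((phi ^^ k) z) z)" using rdvd_D_trans rdvd_D_trans[OF per[OF t] z] by blast
  assume k: "k > 0"
  have "rdvd q (D ((phi ^^ (b + j * k)) P) ((phi ^^ b) P))" for j
  proof (induction j)
    case 0
    show ?case by (simp add: D_def)
  next
    case (Suc j)
    have "rdvd q (D ((phi ^^ (b + j * k + k)) P) ((phi ^^ (b + j * k)) P))" by (rule per) simp
    then have "rdvd q (D ((phi ^^ (b + j * k + k)) P) ((phi ^^ b) P))" using Suc by (rule rdvd_D_trans)
    then show ?case by (simp add: add_ac)
  qed
  from this[of t] have 1: "rdvd q (D ((phi ^^ b) P) ((phi ^^ (b + t * k)) P))" by (simp only: rdvd_D_sym)
  have "t * 1 \<le> t * k" using k by (intro mult_le_mono2) simp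
  then have "t \<le> b + t * k" unfolding mult_1_right by (rule trans_le_add2)
  then have "b + t * k = (b + t * k - t) + t" by (rule le_add_diff_inverse2[symmetric])
  then have "(phi ^^ (b + t * k)) P = (phi ^^ (b + t * k - t)) ((phi ^^ t) P)"
    by (metis funpow_shift)
  then have "rdvd q (D ((phi ^^ (b + t * k)) P) ((phi ^^ (b + t * k - t)) z))"
    using rdvd_D_funpow[OF z, of "b + t * k - t"] by simp
  then show "\<exists>i. rdvd q (D ((phi ^^ b) P) ((phi ^^ i) z))" using rdvd_D_trans[OF 1] by blast
qed

text \<open>Since \<open>d \<ge> 2\<close>, one step multiplies \<open>hgt P + c\<close> by at most
  \<open>d\<close> and \<open>hgt P - c\<close> by at least \<open>d\<close>, so the errors do not
  accumulate.\<close>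

lemma height_growth:
  assumes c: "c \<ge> 0" "\<And>P. \<bar>hgt (phi P) - real d * hgt P\<bar> \<le> c"
  shows "hgt ((phi ^^ k) P) \<le> real d ^ k * (hgt P + c)" "real d ^ k * (hgt P - c) \<le> hgt ((phi ^^ k) P) - c"
proof -
  have d2: "real d \<ge> 2" using d_ge by simp
  have dc: "2 * c \<le> real d * c" using d2 c(1) by (rule mult_right_mono)
  have "hgt ((phi ^^ k) P) + c \<le> real d ^ k * (hgt P + c)"
  proof (induction k)
    case (Suc k)
    have "hgt ((phi ^^ Suc k) P) + c \<le> real d * hgt ((phi ^^ k) P) + 2 * c"
      using c(2)[of "(phi ^^ k) P"] by simp
    also have "\<dots> \<le> real d * (hgt ((phi ^^ k) P) + c)" using dc by (simp add: algebra_simps)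
    also have "\<dots> \<le> real d * (real d ^ k * (hgt P + c))" using Suc d2 by (intro mult_left_mono) auto
    finally show ?case by simp
  qed simp
  then show "hgt ((phi ^^ k) P) \<le> real d ^ k * (hgt P + c)" using c(1) by linarith
  show "real d ^ k * (hgt P - c) \<le> hgt ((phi ^^ k) P) - c"
  proof (induction k)
    case (Suc k)
    have "real d ^ Suc k * (hgt P - c) \<le> real d * (hgt ((phi ^^ k) P) - c)"
      using mult_left_mono[OF Suc, of "real d"] d2 by (simp add: mult.assoc)
    also have "\<dots> \<le> real d * hgt ((phi ^^ k) P) - 2 * c" using dc by (simp add: algebra_simps)
    also have "\<dots> \<le> hgt ((phi ^^ Suc k) P) - c" using c(2)[of "(phi ^^ k) P"] by simp
    finally show ?case .
  qed simp
qed

lemma ln_NR_D_le: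
  assumes "P \<noteq> Q"
  shows "ln (real (NR (D P Q))) \<le> real n * ln 2 + hgt P + hgt Q"
proof -
  have D0: "D P Q \<noteq> 0" using assms by (simp add: D_eq_0)
  have N0: "NZ (D P Q) \<noteq> 0" using NZ_eq_0[OF D_A] D0 by blast
  have "NR (D P Q) \<le> nat \<bar>NZ (D P Q)\<bar>"
    unfolding NR_D[OF assms] mpart_mfree[OF N0] using mpart_pos[of "NZ (D P Q)"] by simp
  then have "real (NR (D P Q)) \<le> Nm (D P Q)" by (simp add: Nm_NZ[OF D_A])
  also have "\<dots> \<le> 2 ^ n * H P * H Q" by (rule Nm_D_le)
  finally have "ln (real (NR (D P Q))) \<le> ln (2 ^ n * H P * H Q)"
    using NR_pos[OF XY_R(3) D0] by (subst ln_le_cancel_iff) (auto intro: less_le_trans)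
  also have "\<dots> = real n * ln 2 + hgt P + hgt Q"
    using H_ge_1[of P] H_ge_1[of Q] by (simp add: hgt_def ln_mult ln_realpow)
  finally show ?thesis .
qed

lemma ln_NR_prod:
  assumes "finite I" "\<And>i. i \<in> I \<Longrightarrow> P i \<noteq> Q i"
  shows "ln (real (NR (\<Prod>i\<in>I. D (P i) (Q i)))) = (\<Sum>i\<in>I. ln (real (NR (D (P i) (Q i)))))"
  using assms
proof (induction I rule: finite_induct)
  case empty
  then show ?case by (simp add: NR_1)
next
  case (insert j I)
  have nz: "D (P j) (Q j) \<noteq> 0" "(\<Prod>i\<in>I. D (P i) (Q i)) \<noteq> 0"
    using insert by (auto simp: D_eq_0)
  have R: "(\<Prod>i\<in>I. D (P i) (Q i)) \<in> R" by (intro prod_R XY_R)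
  show ?case
    using insert NR_mult[OF XY_R(3) R nz] NR_pos[OF XY_R(3) nz(1)] NR_pos[OF R nz(2)]
    by (simp add: ln_mult)
qed

text \<open>The assumption \<open>near\<close> lets the point \<open>z\<close> vary with the prime,
  the precision and \<open>N\<close>; products over the finite set \<open>Z\<close> absorb this
  freedom.\<close>

lemma orbit_not_locally_near:
  fixes Z :: "'k option set" and P :: "'k option"
  defines "x \<equiv> \<lambda>k. (phi ^^ k) P"
  assumes Z: "finite Z" and inj: "inj x"
    and near: "\<And>p e N. rprime p \<Longrightarrow> \<exists>z\<in>Z. \<exists>t\<ge>N. rdvd (p ^ e) (D (x t) z)"
  shows False
proof -
  obtain c where c: "c \<ge> 0" "\<And>P. \<bar>hgt (phi P) - real d * hgt P\<bar> \<le> c" by (rule height_functorial) (rule that)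
  note growth = height_growth[OF c]
  define orb where "orb z = range (\<lambda>k. (phi ^^ k) z)" for z
  define Zi where "Zi = {z \<in> Z. infinite (orb z)}"
  define Cy where "Cy = (\<Union>z\<in>{z \<in> Z. finite (orb z)}. orb z)"
  have fin: "finite Zi" "finite Cy" using Z by (auto simp: Zi_def Cy_def)
  have orb_sub: "(phi ^^ k) z \<in> orb z" for k z by (auto simp: orb_def)
  have Zi: "(phi ^^ k) z \<noteq> z" if "z \<in> Zi" "k > 0" for z k
  proof
    assume e: "(phi ^^ k) z = z"
    have "(phi ^^ i) z = (phi ^^ (i mod k)) z" for i
    proof -
      have "(phi ^^ (j * k)) z = z" for j by (induction j) (auto simp: funpow_shift e)
      then have "(phi ^^ (i mod k + (i div k) * k)) z = (phi ^^ (i mod k)) z" unfolding funpow_shift by simp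
      then show ?thesis by simp
    qed
    then have "orb z \<subseteq> (\<lambda>i. (phi ^^ i) z) ` {..<k}"
      unfolding orb_def using that(2) by (metis (no_types, lifting) image_eqI image_subsetI lessThan_iff mod_less_divisor)
    then have "finite (orb z)" by (rule finite_subset) simp
    with that(1) show False by (simp add: Zi_def)
  qed
  have Cy: "x b \<noteq> w" if "w \<in> Cy" for b w
  proof
    assume e: "x b = w"
    obtain z where z: "finite (orb z)" "w \<in> orb z" using \<open>w \<in> Cy\<close> by (auto simp: Cy_def)
    then obtain l where l: "w = (phi ^^ l) z" by (auto simp: orb_def)
    have "x (k + b) \<in> orb z" for k
    proof -
      have "x (k + b) = (phi ^^ (k + l)) z" using e l by (simp add: x_def funpow_shift)
      then show ?thesis using orb_sub by simp
    qed
    then have "range (\<lambda>k. x (k + b)) \<subseteq> orb z" by auto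
    then have "finite (range (\<lambda>k. x (k + b)))" using z(1) by (rule finite_subset)
    moreover have "inj (\<lambda>k. x (k + b))" by (rule injI) (simp add: inj_eq[OF inj])
    ultimately show False using finite_imageD infinite_UNIV_nat by blast
  qed
  define Wz where "Wz k = (\<Prod>z\<in>Zi. D ((phi ^^ k) z) z)" for k
  define Wc where "Wc b = (\<Prod>w\<in>Cy. D (x b) w)" for b
  have WR: "Wz k \<in> R" "Wc b \<in> R" for k b unfolding Wz_def Wc_def by (intro prod_R XY_R)+
  have W0: "k > 0 \<Longrightarrow> Wz k \<noteq> 0" "Wc b \<noteq> 0" for k b
    unfolding Wz_def Wc_def using fin Zi Cy by (auto simp: D_eq_0)
  \<comment> \<open>Each prime power dividing the left side divides the factor that belongs to the
    point \<open>z\<close> near the orbit at that prime. For \<open>z\<close> with finite orbit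
    \<open>D ((phi ^^ k) z) z\<close> may vanish and the first product would be useless, so the
    second product takes over.\<close>
  have dvd: "rdvd (D (x (b + k)) (x b)) (Wz k * Wc b)" if k: "k > 0" for b k
  proof (rule rdvd_from_prime_powers)
    show "D (x (b + k)) (x b) \<in> R" by (rule XY_R)
    show "D (x (b + k)) (x b) \<noteq> 0" using k by (simp add: D_eq_0 inj_eq[OF inj])
    show "Wz k * Wc b \<in> R" by (intro mult_R WR)
    fix p e assume p: "rprime p" and q: "rdvd (p ^ e) (D (x (b + k)) (x b))"
    obtain z t where z: "z \<in> Z" "b \<le> t" "rdvd (p ^ e) (D (x t) z)" using near[OF p] by blast
    note cyc = congruent_cycle[OF q[unfolded x_def] z(3)[unfolded x_def] z(2)]
    show "rdvd (p ^ e) (Wz k * Wc b)"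
    proof (cases "z \<in> Zi")
      case True
      have "rdvd (p ^ e) (Wz k)" unfolding Wz_def using cyc(1) XY_R(3)
        by (intro rdvd_prod[OF fin(1) True])
      then have "rdvd (p ^ e) (Wc b * Wz k)" using WR by (intro rdvd_mult)
      then show ?thesis by (simp add: mult.commute)
    next
      case False
      obtain i where i: "rdvd (p ^ e) (D (x b) ((phi ^^ i) z))" using cyc(2)[OF k] by (auto simp: x_def)
      have iC: "(phi ^^ i) z \<in> Cy" using False z(1) orb_sub by (auto simp: Zi_def Cy_def)
      have "rdvd (p ^ e) (Wc b)" unfolding Wc_def using i XY_R(3)
        by (intro rdvd_prod[OF fin(2) iC])
      then show ?thesis using WR by (intro rdvd_mult)
    qed
  qed
  define \<kappa> where "\<kappa> = (\<Sum>z\<in>Zi. hgt z + c)"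
  define Cb where "Cb b = (\<Sum>z\<in>Zi. real n * ln 2 + hgt z) + (\<Sum>w\<in>Cy. real n * ln 2 + hgt (x b) + hgt w)" for b
  have \<kappa>0: "\<kappa> \<ge> 0" unfolding \<kappa>_def using c(1) hgt_nonneg by (intro sum_nonneg add_nonneg_nonneg)
  have Cb0: "Cb b \<ge> 0" for b unfolding Cb_def using hgt_nonneg by (intro add_nonneg_nonneg sum_nonneg) auto
  have upper: "ln (real (NR (D (x (b + k)) (x b)))) \<le> real d ^ k * \<kappa> + Cb b" if k: "k > 0" for b k
  proof -
    have nz: "D (x (b + k)) (x b) \<noteq> 0" using k by (simp add: D_eq_0 inj_eq[OF inj])
    have "NR (D (x (b + k)) (x b)) \<le> NR (Wz k * Wc b)"
      using dvd[OF k] W0(1)[OF k] W0(2) by (intro NR_le_of_rdvd XY_R) auto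
    also have "\<dots> = NR (Wz k) * NR (Wc b)" using WR W0(1)[OF k] W0(2) by (intro NR_mult)
    finally have le: "NR (D (x (b + k)) (x b)) \<le> NR (Wz k) * NR (Wc b)" .
    note pos = NR_pos[OF XY_R(3) nz]
    have "ln (real (NR (D (x (b + k)) (x b)))) \<le> ln (real (NR (Wz k) * NR (Wc b)))"
      using pos le less_le_trans[OF pos le] by (subst ln_le_cancel_iff) (simp_all only: of_nat_0_less_iff of_nat_le_iff)
    also have "\<dots> = ln (real (NR (Wz k))) + ln (real (NR (Wc b)))"
      using NR_pos[OF WR(1) W0(1)[OF k]] NR_pos[OF WR(2) W0(2)[of b]] by (simp add: ln_mult)
    also have "ln (real (NR (Wz k))) = (\<Sum>z\<in>Zi. ln (real (NR (D ((phi ^^ k) z) z))))"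
      unfolding Wz_def using fin(1) Zi[OF _ k] by (intro ln_NR_prod) auto
    also have "ln (real (NR (Wc b))) = (\<Sum>w\<in>Cy. ln (real (NR (D (x b) w))))"
      unfolding Wc_def using fin(2) Cy by (intro ln_NR_prod) auto
    also have "(\<Sum>z\<in>Zi. ln (real (NR (D ((phi ^^ k) z) z)))) \<le> (\<Sum>z\<in>Zi. real d ^ k * (hgt z + c) + (real n * ln 2 + hgt z))"
    proof (intro sum_mono)
      fix z assume "z \<in> Zi"
      from ln_NR_D_le[OF Zi[OF this k]] growth(1)[of k z]
      show "ln (real (NR (D ((phi ^^ k) z) z))) \<le> real d ^ k * (hgt z + c) + (real n * ln 2 + hgt z)" by linarith
    qed
    also have "(\<Sum>z\<in>Zi. real d ^ k * (hgt z + c) + (real n * ln 2 + hgt z)) =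
        real d ^ k * \<kappa> + (\<Sum>z\<in>Zi. real n * ln 2 + hgt z)"
      unfolding \<kappa>_def sum_distrib_left by (rule sum.distrib)
    also have "(\<Sum>w\<in>Cy. ln (real (NR (D (x b) w)))) \<le> (\<Sum>w\<in>Cy. real n * ln 2 + hgt (x b) + hgt w)"
      using Cy ln_NR_D_le by (intro sum_mono) blast
    finally show ?thesis by (simp only: Cb_def add.assoc)
  qed
  \<comment> \<open>Once the height exceeds \<open>c\<close>, the lower estimate in
    \<open>height_growth\<close> is genuinely exponential; Northcott finiteness supplies such a
    point of the infinite orbit.\<close>
  obtain t0 where t0: "hgt (x t0) \<ge> c + 1"
  proof -
    have "infinite (range x)" using inj finite_imageD infinite_UNIV_nat by blast
    moreover have "finite {P. H P \<le> exp (c + 1)}" by (rule northcott)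
    ultimately have "\<not> range x \<subseteq> {P. H P \<le> exp (c + 1)}" using finite_subset by blast
    then obtain t where "\<not> H (x t) \<le> exp (c + 1)" by auto
    then have "c + 1 \<le> hgt (x t)" unfolding hgt_def using H_ge_1[of "x t"] by (subst ln_ge_iff) auto
    then show thesis by (rule that)
  qed
  have d2: "real d \<ge> 2" using d_ge by simp
  have d_pow: "real u \<le> real d ^ u" for u
  proof -
    have "real u \<le> 2 ^ u" using less_exp[of u] by (metis less_imp_le of_nat_le_iff of_nat_numeral of_nat_power)
    also have "\<dots> \<le> real d ^ u" using d2 by (intro power_mono) auto
    finally show ?thesis .
  qed
  have low: "real d ^ u \<le> hgt (x (u + t0))" for u
  proof -
    have "real d ^ u * 1 \<le> real d ^ u * (hgt (x t0) - c)" using t0 d2 by (intro mult_left_mono) auto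
    also have "\<dots> \<le> hgt ((phi ^^ u) (x t0)) - c" by (rule growth(2))
    also have "(phi ^^ u) (x t0) = x (u + t0)" by (simp add: x_def funpow_shift)
    finally show ?thesis using c(1) by simp
  qed
  \<comment> \<open>As \<open>d ^ v \<ge> v\<close>, starting the list of points at
    \<open>b0 = v + t0\<close> gives \<open>hgt (x r) \<ge> d ^ (L + u) * (\<kappa> + 1)\<close>,
    whereas the divisibility bound has only the coefficient \<open>\<kappa>\<close>. The surplus
    \<open>d ^ (L + u)\<close> would have to stay bounded in \<open>u\<close>.\<close>
  obtain v :: nat where v: "real v \<ge> \<kappa> + 1" using real_arch_simple by blast
  define b0 where "b0 = v + t0"
  define L where "L = n + card (prime_factors m) * n + 1"
  have "inj_on (\<lambda>j. x (b0 + j)) {..<L}" by (simp add: inj_on_def inj_eq[OF inj])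
  then obtain c1 where c1: "c1 > 0"
    "\<And>Q. Q \<notin> (\<lambda>j. x (b0 + j)) ` {..<L} \<Longrightarrow> \<exists>j<L. c1 * H Q \<le> real (NR (D Q (x (b0 + j))))"
    using exists_far_point[of "\<lambda>j. x (b0 + j)"] unfolding L_def by blast
  define Cm where "Cm = (\<Sum>j<L. Cb (b0 + j))"
  have bound: "real d ^ (L + u) \<le> Cm - ln c1" for u
  proof -
    define r where "r = b0 + (L + u)"
    have "x r \<notin> (\<lambda>j. x (b0 + j)) ` {..<L}" by (auto simp: r_def inj_eq[OF inj])
    then obtain j where j: "j < L" "c1 * H (x r) \<le> real (NR (D (x r) (x (b0 + j))))" using c1(2) by blast
    define k where "k = r - (b0 + j)"
    have k: "k > 0" "r = b0 + j + k" "k \<le> L + u" using j(1) by (auto simp: k_def r_def)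
    have Hr: "H (x r) > 0" using H_ge_1[of "x r"] by linarith
    have pos: "0 < c1 * H (x r)" using c1(1) Hr by simp
    have "ln (c1 * H (x r)) \<le> ln (real (NR (D (x r) (x (b0 + j)))))"
      using pos j(2) less_le_trans[OF pos j(2)] by (subst ln_le_cancel_iff) assumption+
    then have "ln c1 + hgt (x r) \<le> real d ^ k * \<kappa> + Cb (b0 + j)"
      using upper[OF k(1), of "b0 + j"] c1(1) Hr unfolding k(2)[symmetric] by (simp add: ln_mult hgt_def)
    also have "Cb (b0 + j) \<le> Cm"
      unfolding Cm_def using j(1) Cb0 by (intro member_le_sum[of j "{..<L}" "\<lambda>j. Cb (b0 + j)"]) auto
    also have "real d ^ k * \<kappa> \<le> real d ^ (L + u) * \<kappa>"
      using d2 k(3) \<kappa>0 by (intro mult_right_mono power_increasing) auto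
    finally have 1: "ln c1 + hgt (x r) \<le> real d ^ (L + u) * \<kappa> + Cm" by simp
    have "r = (L + u + v) + t0" by (simp add: r_def b0_def)
    then have "real d ^ (L + u + v) \<le> hgt (x r)" using low[of "L + u + v"] by simp
    moreover have "real d ^ (L + u) * (\<kappa> + 1) \<le> real d ^ (L + u) * real d ^ v"
      using order_trans[OF v d_pow[of v]] d2 by (intro mult_left_mono) auto
    ultimately have "real d ^ (L + u) * (\<kappa> + 1) \<le> hgt (x r)" by (simp add: power_add)
    with 1 show ?thesis by (simp add: algebra_simps)
  qed
  obtain u :: nat where "real u > Cm - ln c1" using reals_Archimedean2 by blast
  with bound[of u] d_pow[of "L + u"] show False by simp
qed

end

section \<open>Return to the adelic statement\<close>

lemma rat_map_smult: "c \<noteq> 0 \<Longrightarrow> rat_map (Polynomial.smult c f) (Polynomial.smult c g) P = rat_map f g P"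
  by (cases P) auto

text \<open>Allows finitely many orbit points to be excluded from a neighbourhood, one coordinate
  for each.\<close>

lemma openin_P1_topology_neq:
  assumes "v \<in> places"
  shows "openin (P1_topology v) {y. y \<noteq> x0}"
proof -
  obtain a where a: "nontrivial_abs_val a" "v = {b. nontrivial_abs_val b \<and> equiv_abs_val a b}"
    using assms unfolding places_def by blast
  have "a \<in> v" using a unfolding equiv_abs_val_def
    by (auto intro!: exI[of _ 1] simp: nontrivial_abs_val_def is_abs_val_def)
  define b where "b = (SOME a. a \<in> v)"
  have "b \<in> v" unfolding b_def by (rule someI[of "\<lambda>a. a \<in> v", OF \<open>a \<in> v\<close>])
  then have b: "is_abs_val b" unfolding a(2) nontrivial_abs_val_def by blast
  have pos: "chordal b x x0 > 0" if "x \<noteq> x0" for x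
  proof -
    have 1: "b (y - z) > 0" if "y \<noteq> z" for y z using b that unfolding is_abs_val_def by (metis less_eq_real_def right_minus_eq)
    have 2: "max 1 (b y) > 0" for y by (simp add: less_max_iff_disj)
    show ?thesis using that 1 2 by (cases x; cases x0) auto
  qed
  have "openin (P1_topology_abs b) {y. y \<noteq> x0}"
    unfolding openin_P1_topology_abs using pos by force
  then show ?thesis by (simp only: P1_topology_def b_def)
qed

theorem theorem1:
  fixes f g :: "'k::field_char_0 poly"
    and S :: "('k \<Rightarrow> real) set set"
    and Z :: "'k option set"
    and P :: "'k option"
  assumes "is_number_field TYPE('k)"
    and "finite S" and "S \<subseteq> places"
    and "coprime f g" and "max (degree f) (degree g) \<ge> 2"
    and "finite Z"
  shows "diag (places - S) ` (orbit (rat_map f g) P \<inter> Z) =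
         (product_topology P1_topology (places - S)) closure_of
           (diag (places - S) ` orbit (rat_map f g) P)
         \<inter> PiE (places - S) (\<lambda>_. Z)"
proof -
  obtain A :: "'k set" and n s where "nf_order A n s" by (rule nf_order_exists[OF assms(1)])
  then interpret nf_order A n s .
  obtain M0 X Y where "nf_coords A n s M0 X Y" by (rule nf_coords_exist)
  then interpret co: nf_coords A n s M0 X Y .
  obtain k :: nat where k: "k > 0" "\<And>i. coeff (Polynomial.smult (of_nat k) f) i \<in> A"
    "\<And>i. coeff (Polynomial.smult (of_nat k) g) i \<in> A" by (rule poly_common_denom) (rule that)
  define f' where "f' = Polynomial.smult (of_nat k) f"
  define g' where "g' = Polynomial.smult (of_nat k) g"
  define d where "d = max (degree f') (degree g')"
  have k0: "(of_nat k :: 'k) \<noteq> 0" using k(1) by simp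
  have cop: "coprime f' g'"
  proof (rule coprimeI)
    fix h assume "h dvd f'" "h dvd g'"
    then have "h dvd f" "h dvd g" using k0 unfolding f'_def g'_def by (auto dest: dvd_smult_cancel)
    then show "is_unit h" by (rule coprime_common_divisor[OF assms(4)])
  qed
  have dyn: "nf_dyn A n s M0 X Y f' g' d"
  proof unfold_locales
    show "2 \<le> d" using assms(5) k0 by (simp add: d_def f'_def g'_def)
  qed (use k cop in \<open>auto simp: f'_def g'_def d_def\<close>)
  interpret dy: nf_dyn A n s M0 X Y f' g' d by (rule dyn)
  obtain N0 :: nat where N0: "N0 > 0" "\<And>P. of_nat N0 * dy.lam P \<in> A" "\<And>P. of_nat N0 / dy.lam P \<in> A"
    by (rule dy.lambda_bound) (rule that)
  \<comment> \<open>At a finite place this holds for the positive integers in its maximal ideal. The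
    choice \<open>kk\<close> falls back to 1 where there is none, in particular at archimedean
    places.\<close>
  define bad where "bad v k \<longleftrightarrow> k > 0 \<and> (\<exists>a\<in>v. (\<forall>j::nat. a (of_nat j) \<le> 1) \<and> a (of_nat k) < 1)"
    for v :: "('k \<Rightarrow> real) set" and k :: nat
  define kk where "kk v = (if \<exists>k. bad v k then SOME k. bad v k else 1)" for v
  have kk: "bad v (kk v)" if "bad v j" for v j
    unfolding kk_def using that someI[of "bad v" j] by auto
  have kk_pos: "kk v > 0" for v
  proof (cases "\<exists>j. bad v j")
    case True
    then show ?thesis using kk unfolding bad_def by blast
  qed (simp add: kk_def)
  \<comment> \<open>\<open>M0\<close> provides Bezout identities in \<open>R\<close>,
    \<open>N0\<close> good reduction, and the factors \<open>kk v\<close> ensure that no prime of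
    \<open>R\<close> induces a place of \<open>S\<close>.\<close>
  define m where "m = M0 * N0 * (\<Prod>v\<in>S. kk v)"
  have "m > 0" using co.M0_pos N0(1) kk_pos by (simp add: m_def prod_pos)
  then interpret nf_full A n s M0 X Y m f' g' d N0
    by unfold_locales (use N0 in \<open>auto simp: m_def\<close>)
  have phi: "rat_map f' g' = rat_map f g"
    unfolding f'_def g'_def by (rule ext) (rule rat_map_smult[OF k0])
  define I where "I = (places - S :: ('k \<Rightarrow> real) set set)"
  have place_I: "place p \<in> I" if p: "rprime p" for p
  proof -
    have "\<exists>a\<in>v. a (of_nat m) < 1"
      if v: "v \<in> S" and ex: "\<exists>a\<in>v. (\<forall>j::nat. a (of_nat j) \<le> 1) \<and> (\<exists>k::nat>0. a (of_nat k) < 1)" for v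
    proof -
      have "\<exists>j. bad v j" using ex unfolding bad_def by blast
      then obtain a where a: "a \<in> v" "\<forall>j::nat. a (of_nat j) \<le> 1" "a (of_nat (kk v)) < 1"
        using kk unfolding bad_def by blast
      have "is_abs_val a"
        using a(1) v assms(3) unfolding places_def nontrivial_abs_val_def by blast
      then have mult: "a (x * y) = a x * a y" and nonneg: "a x \<ge> 0" for x y unfolding is_abs_val_def by auto
      have "kk v dvd m" using v assms(2) by (auto simp: m_def dvd_prod_eqI)
      then obtain r where "m = kk v * r" by (elim dvdE)
      then have "a (of_nat m) = a (of_nat (kk v)) * a (of_nat r)" by (simp add: mult)
      also have "\<dots> \<le> a (of_nat (kk v)) * 1" using a(2) nonneg by (intro mult_left_mono) auto
      finally have "a (of_nat m) < 1" using a(3) by linarith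
      with a(1) show ?thesis by blast
    qed
    from place_notin[OF p this] show ?thesis using place_in_places[OF p] by (simp add: I_def)
  qed
  obtain p0 where p0: "rprime p0" by (rule rprime_ex)
  define T where "T = product_topology P1_topology I"
  have topT: "topspace T = PiE I (\<lambda>_. UNIV)" by (simp add: T_def topspace_P1_topology)
  define O' where "O' = orbit (rat_map f g) P"
  have sub: "diag I ` O' \<subseteq> topspace T" by (auto simp: topT diag_def)
  have "z \<in> diag I ` (O' \<inter> Z)" if z: "z \<in> T closure_of (diag I ` O')" "z \<in> PiE I (\<lambda>_. Z)" for z
  proof -
    have zT: "z \<in> topspace T" using z(1) by (simp add: in_closure_of)
    have "\<exists>y\<in>O'. z = diag I y"
    proof (rule ccontr)
      assume none: "\<not> ?thesis"
      have "\<forall>y\<in>O'. \<exists>v. v \<in> I \<and> z v \<noteq> y"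
      proof (rule ballI, rule ccontr)
        fix y assume y: "y \<in> O'" and "\<not> (\<exists>v. v \<in> I \<and> z v \<noteq> y)"
        then have "z = diag I y" using z(2) by (intro ext) (auto simp: diag_def PiE_def extensional_def)
        with none y show False by blast
      qed
      from bchoice[OF this] obtain w where w: "\<And>y. y \<in> O' \<Longrightarrow> w y \<in> I" "\<And>y. y \<in> O' \<Longrightarrow> z (w y) \<noteq> y" by blast
      \<comment> \<open>The neighbourhood of \<open>z\<close> imposes the congruence at
        \<open>place p\<close> and avoids each of the finitely many \<open>y\<close> in
        \<open>E\<close> at the coordinate \<open>w y\<close>. Excluding arbitrary finite sets is
        what yields arbitrarily late orbit points.\<close>
      have near: "\<exists>y\<in>O'. y \<notin> E \<and> rdvd (p ^ e) (co.D (z (place p)) y)"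
        if E: "finite E" "E \<subseteq> O'" and p: "rprime p" for E p e
      proof -
        define U where "U v B = {x \<in> topspace T. x v \<in> B}" for v :: "('k \<Rightarrow> real) set" and B :: "'k option set"
        have U_open: "openin T (U v B)" if "v \<in> I" "openin (P1_topology v) B" for v B
        proof -
          have "continuous_map T (P1_topology v) (\<lambda>x. x v)"
            unfolding T_def by (rule continuous_map_product_projection[OF that(1)])
          then show ?thesis unfolding U_def by (rule openin_continuous_map_preimage[OF _ that(2)])
        qed
        define B0 where "B0 = {Q. rdvd (p ^ e) (co.D (z (place p)) Q)}"
        define FF where "FF = insert (U (place p) B0) ((\<lambda>y. U (w y) {x. x \<noteq> y}) ` E)"
        have "openin T (\<Inter> FF)"
        proof (rule openin_Inter)
          show "finite FF" "FF \<noteq> {}" using E(1) by (auto simp: FF_def)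
          fix V assume "V \<in> FF"
          then consider "V = U (place p) B0" | y where "y \<in> E" "V = U (w y) {x. x \<noteq> y}" by (auto simp: FF_def)
          then show "openin T V"
          proof cases
            case 1
            then show ?thesis unfolding B0_def using U_open[OF place_I[OF p] openin_congruence_class[OF p]] by simp
          next
            case 2
            then have wI: "w y \<in> I" using w(1) E(2) by blast
            then have "w y \<in> places" by (simp add: I_def)
            from U_open[OF wI openin_P1_topology_neq[OF this]] show ?thesis using 2(2) by simp
          qed
        qed
        moreover have "z \<in> \<Inter> FF"
        proof -
          have "z (place p) \<in> B0" by (simp add: B0_def co.D_def)
          then show ?thesis using zT w(2) E(2) by (auto simp: FF_def U_def)
        qed
        ultimately obtain y where y: "y \<in> O'" "diag I y \<in> \<Inter> FF"
          using z(1) unfolding in_closure_of by blast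
        have "diag I y (place p) \<in> B0" using y(2) by (simp add: FF_def U_def)
        then have "rdvd (p ^ e) (co.D (z (place p)) y)" using place_I[OF p] by (simp add: B0_def diag_def)
        moreover have "y \<notin> E"
        proof
          assume "y \<in> E"
          then have "diag I y (w y) \<noteq> y" using y(2) by (auto simp: FF_def U_def)
          then show False using w(1)[OF y(1)] by (simp add: diag_def)
        qed
        ultimately show ?thesis using y(1) by blast
      qed
      define x where "x k = (rat_map f g ^^ k) P" for k
      have Ox: "O' = range x" by (auto simp: O'_def orbit_def x_def)
      \<comment> \<open>A finite orbit could itself serve as \<open>E\<close>, leaving no point at
        all; so the case of a preperiodic \<open>P\<close> is settled here.\<close>
      have "infinite O'" using near[of O' p0 0] p0 by blast
      have "inj x"
      proof (rule linorder_injI)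
        fix i j :: nat assume ij: "i < j"
        show "x i \<noteq> x j"
        proof
          assume e: "x i = x j"
          have "x k \<in> x ` {..<j}" for k
          proof (induction k rule: less_induct)
            case (less k)
            show ?case
            proof (cases "k < j")
              case False
              then have "x k = (rat_map f g ^^ (k - j)) (x j)" by (simp add: x_def flip: funpow_add[unfolded o_def, THEN fun_cong])
              also have "\<dots> = x (k - j + i)" unfolding e[symmetric] by (simp add: x_def funpow_add)
              finally show ?thesis using less[of "k - j + i"] False ij by simp
            qed simp
          qed
          then have "O' \<subseteq> x ` {..<j}" unfolding Ox by blast
          then show False using \<open>infinite O'\<close> finite_subset by blast
        qed
      qed
      have near': "\<exists>z\<in>Z. \<exists>t\<ge>N. rdvd (p ^ e) (co.D (x t) z)" if p: "rprime p" for p e N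
      proof -
        have "x ` {..<N} \<subseteq> O'" by (auto simp: Ox)
        from near[OF _ this p, of e] obtain y where y: "y \<in> O'" "y \<notin> x ` {..<N}" "rdvd (p ^ e) (co.D (z (place p)) y)" by auto
        then obtain t where t: "y = x t" by (auto simp: Ox)
        have "N \<le> t" using y(2) t by (auto simp: not_less[symmetric])
        moreover have "z (place p) \<in> Z" using z(2) place_I[OF p] by (auto simp: PiE_def)
        moreover have "rdvd (p ^ e) (co.D (x t) (z (place p)))" using y(3) t by (simp add: rdvd_D_sym)
        ultimately show ?thesis by blast
      qed
      show False
        by (rule orbit_not_locally_near[OF assms(6), of P]) (use \<open>inj x\<close> near' in \<open>simp_all add: phi x_def[abs_def]\<close>)
    qed
    then obtain y where y: "y \<in> O'" "z = diag I y" by blast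
    \<comment> \<open>Membership in \<open>Z\<close> is read off at one coordinate, so the existence
      of a place outside \<open>S\<close> enters.\<close>
    have "diag I y (place p0) \<in> Z" using z(2) place_I[OF p0] unfolding y(2) by (rule PiE_mem)
    then have "y \<in> Z" using place_I[OF p0] by (simp add: diag_def)
    with y show ?thesis by blast
  qed
  moreover have "diag I ` (O' \<inter> Z) \<subseteq> T closure_of (diag I ` O')"
    using closure_of_subset[OF sub] by blast
  moreover have "diag I ` (O' \<inter> Z) \<subseteq> PiE I (\<lambda>_. Z)" by (auto simp: diag_def)
  ultimately show ?thesis unfolding T_def O'_def I_def by blast
qed

end
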